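(* Let $(M_1,g_1)$ and $(M_2,g_2)$ be pseudo-Riemannian manifolds, let $f\colon M_1\to(0,\infty)$ be smooth, and let $M=M_1\times_f M_2$ be the warped product manifold with metric $g=g_1\oplus f^2g_2$. Assume that the concircular curvature tensor $\mathcal C$ of $(M,g)$ is divergence free. Then: (1) the concircular curvature tensor $\mathcal C^1$ of $(M_1,g_1)$ is divergence free if $$\mathcal R^1(X_1,Y_1,\mathrm{grad} f,Z_1)=Y_1(f)\,\mathcal F(X_1,Z_1)-X_1(f)\,\mathcal F(Y_1,Z_1)$$ for all vector fields $X_1,Y_1,Z_1$ on $M_1$; (2) the concircular curvature tensor $\mathcal C^2$ of $(M_2,g_2)$ is divergence free; and (3) $f$ is constant or $(M_2,g_2)$ is Einstein.
   Context: The warped product metric is $g=\pi_1^*(g_1)+(f\circ\pi_1)^2\pi_2^*(g_2)$ on $M_1\times M_2$, with $\pi_i$ the natural projections. The curvature convention is $\mathcal R(X,Y)Z=\nabla_Y\nabla_XZ-\nabla_X\nabla_YZ+\nabla_{[X,Y]}Z$ and $\mathcal R(X,Y,Z,V)=g(\mathcal R(X,Y)Z,V)$. The concircular curvature tensor of an $n$-dimensional pseudo-Riemannian manifold ($n\ge 3$) with metric $g$ and scalar curvature $\tau$ is $\mathcal C(X,Y,Z,V)=\mathcal R(X,Y,Z,V)-\frac{\tau}{n(n-1)}[g(X,Z)g(Y,V)-g(Y,Z)g(X,V)]$; it is divergence free if $\nabla^{l}\mathcal C_{ijkl}=0$. $\mathcal R^1$ is the curvature tensor of $(M_1,g_1)$,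 $\mathrm{grad} f$ and $H^f(Y_1,Z_1)=g_1(\nabla^1_{Y_1}\mathrm{grad} f,Z_1)$ are the gradient and Hessian of $f$ on $(M_1,g_1)$, with $\nabla^1$ the Levi-Civita connection of $g_1$, and $\mathcal F=\frac1f H^f$. $(M_2,g_2)$ is Einstein if its Ricci tensor is a constant multiple of $g_2$.
   Formalization: M_1 is assumed connected and both manifolds nonempty; without connectedness (3) fails, e.g. M_1 = two copies of R with f = 1 and f = 2 and M_2 = S^2 x R. *)

theory Defs
  imports "HOL-Analysis.Analysis"
begin

section \<open>Smooth functions between normed spaces\<close>

primrec Ck_on :: "nat \<Rightarrow> 'e::real_normed_vector set \<Rightarrow> ('e \<Rightarrow> 'f::real_normed_vector) \<Rightarrow> bool" where
  "Ck_on 0 S h \<longleftrightarrow> continuous_on S h"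
| "Ck_on (Suc k) S h \<longleftrightarrow>
     (\<forall>x\<in>S. h differentiable (at x)) \<and> (\<forall>v. Ck_on k S (\<lambda>x. frechet_derivative h (at x) v))"

text \<open>Only used for open \<open>S\<close> in a finite-dimensional space.\<close>

definition smooth_on :: "'e::real_normed_vector set \<Rightarrow> ('e \<Rightarrow> 'f::real_normed_vector) \<Rightarrow> bool" where
  "smooth_on S h \<longleftrightarrow> (\<forall>k. Ck_on k S h)"


section \<open>Smooth manifolds, tangent vectors, vector fields\<close>

text \<open>A chart is a domain together with a coordinate map; the values of the map outside of the domain
  are irrelevant. The underlying space of an atlas is the union of its chart domains, and the
  dimension is \<open>DIM('e)\<close>.\<close>

type_synonym ('p, 'e) chart = "'p set \<times> ('p \<Rightarrow> 'e)"

definition chart_image :: "('p, 'e) chart \<Rightarrow> 'e set" where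
  "chart_image c = snd c ` fst c"

definition chart_inv :: "('p, 'e) chart \<Rightarrow> 'e \<Rightarrow> 'p" where
  "chart_inv c = inv_into (fst c) (snd c)"

definition points :: "('p, 'e) chart set \<Rightarrow> 'p set" where
  "points A = (\<Union>c\<in>A. fst c)"

definition smooth_manifold ::
  "('p::{t2_space,second_countable_topology}, 'e::euclidean_space) chart set \<Rightarrow> bool" where
  "smooth_manifold A \<longleftrightarrow>
     points A \<noteq> {} \<and>
     (\<forall>c\<in>A. open (fst c) \<and> open (chart_image c) \<and>
        homeomorphism (fst c) (chart_image c) (snd c) (chart_inv c)) \<and>
     (\<forall>c\<in>A. \<forall>d\<in>A. smooth_on (snd c ` (fst c \<inter> fst d)) (snd d \<circ> chart_inv c))"

definition smooth_function :: "('p, 'e::euclidean_space) chart set \<Rightarrow> ('p \<Rightarrow> real) \<Rightarrow> bool" where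
  "smooth_function A h \<longleftrightarrow> (\<forall>c\<in>A. smooth_on (chart_image c) (h \<circ> chart_inv c))"

text \<open>A tangent vector at \<open>p\<close> is the operator of directional differentiation at \<open>p\<close>, acting on the
  functions that are differentiable at \<open>p\<close> and extended by \<open>0\<close> to all other functions.
  \<open>coord_vec c p v\<close> is the vector with components \<open>v\<close> in the chart \<open>c\<close>; for \<open>v \<in> Basis\<close> it is a
  coordinate vector of \<open>c\<close>. Compatible charts give the same tangent space.\<close>

type_synonym 'p tangent = "('p \<Rightarrow> real) \<Rightarrow> real"

definition coord_vec :: "('p, 'e::euclidean_space) chart \<Rightarrow> 'p \<Rightarrow> 'e \<Rightarrow> 'p tangent" where
  "coord_vec c p v = (\<lambda>h. if (h \<circ> chart_inv c) differentiable (at (snd c p))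
     then frechet_derivative (h \<circ> chart_inv c) (at (snd c p)) v else 0)"

definition tangent_space :: "('p, 'e::euclidean_space) chart set \<Rightarrow> 'p \<Rightarrow> 'p tangent set" where
  "tangent_space A p = {coord_vec c p v |c v. c \<in> A \<and> p \<in> fst c}"

definition pushforward :: "('p \<Rightarrow> 'q) \<Rightarrow> 'p tangent \<Rightarrow> 'q tangent" where
  "pushforward F X = (\<lambda>h. X (h \<circ> F))"

text \<open>The local representative of a vector field: the component along \<open>b\<close> is the derivative of the
  coordinate function belonging to \<open>b\<close>.\<close>

definition coord_field ::
  "('p, 'e::euclidean_space) chart \<Rightarrow> ('p \<Rightarrow> 'p tangent) \<Rightarrow> 'e \<Rightarrow> 'e" where
  "coord_field c X x = (\<Sum>b\<in>Basis. X (chart_inv c x) (\<lambda>q. snd c q \<bullet> b) *\<^sub>R b)"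

definition vector_field ::
  "('p, 'e::euclidean_space) chart set \<Rightarrow> ('p \<Rightarrow> 'p tangent) \<Rightarrow> bool" where
  "vector_field A X \<longleftrightarrow>
     (\<forall>p\<in>points A. X p \<in> tangent_space A p) \<and>
     (\<forall>c\<in>A. smooth_on (chart_image c) (coord_field c X))"

definition product_atlas ::
  "('p, 'e) chart set \<Rightarrow> ('q, 'f) chart set \<Rightarrow> ('p \<times> 'q, 'e \<times> 'f) chart set" where
  "product_atlas A B = {(fst c \<times> fst d, map_prod (snd c) (snd d)) |c d. c \<in> A \<and> d \<in> B}"


section \<open>Pseudo-Riemannian metrics and warped products\<close>

type_synonym 'p metric_field = "'p \<Rightarrow> 'p tangent \<Rightarrow> 'p tangent \<Rightarrow> real"

definition coord_metric ::
  "('p, 'e::euclidean_space) chart \<Rightarrow> 'p metric_field \<Rightarrow> 'e \<Rightarrow> 'e \<Rightarrow> 'e \<Rightarrow> real" where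
  "coord_metric c g x u v =
     g (chart_inv c x) (coord_vec c (chart_inv c x) u) (coord_vec c (chart_inv c x) v)"

definition pseudo_riemannian_metric ::
  "('p, 'e::euclidean_space) chart set \<Rightarrow> 'p metric_field \<Rightarrow> bool" where
  "pseudo_riemannian_metric A g \<longleftrightarrow>
     (\<forall>p\<in>points A.
        (\<forall>X\<in>tangent_space A p. \<forall>Y\<in>tangent_space A p. g p X Y = g p Y X) \<and>
        (\<forall>X\<in>tangent_space A p. \<forall>Y\<in>tangent_space A p. \<forall>Z\<in>tangent_space A p. \<forall>a b.
           g p (\<lambda>h. a * X h + b * Y h) Z = a * g p X Z + b * g p Y Z) \<and>
        (\<forall>X\<in>tangent_space A p. (\<forall>Y\<in>tangent_space A p. g p X Y = 0) \<longrightarrow> X = (\<lambda>h. 0))) \<and>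
     (\<forall>c\<in>A. \<forall>u v. smooth_on (chart_image c) (\<lambda>x. coord_metric c g x u v))"

definition pseudo_riemannian_manifold ::
  "('p::{t2_space,second_countable_topology}, 'e::euclidean_space) chart set \<Rightarrow>
     'p metric_field \<Rightarrow> bool" where
  "pseudo_riemannian_manifold A g \<longleftrightarrow> smooth_manifold A \<and> pseudo_riemannian_metric A g"

definition pullback_metric :: "('p \<Rightarrow> 'q) \<Rightarrow> 'q metric_field \<Rightarrow> 'p metric_field" where
  "pullback_metric F g p X Y = g (F p) (pushforward F X) (pushforward F Y)"

definition warped_metric ::
  "'p metric_field \<Rightarrow> ('p \<Rightarrow> real) \<Rightarrow> 'q metric_field \<Rightarrow> ('p \<times> 'q) metric_field" where
  "warped_metric g1 f g2 r X Y =
     pullback_metric fst g1 r X Y + ((f \<circ> fst) r)\<^sup>2 * pullback_metric snd g2 r X Y"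


section \<open>Tensor calculus in a coordinate domain\<close>

text \<open>In this section \<open>G x u v\<close> is the value at \<open>x\<close> of a metric on an open set of \<open>'e\<close>, and a vector
  field is a function \<open>'e \<Rightarrow> 'e\<close>. Coordinate indices are the elements \<open>i\<close> of \<open>Basis\<close>, and the
  coordinate field belonging to \<open>i\<close> is \<open>\<lambda>_. i\<close>.\<close>

type_synonym 'e lmetric = "'e \<Rightarrow> 'e \<Rightarrow> 'e \<Rightarrow> real"

definition sharp :: "'e lmetric \<Rightarrow> 'e \<Rightarrow> ('e \<Rightarrow> real) \<Rightarrow> 'e::euclidean_space" where
  "sharp G x \<alpha> = (THE w. \<forall>z. G x w z = \<alpha> z)"

definition inv_metric :: "'e lmetric \<Rightarrow> 'e \<Rightarrow> 'e \<Rightarrow> 'e::euclidean_space \<Rightarrow> real" where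
  "inv_metric G x i j = sharp G x (\<lambda>z. z \<bullet> i) \<bullet> j"

definition metric_trace :: "'e lmetric \<Rightarrow> 'e \<Rightarrow> ('e \<Rightarrow> 'e::euclidean_space \<Rightarrow> real) \<Rightarrow> real" where
  "metric_trace G x T = (\<Sum>i\<in>Basis. \<Sum>j\<in>Basis. inv_metric G x i j * T i j)"

text \<open>The Levi-Civita connection, through the Christoffel symbols
  \<open>\<Gamma>\<^sup>k\<^sub>i\<^sub>j = g\<^sup>k\<^sup>l (\<partial>\<^sub>i g\<^sub>j\<^sub>l + \<partial>\<^sub>j g\<^sub>i\<^sub>l - \<partial>\<^sub>l g\<^sub>i\<^sub>j) / 2\<close>; here \<open>christoffel G x i j \<bullet> k\<close> is \<open>\<Gamma>\<^sup>k\<^sub>i\<^sub>j\<close>.\<close>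

definition christoffel :: "'e lmetric \<Rightarrow> 'e \<Rightarrow> 'e \<Rightarrow> 'e \<Rightarrow> 'e::euclidean_space" where
  "christoffel G x u v = sharp G x (\<lambda>z.
     (frechet_derivative (\<lambda>y. G y v z) (at x) u
      + frechet_derivative (\<lambda>y. G y u z) (at x) v
      - frechet_derivative (\<lambda>y. G y u v) (at x) z) / 2)"

definition nabla :: "'e lmetric \<Rightarrow> ('e \<Rightarrow> 'e) \<Rightarrow> ('e \<Rightarrow> 'e) \<Rightarrow> 'e \<Rightarrow> 'e::euclidean_space" where
  "nabla G X Y x = frechet_derivative Y (at x) (X x) + christoffel G x (X x) (Y x)"

definition lie_bracket :: "('e \<Rightarrow> 'e) \<Rightarrow> ('e \<Rightarrow> 'e) \<Rightarrow> 'e \<Rightarrow> 'e::euclidean_space" where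
  "lie_bracket X Y x = frechet_derivative Y (at x) (X x) - frechet_derivative X (at x) (Y x)"

text \<open>The sign convention is \<open>R(X,Y)Z = \<nabla>\<^sub>Y \<nabla>\<^sub>X Z - \<nabla>\<^sub>X \<nabla>\<^sub>Y Z + \<nabla>\<^bsub>[X,Y]\<^esub> Z\<close>, so that
  \<open>R(X,Y,X,Y) > 0\<close> on round spheres.\<close>

definition curvature ::
  "'e lmetric \<Rightarrow> ('e \<Rightarrow> 'e) \<Rightarrow> ('e \<Rightarrow> 'e) \<Rightarrow> ('e \<Rightarrow> 'e) \<Rightarrow> 'e \<Rightarrow> 'e::euclidean_space" where
  "curvature G X Y Z x =
     nabla G Y (nabla G X Z) x - nabla G X (nabla G Y Z) x + nabla G (lie_bracket X Y) Z x"

definition curvature4 ::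
  "'e lmetric \<Rightarrow> ('e \<Rightarrow> 'e) \<Rightarrow> ('e \<Rightarrow> 'e) \<Rightarrow> ('e \<Rightarrow> 'e) \<Rightarrow> ('e \<Rightarrow> 'e) \<Rightarrow> 'e::euclidean_space \<Rightarrow> real"
  where "curvature4 G X Y Z V x = G x (curvature G X Y Z x) (V x)"

definition riemann :: "'e lmetric \<Rightarrow> 'e \<Rightarrow> 'e \<Rightarrow> 'e \<Rightarrow> 'e \<Rightarrow> 'e::euclidean_space \<Rightarrow> real" where
  "riemann G x i j k l = curvature4 G (\<lambda>_. i) (\<lambda>_. j) (\<lambda>_. k) (\<lambda>_. l) x"

text \<open>\<open>R\<^sub>i\<^sub>k = g\<^sup>j\<^sup>l R\<^sub>i\<^sub>j\<^sub>k\<^sub>l\<close>; with the sign convention above this is \<open>(n-1) g\<^sub>i\<^sub>k\<close> on the unit sphere.\<close>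

definition ricci :: "'e lmetric \<Rightarrow> 'e \<Rightarrow> 'e \<Rightarrow> 'e::euclidean_space \<Rightarrow> real" where
  "ricci G x i k = metric_trace G x (\<lambda>j l. riemann G x i j k l)"

definition scalar_curvature :: "'e lmetric \<Rightarrow> 'e::euclidean_space \<Rightarrow> real" where
  "scalar_curvature G x = metric_trace G x (ricci G x)"

text \<open>If \<open>n = 1\<close>, the coefficient is \<open>0\<close> by the convention \<open>a / 0 = 0\<close>, and all terms vanish.\<close>

definition concircular :: "'e lmetric \<Rightarrow> 'e \<Rightarrow> 'e \<Rightarrow> 'e \<Rightarrow> 'e \<Rightarrow> 'e::euclidean_space \<Rightarrow> real" where
  "concircular G x i j k l =
     riemann G x i j k l
     - scalar_curvature G x / (real DIM('e) * (real DIM('e) - 1))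
       * (G x i k * G x j l - G x j k * G x i l)"

text \<open>\<open>nabla4 G T x m i j k l\<close> is \<open>\<nabla>\<^sub>m T\<^sub>i\<^sub>j\<^sub>k\<^sub>l\<close>.\<close>

definition nabla4 ::
  "'e lmetric \<Rightarrow> ('e \<Rightarrow> 'e \<Rightarrow> 'e \<Rightarrow> 'e \<Rightarrow> 'e \<Rightarrow> real) \<Rightarrow>
     'e \<Rightarrow> 'e \<Rightarrow> 'e \<Rightarrow> 'e \<Rightarrow> 'e \<Rightarrow> 'e::euclidean_space \<Rightarrow> real" where
  "nabla4 G T x m i j k l =
     frechet_derivative (\<lambda>y. T y i j k l) (at x) m
     - T x (christoffel G x m i) j k l
     - T x i (christoffel G x m j) k l
     - T x i j (christoffel G x m k) l
     - T x i j k (christoffel G x m l)"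

definition div4 ::
  "'e lmetric \<Rightarrow> ('e \<Rightarrow> 'e \<Rightarrow> 'e \<Rightarrow> 'e \<Rightarrow> 'e \<Rightarrow> real) \<Rightarrow>
     'e \<Rightarrow> 'e \<Rightarrow> 'e \<Rightarrow> 'e::euclidean_space \<Rightarrow> real" where
  "div4 G T x i j k = metric_trace G x (\<lambda>m l. nabla4 G T x m i j k l)"

definition gradient :: "'e lmetric \<Rightarrow> ('e \<Rightarrow> real) \<Rightarrow> 'e \<Rightarrow> 'e::euclidean_space" where
  "gradient G h x = sharp G x (frechet_derivative h (at x))"

definition hessian ::
  "'e lmetric \<Rightarrow> ('e \<Rightarrow> real) \<Rightarrow> ('e \<Rightarrow> 'e) \<Rightarrow> ('e \<Rightarrow> 'e) \<Rightarrow> 'e::euclidean_space \<Rightarrow> real" where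
  "hessian G h Y Z x = G x (nabla G Y (gradient G h) x) (Z x)"


section \<open>Tensor conditions on manifolds\<close>

text \<open>The tensors above are invariant under changes of coordinates; a tensor equation on a manifold
  is the corresponding equation in every chart of the atlas.\<close>

definition concircular_divergence_free ::
  "('p, 'e::euclidean_space) chart set \<Rightarrow> 'p metric_field \<Rightarrow> bool" where
  "concircular_divergence_free A g \<longleftrightarrow>
     (\<forall>c\<in>A. \<forall>x\<in>chart_image c. \<forall>i\<in>Basis. \<forall>j\<in>Basis. \<forall>k\<in>Basis.
        div4 (coord_metric c g) (concircular (coord_metric c g)) x i j k = 0)"

definition einstein :: "('p, 'e::euclidean_space) chart set \<Rightarrow> 'p metric_field \<Rightarrow> bool" where
  "einstein A g \<longleftrightarrow>
     (\<exists>\<mu>::real. \<forall>c\<in>A. \<forall>x\<in>chart_image c. \<forall>i\<in>Basis. \<forall>j\<in>Basis.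
        ricci (coord_metric c g) x i j = \<mu> * coord_metric c g x i j)"

text \<open>The values at \<open>p\<close>, computed in a chart \<open>c\<close> around \<open>p\<close>, of \<open>R(X, Y, grad f, Z)\<close> and of
  \<open>F(X, Y) = H\<^sup>f(X, Y) / f\<close>.\<close>

definition curvature_grad ::
  "('p, 'e::euclidean_space) chart \<Rightarrow> 'p metric_field \<Rightarrow> ('p \<Rightarrow> real) \<Rightarrow>
     ('p \<Rightarrow> 'p tangent) \<Rightarrow> ('p \<Rightarrow> 'p tangent) \<Rightarrow> ('p \<Rightarrow> 'p tangent) \<Rightarrow> 'p \<Rightarrow> real" where
  "curvature_grad c g f X Y Z p =
     curvature4 (coord_metric c g) (coord_field c X) (coord_field c Y)
       (gradient (coord_metric c g) (f \<circ> chart_inv c)) (coord_field c Z) (snd c p)"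

definition normalized_hessian ::
  "('p, 'e::euclidean_space) chart \<Rightarrow> 'p metric_field \<Rightarrow> ('p \<Rightarrow> real) \<Rightarrow>
     ('p \<Rightarrow> 'p tangent) \<Rightarrow> ('p \<Rightarrow> 'p tangent) \<Rightarrow> 'p \<Rightarrow> real" where
  "normalized_hessian c g f X Y p =
     1 / f p * hessian (coord_metric c g) (f \<circ> chart_inv c)
                 (coord_field c X) (coord_field c Y) (snd c p)"

end

theory Submission
  imports Defs
begin

text \<open>The second Bianchi identity turns the divergence of the curvature tensor into the Codazzi defect
  \<open>\<nabla>\<^sub>j R\<^sub>i\<^sub>k - \<nabla>\<^sub>i R\<^sub>j\<^sub>k\<close> of the Ricci tensor, whose trace over \<open>i, k\<close> is \<open>\<partial>\<^sub>j \<tau> / 2\<close>. If \<open>\<C>\<close> is divergence free,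
  the same trace is \<open>\<partial>\<^sub>j \<tau> / n\<close>, so \<open>\<tau>\<close> is locally constant for \<open>n \<ge> 3\<close> and the Ricci tensor is a Codazzi
  tensor; conversely, a Codazzi Ricci tensor makes \<open>\<C>\<close> divergence free in every dimension.

  The Ricci tensor of a warped product is \<open>Ric\<^sub>1 - (n\<^sub>2 / f) H\<^sup>f\<close> on the base and \<open>Ric\<^sub>2 - \<psi> g\<^sub>2\<close> on the fibre,
  with a function \<open>\<psi>\<close> on the base, and its mixed part vanishes. The Codazzi equation with three
  horizontal arguments yields the claim about the base, because the antisymmetrised derivative of
  \<open>H\<^sup>f\<close> is \<open>R\<^sup>1(\<cdot>, \<cdot>, grad f, \<cdot>)\<close>; with three vertical arguments it is the Codazzi equation of the fibre; and
  with one horizontal argument \<open>X\<close> it expresses \<open>X(f) Ric\<^sub>2\<close> as a multiple of \<open>g\<^sub>2\<close> whose factor depends on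
  the base point only. Bump functions extend a tangent vector to a global vector field, so that the
  hypothesis on vector fields can be used at a single point.\<close>


section \<open>Calculus of smooth functions\<close>

text \<open>\<open>sharp\<close> is a definite description, so its regularity is not immediate, yet
  connection, curvature and gradient are all built from it. Smoothness comes from a perturbation
  equation around a fixed point and a bootstrap: locally bounded, continuous, differentiable, and
  then all orders, because every directional derivative of a \<open>sharp\<close> is again a
  \<open>sharp\<close>. Tensor identities are proved for vectors, not for fields; that the curvature
  is a tensor is checked once, in \<open>curvature_eq\<close>. Contractions with the metric are
  turned into ordinary traces of endomorphisms. Thus the inverse metric is never differentiated, and
  the Ricci tensor of a warped product splits along the two halves of the product basis. Only the
  total space is assumed to have dimension at least 3, so the passage from divergence to Codazzi
  takes place there; the factors, possibly of dimension 1 or 2, only see the converse. One base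
  point and one direction serve all fibre charts, which makes the Einstein factor a single number;
  connectedness of the base is what upgrades local constancy of \<open>f\<close>.\<close>

abbreviation fderiv :: "('a::real_normed_vector \<Rightarrow> 'b::real_normed_vector) \<Rightarrow> 'a \<Rightarrow> 'a \<Rightarrow> 'b"
  where "fderiv h x \<equiv> frechet_derivative h (at x)"

lemma has_derivative_fderiv: "h differentiable (at x) \<Longrightarrow> (h has_derivative fderiv h x) (at x)"
  by (simp add: frechet_derivative_works)

lemma fderiv_eqI: "(h has_derivative h') (at x) \<Longrightarrow> fderiv h x = h'"
  by (metis frechet_derivative_at)

text \<open>Holds also where no derivative exists: functions that agree near \<open>x\<close> have
  the same derivatives there, so the choice operator behind \<open>frechet_derivative\<close> picks
  the same map.\<close>

lemma fderiv_cong: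
  assumes "open S" "x \<in> S" "\<And>y. y \<in> S \<Longrightarrow> f y = g y"
  shows "fderiv f x = fderiv g x"
proof -
  have "(f has_derivative L) (at x) \<longleftrightarrow> (g has_derivative L) (at x)" for L
    using has_derivative_transform_within_open[OF _ assms(1,2)] assms(3) by metis
  then show ?thesis unfolding frechet_derivative_def by simp
qed

lemma differentiable_cong:
  assumes "open S" "x \<in> S" "\<And>y. y \<in> S \<Longrightarrow> f y = g y"
  shows "f differentiable (at x) \<longleftrightarrow> g differentiable (at x)"
  using has_derivative_transform_within_open[OF _ assms(1,2), of f _ UNIV g]
    has_derivative_transform_within_open[OF _ assms(1,2), of g _ UNIV f] assms(3)
  unfolding differentiable_def by auto

lemma Ck_on_cong:
  assumes "open S" "\<And>y. y \<in> S \<Longrightarrow> f y = g y"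
  shows "Ck_on k S f \<longleftrightarrow> Ck_on k S g"
  using assms
proof (induction k arbitrary: f g)
  case 0
  then show ?case using continuous_on_cong by (metis Ck_on.simps(1))
next
  case (Suc k)
  have "fderiv f x = fderiv g x" if "x \<in> S" for x using fderiv_cong[OF Suc.prems(1) that] Suc.prems(2) by blast
  then have "Ck_on k S (\<lambda>x. fderiv f x v) \<longleftrightarrow> Ck_on k S (\<lambda>x. fderiv g x v)" for v
    by (intro Suc.IH) (use Suc.prems in auto)
  moreover have "f differentiable (at x) \<longleftrightarrow> g differentiable (at x)" if "x \<in> S" for x
    using differentiable_cong[OF Suc.prems(1) that] Suc.prems(2) by blast
  ultimately show ?case by simp
qed

text \<open>Lets an inductive proof name the derivative by a formula \<open>h'\<close>, which is
  rewritten only inside the open set \<open>S\<close>; the rules for sums, products and compositions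
  go through it.\<close>

lemma Ck_on_SucI:
  assumes "open S" "\<And>x. x \<in> S \<Longrightarrow> (h has_derivative h' x) (at x)" "\<And>v. Ck_on k S (\<lambda>x. h' x v)"
  shows "Ck_on (Suc k) S h"
proof -
  have "Ck_on k S (\<lambda>x. fderiv h x v)" for v
    using Ck_on_cong[OF assms(1), of "\<lambda>x. fderiv h x v" "\<lambda>x. h' x v"] assms(2,3) fderiv_eqI by metis
  then show ?thesis using assms(2) by (auto simp: differentiable_def)
qed

lemma Ck_on_Suc_imp: "Ck_on (Suc k) S h \<Longrightarrow> Ck_on k S h"
proof (induction k arbitrary: h)
  case 0
  then show ?case by (auto intro!: continuous_at_imp_continuous_on differentiable_imp_continuous_within)
next
  case (Suc k)
  then show ?case by (meson Ck_on.simps(2))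
qed

lemma Ck_on_const: "Ck_on k S (\<lambda>x. c)"
  by (induction k arbitrary: c) auto

lemma Ck_on_add:
  assumes "open S" "Ck_on k S f" "Ck_on k S g" shows "Ck_on k S (\<lambda>x. f x + g x)"
  using assms(2,3)
proof (induction k arbitrary: f g)
  case 0 then show ?case by (auto intro: continuous_intros)
next
  case (Suc k)
  show ?case
    by (rule Ck_on_SucI[OF assms(1), where h' = "\<lambda>x v. fderiv f x v + fderiv g x v"])
      (use Suc in \<open>auto intro!: has_derivative_add has_derivative_fderiv\<close>)
qed

lemma Ck_on_linear:
  assumes "open S" "bounded_linear L" "Ck_on k S f" shows "Ck_on k S (\<lambda>x. L (f x))"
  using assms(3)
proof (induction k arbitrary: f)
  case 0 then show ?case using assms(2) by (auto intro: bounded_linear.continuous_on)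
next
  case (Suc k)
  show ?case
  proof (rule Ck_on_SucI[OF assms(1), where h' = "\<lambda>x v. L (fderiv f x v)"])
    fix x assume "x \<in> S"
    then show "((\<lambda>x. L (f x)) has_derivative (\<lambda>v. L (fderiv f x v))) (at x)"
      using Suc.prems by (intro bounded_linear.has_derivative[OF assms(2)] has_derivative_fderiv) simp
  next
    fix v show "Ck_on k S (\<lambda>x. L (fderiv f x v))" using Suc by simp
  qed
qed

lemma Ck_on_scaleR:
  fixes f :: "'a::real_normed_vector \<Rightarrow> real"
  assumes "open S" "Ck_on k S f" "Ck_on k S g" shows "Ck_on k S (\<lambda>x. f x *\<^sub>R g x)"
  using assms(2,3)
proof (induction k arbitrary: f g)
  case 0 then show ?case by (auto intro: continuous_intros)
next
  case (Suc k)
  show ?case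
  proof (rule Ck_on_SucI[OF assms(1), where h' = "\<lambda>x v. f x *\<^sub>R fderiv g x v + fderiv f x v *\<^sub>R g x"])
    fix x assume "x \<in> S"
    then show "((\<lambda>x. f x *\<^sub>R g x) has_derivative (\<lambda>v. f x *\<^sub>R fderiv g x v + fderiv f x v *\<^sub>R g x)) (at x)"
      using Suc.prems by (auto intro!: has_derivative_scaleR has_derivative_fderiv)
  next
    fix v show "Ck_on k S (\<lambda>x. f x *\<^sub>R fderiv g x v + fderiv f x v *\<^sub>R g x)"
      using Suc.prems Ck_on_Suc_imp[OF Suc.prems(1)] Ck_on_Suc_imp[OF Suc.prems(2)]
      by (intro Ck_on_add[OF assms(1)] Suc.IH) auto
  qed
qed

lemma Ck_on_sum:
  assumes "open S" "\<And>i. i \<in> I \<Longrightarrow> Ck_on k S (f i)" shows "Ck_on k S (\<lambda>x. \<Sum>i\<in>I. f i x)"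
  using assms(2)
  by (induction I rule: infinite_finite_induct) (auto intro: Ck_on_const Ck_on_add[OF assms(1)])

lemma Ck_on_Un:
  assumes "open S" "open T" "Ck_on k S f" "Ck_on k T f" shows "Ck_on k (S \<union> T) f"
  using assms(3,4)
  by (induction k arbitrary: f) (auto intro: continuous_on_open_Un assms)

lemma Ck_on_subset: "Ck_on k S f \<Longrightarrow> T \<subseteq> S \<Longrightarrow> Ck_on k T f"
  by (induction k arbitrary: f) (auto intro: continuous_on_subset)

lemma smooth_on_cong:
  "open S \<Longrightarrow> (\<And>y. y \<in> S \<Longrightarrow> f y = g y) \<Longrightarrow> smooth_on S f \<longleftrightarrow> smooth_on S g"
  unfolding smooth_on_def using Ck_on_cong[of S f g] by blast

lemma smooth_on_subset: "smooth_on S f \<Longrightarrow> T \<subseteq> S \<Longrightarrow> smooth_on T f"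
  unfolding smooth_on_def using Ck_on_subset[of _ S f T] by blast

lemma smooth_on_Un: "open S \<Longrightarrow> open T \<Longrightarrow> smooth_on S f \<Longrightarrow> smooth_on T f \<Longrightarrow> smooth_on (S \<union> T) f"
  unfolding smooth_on_def using Ck_on_Un[of S T _ f] by blast

lemma smooth_on_const: "smooth_on S (\<lambda>x. c)"
  unfolding smooth_on_def using Ck_on_const[of _ S c] by blast

lemma smooth_on_add: "open S \<Longrightarrow> smooth_on S f \<Longrightarrow> smooth_on S g \<Longrightarrow> smooth_on S (\<lambda>x. f x + g x)"
  unfolding smooth_on_def using Ck_on_add[of S _ f g] by blast

lemma smooth_on_linear:
  "open S \<Longrightarrow> bounded_linear L \<Longrightarrow> smooth_on S f \<Longrightarrow> smooth_on S (\<lambda>x. L (f x))"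
  unfolding smooth_on_def using Ck_on_linear[of S L _ f] by blast

lemma smooth_on_minus: "open S \<Longrightarrow> smooth_on S f \<Longrightarrow> smooth_on S (\<lambda>x. - f x)"
  using smooth_on_linear[OF _ bounded_linear_minus[OF bounded_linear_ident]] by blast

lemma smooth_on_diff: "open S \<Longrightarrow> smooth_on S f \<Longrightarrow> smooth_on S g \<Longrightarrow> smooth_on S (\<lambda>x. f x - g x)"
  using smooth_on_add[OF _ _ smooth_on_minus, of S f g] by simp

lemma smooth_on_scaleR:
  fixes f :: "'a::real_normed_vector \<Rightarrow> real"
  shows "open S \<Longrightarrow> smooth_on S f \<Longrightarrow> smooth_on S g \<Longrightarrow> smooth_on S (\<lambda>x. f x *\<^sub>R g x)"
  unfolding smooth_on_def using Ck_on_scaleR[of S _ f g] by blast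

lemma smooth_on_mult:
  fixes f g :: "'a::real_normed_vector \<Rightarrow> real"
  shows "open S \<Longrightarrow> smooth_on S f \<Longrightarrow> smooth_on S g \<Longrightarrow> smooth_on S (\<lambda>x. f x * g x)"
  using smooth_on_scaleR[of S f g] by simp

lemma smooth_on_sum:
  "open S \<Longrightarrow> (\<And>i. i \<in> I \<Longrightarrow> smooth_on S (f i)) \<Longrightarrow> smooth_on S (\<lambda>x. \<Sum>i\<in>I. f i x)"
  unfolding smooth_on_def using Ck_on_sum[of S I _ f] by blast

lemma smooth_on_inner_right: "open S \<Longrightarrow> smooth_on S f \<Longrightarrow> smooth_on S (\<lambda>x. f x \<bullet> b)"
  using smooth_on_linear[OF _ bounded_linear_inner_left] .

lemma smooth_on_ident: "smooth_on S (\<lambda>x. x)"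
proof -
  have "Ck_on k S (\<lambda>x. x)" for k
    by (cases k) (auto simp: Ck_on_const)
  then show ?thesis unfolding smooth_on_def by blast
qed

lemma smooth_on_bounded_linear:
  assumes "bounded_linear L" shows "smooth_on S L"
  by (rule smooth_on_subset[OF smooth_on_linear[OF open_UNIV assms smooth_on_ident]]) simp

lemma smooth_on_fderiv: "smooth_on S h \<Longrightarrow> smooth_on S (\<lambda>x. fderiv h x v)"
  unfolding smooth_on_def by (metis Ck_on.simps(2))

lemma smooth_on_differentiable: "smooth_on S h \<Longrightarrow> x \<in> S \<Longrightarrow> h differentiable (at x)"
  unfolding smooth_on_def by (metis Ck_on.simps(2))

lemma smooth_on_continuous: "smooth_on S h \<Longrightarrow> continuous_on S h"
  unfolding smooth_on_def by (metis Ck_on.simps(1))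

lemma smooth_on_has_derivative: "smooth_on S h \<Longrightarrow> x \<in> S \<Longrightarrow> (h has_derivative fderiv h x) (at x)"
  by (simp add: has_derivative_fderiv smooth_on_differentiable)

lemma smooth_on_linear_fderiv: "smooth_on S h \<Longrightarrow> x \<in> S \<Longrightarrow> linear (fderiv h x)"
  by (simp add: linear_frechet_derivative smooth_on_differentiable)

lemma linear_Basis_expansion:
  fixes v :: "'a::euclidean_space"
  assumes "linear L" shows "L v = (\<Sum>b\<in>Basis. (v \<bullet> b) *\<^sub>R L b)"
proof -
  have "L v = L (\<Sum>b\<in>Basis. (v \<bullet> b) *\<^sub>R b)" by (simp only: euclidean_representation)
  also have "\<dots> = (\<Sum>b\<in>Basis. (v \<bullet> b) *\<^sub>R L b)"
    by (simp only: linear_sum[OF assms] linear_cmul[OF assms])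
  finally show ?thesis .
qed

lemma smooth_on_compose:
  fixes g :: "'a::real_normed_vector \<Rightarrow> 'b::euclidean_space"
  assumes S: "open S" and T: "open T" and f: "smooth_on T f" and g: "smooth_on S g" and gS: "g ` S \<subseteq> T"
  shows "smooth_on S (\<lambda>x. f (g x))"
proof -
  have "Ck_on k S (\<lambda>x. f (g x))" for k
    using f
  proof (induction k arbitrary: f)
    case 0
    then show ?case
      using continuous_on_compose2[OF smooth_on_continuous smooth_on_continuous[OF g] gS] by auto
  next
    case (Suc k)
    show ?case
    \<comment> \<open>\<open>Ck_on\<close> differentiates in fixed directions, so the moving
      direction \<open>fderiv g x v\<close> is expanded in the basis. Each summand is a component of
      the derivative of \<open>g\<close> times a partial derivative of \<open>f\<close> composed
      with \<open>g\<close>, and the latter falls under the induction hypothesis.\<close>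
    proof (rule Ck_on_SucI[OF S, where h' = "\<lambda>x v. \<Sum>b\<in>Basis. (fderiv g x v \<bullet> b) *\<^sub>R fderiv f (g x) b"])
      fix x assume x: "x \<in> S"
      then have gx: "g x \<in> T" using gS by blast
      have "((\<lambda>x. f (g x)) has_derivative (\<lambda>v. fderiv f (g x) (fderiv g x v))) (at x)"
        using has_derivative_compose[OF smooth_on_has_derivative[OF g x] smooth_on_has_derivative[OF Suc.prems gx]] .
      moreover have "fderiv f (g x) (fderiv g x v) = (\<Sum>b\<in>Basis. (fderiv g x v \<bullet> b) *\<^sub>R fderiv f (g x) b)" for v
        by (rule linear_Basis_expansion[OF smooth_on_linear_fderiv[OF Suc.prems gx]])
      ultimately show "((\<lambda>x. f (g x)) has_derivative
          (\<lambda>v. \<Sum>b\<in>Basis. (fderiv g x v \<bullet> b) *\<^sub>R fderiv f (g x) b)) (at x)"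
        by (simp only:)
    next
      fix v
      have "Ck_on k S (\<lambda>x. fderiv g x v \<bullet> b)" for b
        using smooth_on_inner_right[OF S smooth_on_fderiv[OF g]] unfolding smooth_on_def by blast
      then show "Ck_on k S (\<lambda>x. \<Sum>b\<in>Basis. (fderiv g x v \<bullet> b) *\<^sub>R fderiv f (g x) b)"
        by (intro Ck_on_sum[OF S] Ck_on_scaleR[OF S] Suc.IH smooth_on_fderiv[OF Suc.prems])
    qed
  qed
  then show ?thesis unfolding smooth_on_def by blast
qed

text \<open>Product rule for an expression linear in its argument, with the argument frozen in the
  first term. This is the shape in which metrics, Christoffel symbols and differentials are later
  differentiated on moving vectors.\<close>

lemma has_derivative_linear_arg:
  fixes T :: "'a::real_normed_vector \<Rightarrow> 'b::euclidean_space \<Rightarrow> 'c::real_normed_vector"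
  assumes S: "open S" "x \<in> S" and lin: "\<And>y. y \<in> S \<Longrightarrow> linear (T y)"
    and dT: "\<And>b. (\<lambda>y. T y b) differentiable (at x)" and Z: "(Z has_derivative Z') (at x)"
  shows "((\<lambda>y. T y (Z y)) has_derivative (\<lambda>w. fderiv (\<lambda>y. T y (Z x)) x w + T x (Z' w))) (at x)"
proof -
  have exp: "T y v = (\<Sum>b\<in>Basis. (v \<bullet> b) *\<^sub>R T y b)" if "y \<in> S" for y v
    by (rule linear_Basis_expansion[OF lin[OF that]])
  have D: "((\<lambda>y. \<Sum>b\<in>Basis. (Z y \<bullet> b) *\<^sub>R T y b) has_derivative
      (\<lambda>w. \<Sum>b\<in>Basis. (Z x \<bullet> b) *\<^sub>R fderiv (\<lambda>y. T y b) x w + (Z' w \<bullet> b) *\<^sub>R T x b)) (at x)"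
    by (rule has_derivative_sum, rule has_derivative_scaleR,
        rule has_derivative_inner_left[OF Z], rule has_derivative_fderiv[OF dT])
  have D0: "((\<lambda>y. \<Sum>b\<in>Basis. (Z x \<bullet> b) *\<^sub>R T y b) has_derivative
      (\<lambda>w. \<Sum>b\<in>Basis. (Z x \<bullet> b) *\<^sub>R fderiv (\<lambda>y. T y b) x w)) (at x)"
    by (rule has_derivative_sum, rule has_derivative_scaleR_right, rule has_derivative_fderiv[OF dT])
  have "((\<lambda>y. T y (Z x)) has_derivative (\<lambda>w. \<Sum>b\<in>Basis. (Z x \<bullet> b) *\<^sub>R fderiv (\<lambda>y. T y b) x w)) (at x)"
    by (rule has_derivative_transform_within_open[OF D0 S]) (rule exp[symmetric])
  then have "fderiv (\<lambda>y. T y (Z x)) x = (\<lambda>w. \<Sum>b\<in>Basis. (Z x \<bullet> b) *\<^sub>R fderiv (\<lambda>y. T y b) x w)"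
    by (rule fderiv_eqI)
  moreover have "T x (Z' w) = (\<Sum>b\<in>Basis. (Z' w \<bullet> b) *\<^sub>R T x b)" for w
    by (rule exp[OF S(2)])
  ultimately have "((\<lambda>y. \<Sum>b\<in>Basis. (Z y \<bullet> b) *\<^sub>R T y b) has_derivative
      (\<lambda>w. fderiv (\<lambda>y. T y (Z x)) x w + T x (Z' w))) (at x)"
    using D by (simp add: sum.distrib)
  then show ?thesis
    by (rule has_derivative_transform_within_open[OF _ S]) (rule exp[symmetric])
qed

lemma smooth_on_linear_arg:
  fixes T :: "'a::real_normed_vector \<Rightarrow> 'b::euclidean_space \<Rightarrow> 'c::real_normed_vector"
  assumes S: "open S" and lin: "\<And>y. y \<in> S \<Longrightarrow> linear (T y)"
    and T: "\<And>b. smooth_on S (\<lambda>y. T y b)" and Z: "smooth_on S Z"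
  shows "smooth_on S (\<lambda>y. T y (Z y))"
proof -
  have "smooth_on S (\<lambda>y. \<Sum>b\<in>Basis. (Z y \<bullet> b) *\<^sub>R T y b)"
    by (intro smooth_on_sum smooth_on_scaleR smooth_on_inner_right S T Z)
  then show ?thesis
    by (subst smooth_on_cong[OF S linear_Basis_expansion[OF lin]])
qed

section \<open>Symmetry of second derivatives\<close>

lemma DERIV_along_line:
  fixes h :: "'a::real_normed_vector \<Rightarrow> real"
  assumes "(h has_derivative L) (at (p + \<sigma> *\<^sub>R u))"
  shows "((\<lambda>\<sigma>. h (p + \<sigma> *\<^sub>R u)) has_real_derivative L u) (at \<sigma>)"
proof -
  have *: "((\<lambda>\<sigma>. p + \<sigma> *\<^sub>R u) has_derivative (\<lambda>t. t *\<^sub>R u)) (at \<sigma>)"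
    by (auto intro!: derivative_eq_intros)
  have "((\<lambda>\<sigma>. h (p + \<sigma> *\<^sub>R u)) has_derivative (\<lambda>t. L (t *\<^sub>R u))) (at \<sigma>)"
    using has_derivative_compose[OF * assms] .
  moreover have "L (t *\<^sub>R u) = L u * t" for t
    using linear_cmul[OF has_derivative_linear[OF assms]] by simp
  ultimately show ?thesis by (simp add: has_field_derivative_def)
qed

text \<open>Two applications of the mean value theorem: along \<open>u\<close> to the difference of
  \<open>h\<close> at points shifted by \<open>s *\<^sub>R v\<close>, then along \<open>v\<close> to
  the derivative so obtained. The left-hand side is symmetric in \<open>u\<close> and
  \<open>v\<close>.\<close>

lemma second_difference_mvt:
  fixes h :: "'a::real_normed_vector \<Rightarrow> real"
  assumes h: "smooth_on S h" and S: "ball x r \<subseteq> S" and s: "0 < s" "s * (norm u + norm v) < r"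
  shows "\<exists>a. dist x a < r \<and>
    h (x + s *\<^sub>R u + s *\<^sub>R v) - h (x + s *\<^sub>R u) - h (x + s *\<^sub>R v) + h x
      = s * s * fderiv (\<lambda>y. fderiv h y u) a v"
proof -
  have inS: "x + \<sigma> *\<^sub>R u + \<tau> *\<^sub>R v \<in> ball x r" if "0 \<le> \<sigma>" "\<sigma> \<le> s" "0 \<le> \<tau>" "\<tau> \<le> s" for \<sigma> \<tau>
  proof -
    have "norm (\<sigma> *\<^sub>R u + \<tau> *\<^sub>R v) \<le> \<sigma> * norm u + \<tau> * norm v"
      using norm_triangle_ineq[of "\<sigma> *\<^sub>R u" "\<tau> *\<^sub>R v"] that by simp
    also have "\<dots> \<le> s * norm u + s * norm v"
      using that by (intro add_mono mult_right_mono) auto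
    also have "\<dots> < r" using s by (simp add: distrib_left)
    finally have "norm (\<sigma> *\<^sub>R u + \<tau> *\<^sub>R v) < r" .
    moreover have "dist x (x + \<sigma> *\<^sub>R u + \<tau> *\<^sub>R v) = norm (\<sigma> *\<^sub>R u + \<tau> *\<^sub>R v)"
      by (metis add.assoc add_diff_cancel_left' dist_commute dist_norm)
    ultimately show ?thesis by simp
  qed
  have D1: "((\<lambda>\<sigma>. h (x + s *\<^sub>R v + \<sigma> *\<^sub>R u) - h (x + \<sigma> *\<^sub>R u)) has_real_derivative
      fderiv h (x + s *\<^sub>R v + \<sigma> *\<^sub>R u) u - fderiv h (x + \<sigma> *\<^sub>R u) u) (at \<sigma>)"
    if "0 \<le> \<sigma>" "\<sigma> \<le> s" for \<sigma>
  proof -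
    have "x + s *\<^sub>R v + \<sigma> *\<^sub>R u \<in> S" using inS[of \<sigma> s] that s S by (auto simp: algebra_simps)
    moreover have "x + \<sigma> *\<^sub>R u \<in> S" using inS[of \<sigma> 0] that s S by auto
    ultimately show ?thesis
      by (intro DERIV_diff DERIV_along_line[OF smooth_on_has_derivative[OF h]])
  qed
  obtain \<sigma> where \<sigma>: "0 < \<sigma>" "\<sigma> < s" and
    e1: "(h (x + s *\<^sub>R v + s *\<^sub>R u) - h (x + s *\<^sub>R u)) - (h (x + s *\<^sub>R v + 0 *\<^sub>R u) - h (x + 0 *\<^sub>R u))
      = (s - 0) * (fderiv h (x + s *\<^sub>R v + \<sigma> *\<^sub>R u) u - fderiv h (x + \<sigma> *\<^sub>R u) u)"
    using MVT2[OF s(1) D1] by blast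
  have D2: "((\<lambda>\<tau>. fderiv h (x + \<sigma> *\<^sub>R u + \<tau> *\<^sub>R v) u) has_real_derivative
      fderiv (\<lambda>y. fderiv h y u) (x + \<sigma> *\<^sub>R u + \<tau> *\<^sub>R v) v) (at \<tau>)"
    if "0 \<le> \<tau>" "\<tau> \<le> s" for \<tau>
    using inS[of \<sigma> \<tau>] that \<sigma> S
    by (intro DERIV_along_line[where h = "\<lambda>y. fderiv h y u"] smooth_on_has_derivative[OF smooth_on_fderiv[OF h]]) auto
  obtain \<tau> where \<tau>: "0 < \<tau>" "\<tau> < s" and
    e2: "fderiv h (x + \<sigma> *\<^sub>R u + s *\<^sub>R v) u - fderiv h (x + \<sigma> *\<^sub>R u + 0 *\<^sub>R v) u
      = (s - 0) * fderiv (\<lambda>y. fderiv h y u) (x + \<sigma> *\<^sub>R u + \<tau> *\<^sub>R v) v"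
    using MVT2[OF s(1) D2] by blast
  show ?thesis
  proof (intro exI conjI)
    show "dist x (x + \<sigma> *\<^sub>R u + \<tau> *\<^sub>R v) < r" using inS[of \<sigma> \<tau>] \<sigma> \<tau> by simp
    have c: "x + s *\<^sub>R v + \<sigma> *\<^sub>R u = x + \<sigma> *\<^sub>R u + s *\<^sub>R v" "x + s *\<^sub>R v + s *\<^sub>R u = x + s *\<^sub>R u + s *\<^sub>R v"
      by simp_all
    show "h (x + s *\<^sub>R u + s *\<^sub>R v) - h (x + s *\<^sub>R u) - h (x + s *\<^sub>R v) + h x
      = s * s * fderiv (\<lambda>y. fderiv h y u) (x + \<sigma> *\<^sub>R u + \<tau> *\<^sub>R v) v"
      using e1[unfolded c] e2 by simp
  qed
qed

text \<open>Evaluating the symmetric second difference in both orders identifies the two mixed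
  derivatives at two points close to \<open>x\<close>; their continuity then excludes a gap at
  \<open>x\<close> itself.\<close>

lemma fderiv_commute_real:
  fixes h :: "'a::real_normed_vector \<Rightarrow> real"
  assumes S: "open S" "x \<in> S" and h: "smooth_on S h"
  shows "fderiv (\<lambda>y. fderiv h y u) x v = fderiv (\<lambda>y. fderiv h y v) x u"
proof (rule ccontr)
  let ?F = "\<lambda>y. fderiv (\<lambda>y. fderiv h y u) y v" and ?F' = "\<lambda>y. fderiv (\<lambda>y. fderiv h y v) y u"
  assume ne: "?F x \<noteq> ?F' x"
  define e where "e = \<bar>?F x - ?F' x\<bar> / 2"
  have e: "e > 0" using ne by (simp add: e_def)
  have cont: "continuous (at x) ?F" "continuous (at x) ?F'"
    using smooth_on_continuous[OF smooth_on_fderiv[OF smooth_on_fderiv[OF h]]]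
    by (metis S continuous_on_eq_continuous_at)+
  obtain r0 where r0: "r0 > 0" "ball x r0 \<subseteq> S" using S openE by blast
  obtain r1 where r1: "r1 > 0" "\<And>y. dist y x < r1 \<Longrightarrow> dist (?F y) (?F x) < e"
    using cont(1) e unfolding continuous_at_eps_delta by blast
  obtain r2 where r2: "r2 > 0" "\<And>y. dist y x < r2 \<Longrightarrow> dist (?F' y) (?F' x) < e"
    using cont(2) e unfolding continuous_at_eps_delta by blast
  define r where "r = min r0 (min r1 r2)"
  have r: "r > 0" "ball x r \<subseteq> S" using r0 r1 r2 by (auto simp: r_def)
  \<comment> \<open>The step stays within half the radius; the summand 1 keeps \<open>s\<close>
    positive when \<open>u = v = 0\<close>.\<close>
  define s where "s = r / (2 * (norm u + norm v + 1))"
  have s: "s > 0" using r by (simp add: s_def add_nonneg_pos)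
  have "s * (norm u + norm v) \<le> s * (norm u + norm v + 1)" using s by (intro mult_left_mono) auto
  also have "\<dots> = r / 2"
    using add_nonneg_pos[of "norm u + norm v" 1] by (simp add: s_def field_simps)
  also have "\<dots> < r" using r by simp
  finally have s': "s * (norm u + norm v) < r" "s * (norm v + norm u) < r" by (simp_all add: add.commute)
  obtain a where a: "dist x a < r"
      "h (x + s *\<^sub>R u + s *\<^sub>R v) - h (x + s *\<^sub>R u) - h (x + s *\<^sub>R v) + h x = s * s * ?F a"
    using second_difference_mvt[OF h r(2) s s'(1)] by blast
  obtain b where b: "dist x b < r"
      "h (x + s *\<^sub>R v + s *\<^sub>R u) - h (x + s *\<^sub>R v) - h (x + s *\<^sub>R u) + h x = s * s * ?F' b"
    using second_difference_mvt[OF h r(2) s s'(2)] by blast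
  have "s * s * ?F a = s * s * ?F' b"
    unfolding a(2)[symmetric] b(2)[symmetric] by (simp add: algebra_simps)
  then have "?F a = ?F' b" using s by simp
  moreover have "dist (?F a) (?F x) < e" "dist (?F' b) (?F' x) < e"
    using a(1) b(1) by (auto intro!: r1 r2 simp: r_def dist_commute)
  ultimately have "\<bar>?F x - ?F' x\<bar> < 2 * e" by (simp add: dist_real_def)
  then show False by (simp add: e_def)
qed

lemma fderiv_inner:
  assumes "h differentiable (at x)" shows "fderiv (\<lambda>y. h y \<bullet> b) x v = fderiv h x v \<bullet> b"
  by (simp add: fderiv_eqI[OF has_derivative_inner_left[OF has_derivative_fderiv[OF assms]]])

lemma fderiv_commute:
  fixes h :: "'a::real_normed_vector \<Rightarrow> 'b::euclidean_space"
  assumes S: "open S" "x \<in> S" and h: "smooth_on S h"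
  shows "fderiv (\<lambda>y. fderiv h y u) x v = fderiv (\<lambda>y. fderiv h y v) x u"
proof (rule euclidean_eqI)
  fix b :: 'b
  have "fderiv (\<lambda>y. fderiv h y w) x z \<bullet> b = fderiv (\<lambda>y. fderiv (\<lambda>y. h y \<bullet> b) y w) x z" for w z
  proof -
    have "fderiv (\<lambda>y. fderiv h y w) x z \<bullet> b = fderiv (\<lambda>y. fderiv h y w \<bullet> b) x z"
      by (rule fderiv_inner[symmetric]) (rule smooth_on_differentiable[OF smooth_on_fderiv[OF h] S(2)])
    also have "fderiv (\<lambda>y. fderiv h y w \<bullet> b) x = fderiv (\<lambda>y. fderiv (\<lambda>y. h y \<bullet> b) y w) x"
      by (rule fderiv_cong[OF S]) (simp add: fderiv_inner smooth_on_differentiable[OF h])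
    finally show ?thesis .
  qed
  then show "fderiv (\<lambda>y. fderiv h y u) x v \<bullet> b = fderiv (\<lambda>y. fderiv h y v) x u \<bullet> b"
    using fderiv_commute_real[OF S smooth_on_inner_right[OF S(1) h]] by metis
qed

lemma linear_fderiv_arg:
  fixes T :: "'a::real_normed_vector \<Rightarrow> 'b::real_normed_vector \<Rightarrow> 'c::real_normed_vector"
  assumes S: "open S" "x \<in> S" and lin: "\<And>y. y \<in> S \<Longrightarrow> linear (T y)"
    and dT: "\<And>b. (\<lambda>y. T y b) differentiable (at x)"
  shows "linear (\<lambda>b. fderiv (\<lambda>y. T y b) x w)"
proof (rule linearI)
  fix a b
  have "fderiv (\<lambda>y. T y (a + b)) x = fderiv (\<lambda>y. T y a + T y b) x"
    by (rule fderiv_cong[OF S]) (simp add: linear_add[OF lin])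
  also have "\<dots> = (\<lambda>w. fderiv (\<lambda>y. T y a) x w + fderiv (\<lambda>y. T y b) x w)"
    by (rule fderiv_eqI[OF has_derivative_add[OF has_derivative_fderiv[OF dT] has_derivative_fderiv[OF dT]]])
  finally show "fderiv (\<lambda>y. T y (a + b)) x w = fderiv (\<lambda>y. T y a) x w + fderiv (\<lambda>y. T y b) x w" by simp
next
  fix r b
  have "fderiv (\<lambda>y. T y (r *\<^sub>R b)) x = fderiv (\<lambda>y. r *\<^sub>R T y b) x"
    by (rule fderiv_cong[OF S]) (simp add: linear_cmul[OF lin])
  also have "\<dots> = (\<lambda>w. r *\<^sub>R fderiv (\<lambda>y. T y b) x w)"
    by (rule fderiv_eqI[OF has_derivative_scaleR_right[OF has_derivative_fderiv[OF dT]]])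
  finally show "fderiv (\<lambda>y. T y (r *\<^sub>R b)) x w = r *\<^sub>R fderiv (\<lambda>y. T y b) x w" by simp
qed

lemma has_derivative_bilinear_arg:
  fixes T :: "'a::real_normed_vector \<Rightarrow> 'b::euclidean_space \<Rightarrow> 'd::euclidean_space \<Rightarrow> 'c::real_normed_vector"
  assumes S: "open S" "x \<in> S" and lin: "\<And>y b. y \<in> S \<Longrightarrow> linear (\<lambda>a. T y a b)" "\<And>y a. y \<in> S \<Longrightarrow> linear (T y a)"
    and dT: "\<And>a b. (\<lambda>y. T y a b) differentiable (at x)"
    and A: "(A has_derivative A') (at x)" and B: "(B has_derivative B') (at x)"
  shows "((\<lambda>y. T y (A y) (B y)) has_derivative
    (\<lambda>w. fderiv (\<lambda>y. T y (A x) (B x)) x w + T x (A' w) (B x) + T x (A x) (B' w))) (at x)"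
proof -
  have *: "((\<lambda>y. T y (A y) b) has_derivative (\<lambda>w. fderiv (\<lambda>y. T y (A x) b) x w + T x (A' w) b)) (at x)" for b
    using has_derivative_linear_arg[OF S, of "\<lambda>y a. T y a b"] lin(1) dT A by blast
  have "((\<lambda>y. T y (A y) (B y)) has_derivative
    (\<lambda>w. fderiv (\<lambda>y. T y (A y) (B x)) x w + T x (A x) (B' w))) (at x)"
    using has_derivative_linear_arg[OF S, of "\<lambda>y. T y (A y)"] lin(2) * B unfolding differentiable_def by blast
  then show ?thesis unfolding fderiv_eqI[OF *] .
qed

lemma smooth_on_bilinear_arg:
  fixes T :: "'a::real_normed_vector \<Rightarrow> 'b::euclidean_space \<Rightarrow> 'd::euclidean_space \<Rightarrow> 'c::real_normed_vector"
  assumes S: "open S" and lin: "\<And>y b. y \<in> S \<Longrightarrow> linear (\<lambda>a. T y a b)" "\<And>y a. y \<in> S \<Longrightarrow> linear (T y a)"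
    and T: "\<And>a b. smooth_on S (\<lambda>y. T y a b)" and A: "smooth_on S A" and B: "smooth_on S B"
  shows "smooth_on S (\<lambda>y. T y (A y) (B y))"
  by (rule smooth_on_linear_arg[OF S, of "\<lambda>y. T y (A y)"])
    (use smooth_on_linear_arg[OF S, of "\<lambda>y a. T y a b" for b] assms in auto)

text \<open>At a zero of \<open>d\<close>, continuity of \<open>u\<close> is enough, because the
  term with the derivative of \<open>u\<close> would carry the factor \<open>d x = 0\<close>. This
  breaks the circle in \<open>sharp_differentiable\<close>, where \<open>u\<close> is a component of
  the very function to be differentiated.\<close>

lemma has_derivative_scaleR_vanishing:
  fixes u :: "'a::real_normed_vector \<Rightarrow> real"
  assumes d: "(d has_derivative d') (at x)" and d0: "d x = 0" and u: "isCont u x"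
  shows "((\<lambda>y. u y *\<^sub>R d y) has_derivative (\<lambda>h. u x *\<^sub>R d' h)) (at x)"
  unfolding has_derivative_iff_norm
proof
  have bl: "bounded_linear d'" using d has_derivative_bounded_linear by blast
  then show "bounded_linear (\<lambda>h. u x *\<^sub>R d' h)" by (rule bounded_linear_const_scaleR)
  obtain K where K: "\<And>h. norm (d' h) \<le> norm h * K" using bounded_linear.bounded[OF bl] by blast
  have d_lim: "((\<lambda>y. norm (d y - d x - d' (y - x)) / norm (y - x)) \<longlongrightarrow> 0) (at x)"
    using d unfolding has_derivative_iff_norm by blast
  have u_lim: "(u \<longlongrightarrow> u x) (at x)" using u isCont_def by blast
  have lim: "((\<lambda>y. \<bar>u y\<bar> * (norm (d y - d x - d' (y - x)) / norm (y - x)) + \<bar>u y - u x\<bar> * K) \<longlongrightarrow> 0) (at x)"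
    by (rule tendsto_eq_intros tendsto_rabs u_lim d_lim tendsto_const | simp)+
  show "((\<lambda>y. norm (u y *\<^sub>R d y - u x *\<^sub>R d x - u x *\<^sub>R d' (y - x)) / norm (y - x)) \<longlongrightarrow> 0) (at x)"
  proof (rule Lim_null_comparison[OF _ lim], rule eventually_mono[OF eventually_at_filter[THEN iffD2]])
    show "\<forall>\<^sub>F y in nhds x. y \<noteq> x \<longrightarrow> y \<in> UNIV \<longrightarrow> y \<noteq> x" by simp
    fix y assume "y \<noteq> x"
    then have n: "norm (y - x) > 0" by simp
    have "u y *\<^sub>R d y - u x *\<^sub>R d x - u x *\<^sub>R d' (y - x)
        = u y *\<^sub>R (d y - d x - d' (y - x)) + (u y - u x) *\<^sub>R d' (y - x)"
      by (simp add: d0 algebra_simps)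
    then have "norm (u y *\<^sub>R d y - u x *\<^sub>R d x - u x *\<^sub>R d' (y - x))
        \<le> \<bar>u y\<bar> * norm (d y - d x - d' (y - x)) + \<bar>u y - u x\<bar> * norm (d' (y - x))"
      using norm_triangle_ineq by (metis norm_scaleR)
    also have "\<dots> \<le> \<bar>u y\<bar> * norm (d y - d x - d' (y - x)) + \<bar>u y - u x\<bar> * (norm (y - x) * K)"
      by (intro add_left_mono mult_left_mono K) simp
    finally show "norm (norm (u y *\<^sub>R d y - u x *\<^sub>R d x - u x *\<^sub>R d' (y - x)) / norm (y - x))
        \<le> \<bar>u y\<bar> * (norm (d y - d x - d' (y - x)) / norm (y - x)) + \<bar>u y - u x\<bar> * K"
      using n by (simp add: divide_simps algebra_simps)
  qed
qed


section \<open>Local pseudo-Riemannian geometry\<close>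

text \<open>The curvature written in Christoffel symbols as a map of vectors at a point;
  \<open>curvature_eq\<close> identifies it with \<open>curvature\<close>, which takes vector
  fields.\<close>

definition curvature_op :: "'e lmetric \<Rightarrow> 'e \<Rightarrow> 'e \<Rightarrow> 'e \<Rightarrow> 'e \<Rightarrow> 'e::euclidean_space" where
  "curvature_op G x i j k =
     fderiv (\<lambda>y. christoffel G y i k) x j - fderiv (\<lambda>y. christoffel G y j k) x i
     + christoffel G x j (christoffel G x i k) - christoffel G x i (christoffel G x j k)"

text \<open>The covariant derivative of the curvature as a vector-valued tensor. In this form the
  second Bianchi identity concerns the connection alone; the metric enters in
  \<open>nabla4_riemann\<close>.\<close>

definition nabla_curvature_op :: "'e lmetric \<Rightarrow> 'e \<Rightarrow> 'e \<Rightarrow> 'e \<Rightarrow> 'e \<Rightarrow> 'e \<Rightarrow> 'e::euclidean_space" where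
  "nabla_curvature_op G x m i j k =
     fderiv (\<lambda>y. curvature_op G y i j k) x m + christoffel G x m (curvature_op G x i j k)
     - curvature_op G x (christoffel G x m i) j k - curvature_op G x i (christoffel G x m j) k
     - curvature_op G x i j (christoffel G x m k)"

definition nabla2 :: "'e lmetric \<Rightarrow> ('e \<Rightarrow> 'e \<Rightarrow> 'e \<Rightarrow> real) \<Rightarrow> 'e \<Rightarrow> 'e \<Rightarrow> 'e \<Rightarrow> 'e::euclidean_space \<Rightarrow> real" where
  "nabla2 G T x m i k =
     fderiv (\<lambda>y. T y i k) x m - T x (christoffel G x m i) k - T x i (christoffel G x m k)"

definition ricci_codazzi :: "'e lmetric \<Rightarrow> 'e \<Rightarrow> 'e \<Rightarrow> 'e \<Rightarrow> 'e::euclidean_space \<Rightarrow> real" where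
  "ricci_codazzi G x i j k = nabla2 G (ricci G) x j i k - nabla2 G (ricci G) x i j k"

text \<open>Serves to cancel the two connection terms when the trace of an endomorphism field is
  differentiated.\<close>

lemma trace_commute:
  fixes A B :: "'e::euclidean_space \<Rightarrow> 'e"
  assumes A: "linear A" and B: "linear B"
  shows "(\<Sum>i\<in>Basis. A (B i) \<bullet> i) = (\<Sum>i\<in>Basis. B (A i) \<bullet> i)"
proof -
  have *: "(\<Sum>i\<in>Basis. C (D i) \<bullet> i) = (\<Sum>i\<in>Basis. \<Sum>j\<in>Basis. (D i \<bullet> j) * (C j \<bullet> i))"
    if "linear C" for C D :: "'e \<Rightarrow> 'e"
    by (simp add: linear_Basis_expansion[OF that, of "D _"] inner_sum_left)
  show ?thesis
    unfolding *[OF A] *[OF B] by (subst sum.swap) (simp add: mult.commute)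
qed

lemma metric_trace_diff: "metric_trace G x (\<lambda>i j. T i j - U i j) = metric_trace G x T - metric_trace G x U"
  by (simp add: metric_trace_def right_diff_distrib sum_subtractf)

lemma metric_trace_cmult: "metric_trace G x (\<lambda>i j. c * T i j) = c * metric_trace G x T"
  by (simp add: metric_trace_def sum_distrib_left mult.left_commute)

lemma metric_trace_cong:
  "(\<And>i j. i \<in> Basis \<Longrightarrow> j \<in> Basis \<Longrightarrow> T i j = U i j) \<Longrightarrow> metric_trace G x T = metric_trace G x U"
  by (simp add: metric_trace_def)

lemma metric_trace_swap:
  "metric_trace G x (\<lambda>i k. metric_trace G x (\<lambda>m l. T i k m l)) =
   metric_trace G x (\<lambda>m l. metric_trace G x (\<lambda>i k. T i k m l))"
proof -
  have *: "metric_trace G x U = (\<Sum>p\<in>Basis \<times> Basis. inv_metric G x (fst p) (snd p) * U (fst p) (snd p))" for U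
    by (simp add: metric_trace_def sum.cartesian_product case_prod_unfold)
  show ?thesis
    unfolding * sum_distrib_left by (subst sum.swap) (simp add: mult.left_commute)
qed

definition hess :: "'e lmetric \<Rightarrow> ('e \<Rightarrow> real) \<Rightarrow> 'e \<Rightarrow> 'e \<Rightarrow> 'e::euclidean_space \<Rightarrow> real" where
  "hess G h x u v = G x (nabla G (\<lambda>_. u) (gradient G h) x) v"

locale local_metric =
  fixes G :: "'e::euclidean_space lmetric" and S :: "'e set"
  assumes open_S: "open S"
    and G_commute: "x \<in> S \<Longrightarrow> G x u v = G x v u"
    and G_linear: "x \<in> S \<Longrightarrow> linear (\<lambda>u. G x u v)"
    and G_nondegenerate: "x \<in> S \<Longrightarrow> (\<And>v. G x u v = 0) \<Longrightarrow> u = 0"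
    and G_smooth: "smooth_on S (\<lambda>x. G x u v)"
begin

lemma G_linear_right: "x \<in> S \<Longrightarrow> linear (G x u)"
proof -
  assume x: "x \<in> S"
  then have "G x u = (\<lambda>v. G x v u)" using G_commute by blast
  then show ?thesis using G_linear[OF x] by simp
qed

lemmas G_left [simp] = linear_add[OF G_linear] linear_diff[OF G_linear] linear_neg[OF G_linear]
  linear_0[OF G_linear] linear_cmul[OF G_linear]

lemmas G_right [simp] = linear_add[OF G_linear_right] linear_diff[OF G_linear_right] linear_neg[OF G_linear_right]
  linear_0[OF G_linear_right] linear_cmul[OF G_linear_right]

lemma G_eqI: "x \<in> S \<Longrightarrow> (\<And>z. G x u z = G x v z) \<Longrightarrow> u = v"
  using G_nondegenerate[of x "u - v"] by simp

text \<open>By nondegeneracy the map from \<open>w\<close> to the vector of values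
  \<open>G x w b\<close> is injective, hence surjective in finite dimension; a preimage of the
  values of \<open>\<alpha>\<close> on the basis represents \<open>\<alpha>\<close>.\<close>

lemma G_represent:
  assumes x: "x \<in> S" and \<alpha>: "linear \<alpha>"
  obtains w where "\<And>z. G x w z = \<alpha> z"
proof -
  let ?A = "\<lambda>w. \<Sum>b\<in>Basis. G x w b *\<^sub>R b"
  have lA: "linear ?A"
    by (rule linearI) (simp_all add: x scaleR_add_left sum.distrib scaleR_sum_right)
  have Ab: "?A w \<bullet> b = G x w b" if "b \<in> Basis" for w b
    using that by (simp add: inner_sum_left inner_Basis if_distrib cong: if_cong)
  have "inj ?A"
  proof (rule linear_injective_0[OF lA, THEN iffD2], safe)
    fix w assume w: "?A w = 0"
    have "G x w b = 0" if "b \<in> Basis" for b using Ab[OF that, of w] w by simp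
    then have "G x w v = 0" for v
      by (subst linear_Basis_expansion[OF G_linear_right[OF x]]) simp
    then show "w = 0" using G_nondegenerate[OF x] by blast
  qed
  then have "surj ?A" using linear_injective_imp_surjective[OF lA] by blast
  from surjD[OF this] obtain w where w: "(\<Sum>b\<in>Basis. \<alpha> b *\<^sub>R b) = ?A w" by blast
  have "G x w b = \<alpha> b" if "b \<in> Basis" for b
    using Ab[OF that, of w] that unfolding w[symmetric]
    by (simp add: inner_sum_left inner_Basis if_distrib cong: if_cong)
  then have "G x w z = \<alpha> z" for z
    by (subst linear_Basis_expansion[OF G_linear_right[OF x]], subst linear_Basis_expansion[OF \<alpha>]) simp
  then show ?thesis using that by blast
qed

lemma sharp_eqI: "x \<in> S \<Longrightarrow> (\<And>z. G x w z = \<alpha> z) \<Longrightarrow> sharp G x \<alpha> = w"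
  unfolding sharp_def by (rule the_equality) (auto intro: G_eqI)

lemma G_sharp: "x \<in> S \<Longrightarrow> linear \<alpha> \<Longrightarrow> G x (sharp G x \<alpha>) z = \<alpha> z"
  by (metis G_represent sharp_eqI)

section \<open>Smooth dependence of the metric isomorphism on the point\<close>

lemma bounded_linear_sharp_inner:
  assumes x: "x \<in> S" shows "bounded_linear (\<lambda>y. sharp G x (\<lambda>z. y \<bullet> z))"
proof -
  have *: "G x (sharp G x (\<lambda>z. y \<bullet> z)) z = y \<bullet> z" for y z
    by (intro G_sharp x bounded_linear.linear bounded_linear_inner_right)
  have "linear (\<lambda>y. sharp G x (\<lambda>z. y \<bullet> z))"
    by (rule linearI) (auto intro!: sharp_eqI[OF x] simp: x * inner_add_left)
  then show ?thesis using linear_conv_bounded_linear by blast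
qed

text \<open>The equation \<open>G y w z = \<alpha> z\<close> is rewritten as
  \<open>G x w z = \<alpha> z - (G y w z - G x w z)\<close>, and the form at the fixed point
  \<open>x\<close> is inverted. The inverse no longer depends on \<open>y\<close>; the unknown
  reappears on the right, but with coefficients that vanish at \<open>y = x\<close>.\<close>

lemma sharp_perturbation:
  assumes x: "x \<in> S" and y: "y \<in> S" and \<alpha>: "linear \<alpha>"
  shows "sharp G y \<alpha> = sharp G x (\<lambda>z. ((\<Sum>b\<in>Basis. \<alpha> b *\<^sub>R b) -
    (\<Sum>c\<in>Basis. (sharp G y \<alpha> \<bullet> c) *\<^sub>R (\<Sum>b\<in>Basis. (G y c b - G x c b) *\<^sub>R b))) \<bullet> z)" (is "?w = _")
proof (rule sharp_eqI[OF x, symmetric])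
  fix z
  have A: "(\<Sum>b\<in>Basis. \<beta> b *\<^sub>R b) \<bullet> z = \<beta> z" if "linear \<beta>" for \<beta> :: "'e \<Rightarrow> real"
    unfolding inner_sum_left inner_scaleR_left
    using linear_Basis_expansion[OF that, of z] by (simp add: mult.commute inner_commute)
  have "(\<Sum>b\<in>Basis. (G y c b - G x c b) *\<^sub>R b) \<bullet> z = G y c z - G x c z" for c
    by (rule A) (intro linear_compose_sub G_linear_right x y)
  then have "(\<Sum>c\<in>Basis. (?w \<bullet> c) *\<^sub>R (\<Sum>b\<in>Basis. (G y c b - G x c b) *\<^sub>R b)) \<bullet> z = G y ?w z - G x ?w z"
    by (simp add: inner_sum_left sum_subtractf right_diff_distrib
        linear_Basis_expansion[OF G_linear[OF x], of ?w] linear_Basis_expansion[OF G_linear[OF y], of ?w])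
  then show "G x ?w z = ((\<Sum>b\<in>Basis. \<alpha> b *\<^sub>R b) -
    (\<Sum>c\<in>Basis. (?w \<bullet> c) *\<^sub>R (\<Sum>b\<in>Basis. (G y c b - G x c b) *\<^sub>R b))) \<bullet> z"
    by (simp add: inner_diff_left A[OF \<alpha>] G_sharp[OF y \<alpha>])
qed

lemma G_isCont: "x \<in> S \<Longrightarrow> isCont (\<lambda>y. G y u v) x"
  using smooth_on_continuous[OF G_smooth] open_S continuous_on_eq_continuous_at by blast

text \<open>The error term in \<open>sharp_perturbation\<close> is at most
  \<open>norm (?w y) * e y\<close> with \<open>e\<close> tending to 0, so the point is to bound
  \<open>?w\<close> near \<open>x\<close>. For small \<open>e\<close> half of its norm is absorbed
  into the left-hand side.\<close>

lemma sharp_isCont: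
  assumes x: "x \<in> S" and \<alpha>: "\<And>y. y \<in> S \<Longrightarrow> linear (\<alpha> y)" and c: "\<And>b. isCont (\<lambda>y. \<alpha> y b) x"
  shows "isCont (\<lambda>y. sharp G y (\<alpha> y)) x"
proof -
  let ?w = "\<lambda>y. sharp G y (\<alpha> y)"
  let ?P = "\<lambda>v. sharp G x (\<lambda>z. v \<bullet> z)"
  let ?A = "\<lambda>y. \<Sum>b\<in>Basis. \<alpha> y b *\<^sub>R b"
  let ?E = "\<lambda>y c. \<Sum>b\<in>Basis. (G y c b - G x c b) *\<^sub>R b"
  let ?F = "\<lambda>y. \<Sum>c\<in>Basis. (?w y \<bullet> c) *\<^sub>R ?E y c"
  define e where "e y = (\<Sum>c\<in>Basis. norm (?E y c))" for y
  have P: "bounded_linear ?P" by (rule bounded_linear_sharp_inner[OF x])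
  obtain K where K: "K > 0" "\<And>v. norm (?P v) \<le> norm v * K"
    using bounded_linear.pos_bounded[OF P] by blast
  have inS: "\<forall>\<^sub>F y in at x. y \<in> S" using eventually_at_in_open'[OF open_S x] .
  have w: "?w y = ?P (?A y - ?F y)" if "y \<in> S" for y
    using sharp_perturbation[OF x that \<alpha>[OF that]] .
  have A: "(?A \<longlongrightarrow> ?A x) (at x)"
    by (rule tendsto_sum, rule tendsto_scaleR, rule c[unfolded isCont_def], rule tendsto_const)
  have "(e \<longlongrightarrow> (\<Sum>c\<in>Basis. norm (\<Sum>b\<in>Basis. (G x c b - G x c b) *\<^sub>R (b::'e)))) (at x)"
    unfolding e_def
    by (rule tendsto_sum, rule tendsto_norm, rule tendsto_sum, rule tendsto_scaleR, rule tendsto_diff,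
        rule G_isCont[OF x, unfolded isCont_def], rule tendsto_const, rule tendsto_const)
  then have e: "(e \<longlongrightarrow> 0) (at x)" by simp
  have F: "norm (?F y) \<le> norm (?w y) * e y" for y
    unfolding e_def sum_distrib_left
    by (intro order_trans[OF norm_sum] sum_mono) (simp add: mult_right_mono Basis_le_norm)
  \<comment> \<open>With \<open>K * e y < 1 / 2\<close> the perturbation equation gives
    \<open>norm (?w y) \<le> K * (norm (?A x) + 1) + norm (?w y) / 2\<close>, and solving for the
    norm yields this bound.\<close>
  define B where "B = 2 * K * (norm (?A x) + 1)"
  have "\<forall>\<^sub>F y in at x. e y < 1 / (2 * K)" using order_tendstoD(2)[OF e] K by simp
  moreover have "\<forall>\<^sub>F y in at x. norm (?A y) < norm (?A x) + 1"
    using order_tendstoD(2)[OF tendsto_norm[OF A]] by simp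
  ultimately have "\<forall>\<^sub>F y in at x. norm (?w y) \<le> B"
    using inS
  proof eventually_elim
    case (elim y)
    have "norm (?w y) \<le> norm (?A y - ?F y) * K" by (rule ord_eq_le_trans[OF arg_cong[OF w[OF elim(3)], of norm] K(2)])
    also have "\<dots> \<le> ((norm (?A x) + 1) + norm (?w y) * e y) * K"
      using K(1) elim(2) F[of y] norm_triangle_ineq4[of "?A y" "?F y"] by (intro mult_right_mono) auto
    also have "\<dots> \<le> ((norm (?A x) + 1) + norm (?w y) * (1 / (2 * K))) * K"
      using K(1) elim(1) by (intro mult_right_mono add_left_mono mult_left_mono) auto
    also have "\<dots> = B / 2 + norm (?w y) / 2" using K(1) by (simp add: B_def field_simps)
    finally show ?case by simp
  qed
  then have "\<forall>\<^sub>F y in at x. norm (?F y) \<le> B * e y"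
  proof eventually_elim
    case (elim y)
    then show ?case using order_trans[OF F mult_right_mono[OF elim]] by (simp add: e_def sum_nonneg)
  qed
  then have F0: "(?F \<longlongrightarrow> 0) (at x)"
    by (rule Lim_null_comparison) (use tendsto_mult_right_zero[OF e] in simp)
  have "((\<lambda>y. ?P (?A y - ?F y)) \<longlongrightarrow> ?P (?A x - 0)) (at x)"
    by (intro bounded_linear.tendsto[OF P] tendsto_diff A F0)
  then have "(?w \<longlongrightarrow> ?P (?A x - 0)) (at x)"
    by (rule Lim_transform_eventually) (use inS w in \<open>auto elim: eventually_mono\<close>)
  moreover have "?P (?A x - 0) = ?w x" using w[OF x] by simp
  ultimately show ?thesis unfolding isCont_def by simp
qed

text \<open>In the perturbation equation the components of \<open>?w\<close> occur only as factors
  of \<open>?E y c\<close>, which vanishes at \<open>y = x\<close>. The continuity just obtained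
  therefore suffices for the product rule.\<close>

lemma sharp_differentiable:
  assumes x: "x \<in> S" and \<alpha>: "\<And>y. y \<in> S \<Longrightarrow> linear (\<alpha> y)" and d: "\<And>b. (\<lambda>y. \<alpha> y b) differentiable (at x)"
  shows "(\<lambda>y. sharp G y (\<alpha> y)) differentiable (at x)"
proof -
  let ?w = "\<lambda>y. sharp G y (\<alpha> y)"
  let ?P = "\<lambda>v. sharp G x (\<lambda>z. v \<bullet> z)"
  let ?E = "\<lambda>y c. \<Sum>b\<in>Basis. (G y c b - G x c b) *\<^sub>R b"
  have P: "bounded_linear ?P" by (rule bounded_linear_sharp_inner[OF x])
  have cont: "isCont ?w x"
    by (rule sharp_isCont[OF x \<alpha>]) (auto intro: differentiable_imp_continuous_within d)
  have A: "((\<lambda>y. \<Sum>b\<in>Basis. \<alpha> y b *\<^sub>R b) has_derivative (\<lambda>h. \<Sum>b\<in>Basis. fderiv (\<lambda>y. \<alpha> y b) x h *\<^sub>R b)) (at x)"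
    by (rule has_derivative_sum, rule has_derivative_scaleR_left, rule has_derivative_fderiv[OF d])
  have E: "((\<lambda>y. ?E y c) has_derivative (\<lambda>h. \<Sum>b\<in>Basis. (fderiv (\<lambda>y. G y c b) x h - 0) *\<^sub>R b)) (at x)" for c
    by (rule has_derivative_sum, rule has_derivative_scaleR_left, rule has_derivative_diff,
        rule smooth_on_has_derivative[OF G_smooth x], rule has_derivative_const)
  have F: "((\<lambda>y. \<Sum>c\<in>Basis. (?w y \<bullet> c) *\<^sub>R ?E y c) has_derivative
     (\<lambda>h. \<Sum>c\<in>Basis. (?w x \<bullet> c) *\<^sub>R (\<Sum>b\<in>Basis. (fderiv (\<lambda>y. G y c b) x h - 0) *\<^sub>R b))) (at x)"
    by (rule has_derivative_sum, rule has_derivative_scaleR_vanishing[OF E])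
      (use cont in \<open>auto intro!: continuous_intros\<close>)
  have "(\<lambda>y. ?P ((\<Sum>b\<in>Basis. \<alpha> y b *\<^sub>R b) - (\<Sum>c\<in>Basis. (?w y \<bullet> c) *\<^sub>R ?E y c))) differentiable (at x)"
    using bounded_linear.has_derivative[OF P has_derivative_diff[OF A F]] unfolding differentiable_def by blast
  then show ?thesis
    by (rule differentiable_cong[OF open_S x, THEN iffD2, rotated]) (rule sharp_perturbation[OF x _ \<alpha>])
qed

lemma fderiv_G_linear_right: "x \<in> S \<Longrightarrow> linear (\<lambda>z. fderiv (\<lambda>y. G y u z) x h)"
  by (intro linear_fderiv_arg[OF open_S] G_linear_right smooth_on_differentiable[OF G_smooth])

lemma fderiv_G_linear_left: "x \<in> S \<Longrightarrow> linear (\<lambda>u. fderiv (\<lambda>y. G y u z) x h)"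
  by (intro linear_fderiv_arg[OF open_S] G_linear smooth_on_differentiable[OF G_smooth])

lemma G_has_derivative:
  assumes x: "x \<in> S" and A: "(A has_derivative A') (at x)" and B: "(B has_derivative B') (at x)"
  shows "((\<lambda>y. G y (A y) (B y)) has_derivative
    (\<lambda>w. fderiv (\<lambda>y. G y (A x) (B x)) x w + G x (A' w) (B x) + G x (A x) (B' w))) (at x)"
  by (rule has_derivative_bilinear_arg[OF open_S x _ _ _ A B])
    (auto intro: G_linear G_linear_right smooth_on_differentiable[OF G_smooth] x)

text \<open>Differentiating \<open>G y (?w y) z = \<alpha> y z\<close> shows that each directional
  derivative of \<open>?w\<close> is the \<open>sharp\<close> of a new covector field. That field
  involves \<open>?w\<close> undifferentiated, so the induction closes when \<open>\<alpha>\<close>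
  is arbitrary.\<close>

lemma sharp_Ck:
  assumes "\<And>y. y \<in> S \<Longrightarrow> linear (\<alpha> y)" "\<And>b. Ck_on k S (\<lambda>y. \<alpha> y b)"
  shows "Ck_on k S (\<lambda>y. sharp G y (\<alpha> y))"
  using assms
proof (induction k arbitrary: \<alpha>)
  case 0
  show ?case
    using sharp_isCont[of _ \<alpha>] 0 open_S by (simp add: continuous_on_eq_continuous_at)
next
  case (Suc k)
  let ?w = "\<lambda>y. sharp G y (\<alpha> y)"
  \<comment> \<open>The derivative of \<open>\<alpha>\<close> minus the derivative of the metric
    with first argument \<open>?w x\<close>. That argument is expanded in the basis, so that
    \<open>\<beta>\<close> is a sum of products whose factors are already known to be of class
    \<open>k\<close>.\<close>
  define \<beta> where "\<beta> h x z = fderiv (\<lambda>y. \<alpha> y z) x h - (\<Sum>c\<in>Basis. (?w x \<bullet> c) *\<^sub>R fderiv (\<lambda>y. G y c z) x h)" for h x z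
  have d: "(\<lambda>y. \<alpha> y b) differentiable (at x)" if "x \<in> S" for x b using Suc.prems(2) that by simp
  have w: "(?w has_derivative fderiv ?w x) (at x)" if "x \<in> S" for x
    by (intro has_derivative_fderiv sharp_differentiable that Suc.prems(1) d)
  have lin: "linear (\<beta> h x)" if x: "x \<in> S" for h x
  proof -
    have "linear (\<lambda>z. fderiv (\<lambda>y. \<alpha> y z) x h)"
      by (intro linear_fderiv_arg[OF open_S x] Suc.prems(1) d[OF x])
    then show ?thesis unfolding \<beta>_def
      by (intro linear_compose_sub linear_compose_sum ballI linear_compose_scale_right fderiv_G_linear_right x)
  qed
  have eq: "sharp G x (\<beta> h x) = fderiv ?w x h" if x: "x \<in> S" for x h
  proof (rule sharp_eqI[OF x])
    fix z
    have D1: "((\<lambda>y. G y (?w y) z) has_derivative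
      (\<lambda>h. fderiv (\<lambda>y. G y (?w x) z) x h + G x (fderiv ?w x h) z + G x (?w x) 0)) (at x)"
      by (rule G_has_derivative[OF x w[OF x] has_derivative_const])
    have D2: "((\<lambda>y. G y (?w y) z) has_derivative fderiv (\<lambda>y. \<alpha> y z) x) (at x)"
      by (rule has_derivative_transform_within_open[OF has_derivative_fderiv[OF d[OF x]] open_S x])
        (simp add: G_sharp Suc.prems(1))
    have "fderiv (\<lambda>y. \<alpha> y z) x h = fderiv (\<lambda>y. G y (?w x) z) x h + G x (fderiv ?w x h) z + G x (?w x) 0"
      by (rule fun_cong[OF has_derivative_unique[OF D2 D1]])
    moreover have "fderiv (\<lambda>y. G y (?w x) z) x h = (\<Sum>c\<in>Basis. (?w x \<bullet> c) *\<^sub>R fderiv (\<lambda>y. G y c z) x h)"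
      by (rule linear_Basis_expansion[OF fderiv_G_linear_left[OF x]])
    ultimately show "G x (fderiv ?w x h) z = \<beta> h x z" by (simp add: \<beta>_def x)
  qed
  show ?case
  proof (rule Ck_on_SucI[OF open_S w])
    fix h
    have "Ck_on k S (\<lambda>x. fderiv (\<lambda>y. G y c b) x h)" for c b
      using smooth_on_fderiv[OF G_smooth] unfolding smooth_on_def by blast
    moreover have "Ck_on k S (\<lambda>x. ?w x \<bullet> c)" for c
      by (rule Ck_on_linear[OF open_S bounded_linear_inner_left], rule Suc.IH)
        (auto intro: Suc.prems Ck_on_Suc_imp)
    moreover have "Ck_on k S (\<lambda>x. fderiv (\<lambda>y. \<alpha> y b) x h)" for b using Suc.prems(2) by simp
    ultimately have "Ck_on k S (\<lambda>x. \<beta> h x b)" for b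
      unfolding \<beta>_def diff_conv_add_uminus
      by (intro Ck_on_add[OF open_S] Ck_on_sum[OF open_S] Ck_on_scaleR[OF open_S]
          Ck_on_linear[OF open_S bounded_linear_minus[OF bounded_linear_ident], of _ "\<lambda>x. sum (f x) A" for f A])
    then have "Ck_on k S (\<lambda>x. sharp G x (\<beta> h x))" by (intro Suc.IH lin)
    then show "Ck_on k S (\<lambda>x. fderiv ?w x h)" 
      using Ck_on_cong[of S "\<lambda>x. sharp G x (\<beta> h x)" "\<lambda>x. fderiv ?w x h" k] open_S eq by simp
  qed
qed

lemma smooth_on_sharp:
  assumes "\<And>y. y \<in> S \<Longrightarrow> linear (\<alpha> y)" "\<And>b. smooth_on S (\<lambda>y. \<alpha> y b)"
  shows "smooth_on S (\<lambda>y. sharp G y (\<alpha> y))"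
  using sharp_Ck assms unfolding smooth_on_def by blast

section \<open>The Levi-Civita connection\<close>

abbreviation "\<Gamma> \<equiv> christoffel G"
abbreviation "R \<equiv> curvature_op G"

lemma fderiv_G_commute: "x \<in> S \<Longrightarrow> fderiv (\<lambda>y. G y u v) x = fderiv (\<lambda>y. G y v u) x"
  by (rule fderiv_cong[OF open_S]) (auto intro: G_commute)

lemma fderiv_G_linear: "x \<in> S \<Longrightarrow> linear (fderiv (\<lambda>y. G y u v) x)"
  by (rule smooth_on_linear_fderiv[OF G_smooth])

lemma koszul_linear:
  assumes x: "x \<in> S"
  shows "linear (\<lambda>z. (fderiv (\<lambda>y. G y v z) x u + fderiv (\<lambda>y. G y u z) x v - fderiv (\<lambda>y. G y u v) x z) / 2)"
  by (rule linearI)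
    (simp_all add: linear_add[OF fderiv_G_linear[OF x]] linear_cmul[OF fderiv_G_linear[OF x]]
      linear_add[OF fderiv_G_linear_right[OF x]] linear_cmul[OF fderiv_G_linear_right[OF x]] field_simps)

lemma G_christoffel:
  assumes x: "x \<in> S"
  shows "G x (\<Gamma> x u v) z =
    (fderiv (\<lambda>y. G y v z) x u + fderiv (\<lambda>y. G y u z) x v - fderiv (\<lambda>y. G y u v) x z) / 2"
  unfolding christoffel_def by (rule G_sharp[OF x koszul_linear[OF x]])

lemma christoffel_commute:
  assumes x: "x \<in> S" shows "\<Gamma> x u v = \<Gamma> x v u"
proof (rule G_eqI[OF x])
  fix z show "G x (\<Gamma> x u v) z = G x (\<Gamma> x v u) z"
    unfolding G_christoffel[OF x] fderiv_G_commute[OF x, of u v] by simp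
qed

lemma christoffel_linear_right: "x \<in> S \<Longrightarrow> linear (\<Gamma> x u)"
  by (intro linearI G_eqI[of x])
    (simp_all add: G_christoffel linear_add[OF fderiv_G_linear] linear_cmul[OF fderiv_G_linear]
      linear_add[OF fderiv_G_linear_right] linear_cmul[OF fderiv_G_linear_right]
      linear_add[OF fderiv_G_linear_left] linear_cmul[OF fderiv_G_linear_left] field_simps)

lemma christoffel_linear: "x \<in> S \<Longrightarrow> linear (\<lambda>u. \<Gamma> x u v)"
proof -
  assume x: "x \<in> S"
  then have "(\<lambda>u. \<Gamma> x u v) = \<Gamma> x v" using christoffel_commute by blast
  then show ?thesis using christoffel_linear_right[OF x] by simp
qed

text \<open>Metric compatibility of the connection. It trades derivatives of metric components for
  Christoffel terms, which then cancel in covariant derivatives.\<close>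

lemma fderiv_G_christoffel:
  "x \<in> S \<Longrightarrow> fderiv (\<lambda>y. G y u v) x w = G x (\<Gamma> x w u) v + G x u (\<Gamma> x w v)"
  by (simp add: G_commute[of x u "\<Gamma> x w v"] G_christoffel
      fderiv_G_commute[of x u v] fderiv_G_commute[of x w v] fderiv_G_commute[of x w u] field_simps)

lemma christoffel_smooth: "smooth_on S (\<lambda>x. \<Gamma> x u v)"
  unfolding christoffel_def
proof (rule smooth_on_sharp[OF koszul_linear])
  fix b
  have "smooth_on S (\<lambda>x. (1 / 2) *\<^sub>R (fderiv (\<lambda>y. G y v b) x u + fderiv (\<lambda>y. G y u b) x v - fderiv (\<lambda>y. G y u v) x b))"
    by (intro smooth_on_linear[OF open_S bounded_linear_scaleR_right] smooth_on_add[OF open_S]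
        smooth_on_diff[OF open_S] smooth_on_fderiv[OF G_smooth])
  then show "smooth_on S (\<lambda>x. (fderiv (\<lambda>y. G y v b) x u + fderiv (\<lambda>y. G y u b) x v - fderiv (\<lambda>y. G y u v) x b) / 2)"
    by simp
qed

lemmas christoffel_left [simp] = linear_add[OF christoffel_linear] linear_diff[OF christoffel_linear]
  linear_neg[OF christoffel_linear] linear_0[OF christoffel_linear] linear_cmul[OF christoffel_linear]

lemmas christoffel_right [simp] = linear_add[OF christoffel_linear_right] linear_diff[OF christoffel_linear_right]
  linear_neg[OF christoffel_linear_right] linear_0[OF christoffel_linear_right] linear_cmul[OF christoffel_linear_right]

lemma fderiv_christoffel_linear_right: "x \<in> S \<Longrightarrow> linear (\<lambda>v. fderiv (\<lambda>y. \<Gamma> y u v) x w)"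
  by (intro linear_fderiv_arg[OF open_S] christoffel_linear_right smooth_on_differentiable[OF christoffel_smooth])

lemma fderiv_christoffel_linear_left: "x \<in> S \<Longrightarrow> linear (\<lambda>u. fderiv (\<lambda>y. \<Gamma> y u v) x w)"
  by (intro linear_fderiv_arg[OF open_S] christoffel_linear smooth_on_differentiable[OF christoffel_smooth])

lemma fderiv_christoffel_linear: "x \<in> S \<Longrightarrow> linear (fderiv (\<lambda>y. \<Gamma> y u v) x)"
  by (rule smooth_on_linear_fderiv[OF christoffel_smooth])

lemmas fderiv_christoffel_simps [simp] =
  linear_add[OF fderiv_christoffel_linear_right] linear_cmul[OF fderiv_christoffel_linear_right]
  linear_add[OF fderiv_christoffel_linear_left] linear_cmul[OF fderiv_christoffel_linear_left]
  linear_add[OF fderiv_christoffel_linear] linear_cmul[OF fderiv_christoffel_linear]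

lemma christoffel_has_derivative:
  assumes x: "x \<in> S" and A: "(A has_derivative A') (at x)" and B: "(B has_derivative B') (at x)"
  shows "((\<lambda>y. \<Gamma> y (A y) (B y)) has_derivative
    (\<lambda>w. fderiv (\<lambda>y. \<Gamma> y (A x) (B x)) x w + \<Gamma> x (A' w) (B x) + \<Gamma> x (A x) (B' w))) (at x)"
  by (rule has_derivative_bilinear_arg[OF open_S x _ _ _ A B])
    (auto intro: christoffel_linear christoffel_linear_right smooth_on_differentiable[OF christoffel_smooth] x)

lemma smooth_on_christoffel:
  "smooth_on S A \<Longrightarrow> smooth_on S B \<Longrightarrow> smooth_on S (\<lambda>y. \<Gamma> y (A y) (B y))"
  by (rule smooth_on_bilinear_arg[OF open_S])
    (auto intro: christoffel_linear christoffel_linear_right christoffel_smooth)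

section \<open>Curvature as a tensor and its identities\<close>

lemma curvature_op_linear:
  assumes x: "x \<in> S"
  shows "linear (\<lambda>i. R x i j k)" "linear (\<lambda>j. R x i j k)" "linear (\<lambda>k. R x i j k)"
  unfolding curvature_op_def by (intro linearI; simp add: x algebra_simps)+

lemmas curvature_op_simps [simp] =
  linear_add[OF curvature_op_linear(1)] linear_add[OF curvature_op_linear(2)] linear_add[OF curvature_op_linear(3)]
  linear_cmul[OF curvature_op_linear(1)] linear_cmul[OF curvature_op_linear(2)] linear_cmul[OF curvature_op_linear(3)]

lemma curvature_op_skew: "R x j i k = - R x i j k"
  by (simp add: curvature_op_def)

lemma curvature_op_smooth: "smooth_on S (\<lambda>x. R x i j k)"
  unfolding curvature_op_def
  by (intro smooth_on_diff[OF open_S] smooth_on_add[OF open_S] smooth_on_fderiv christoffel_smooth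
      smooth_on_christoffel smooth_on_const)

lemma nabla_has_derivative:
  assumes x: "x \<in> S" and X: "smooth_on S X" and Z: "smooth_on S Z"
  shows "(nabla G X Z has_derivative (\<lambda>w.
    (fderiv (\<lambda>y. fderiv Z y (X x)) x w + fderiv Z x (fderiv X x w)) +
    (fderiv (\<lambda>y. \<Gamma> y (X x) (Z x)) x w + \<Gamma> x (fderiv X x w) (Z x) + \<Gamma> x (X x) (fderiv Z x w)))) (at x)"
proof -
  have "nabla G X Z = (\<lambda>y. fderiv Z y (X y) + \<Gamma> y (X y) (Z y))" by (simp add: nabla_def fun_eq_iff)
  moreover have "((\<lambda>y. fderiv Z y (X y)) has_derivative
      (\<lambda>w. fderiv (\<lambda>y. fderiv Z y (X x)) x w + fderiv Z x (fderiv X x w))) (at x)"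
    by (rule has_derivative_linear_arg[OF open_S x smooth_on_linear_fderiv[OF Z]])
      (auto intro: smooth_on_differentiable[OF smooth_on_fderiv[OF Z]] smooth_on_has_derivative[OF X] x)
  ultimately show ?thesis
    using has_derivative_add[OF _ christoffel_has_derivative[OF x smooth_on_has_derivative[OF X x] smooth_on_has_derivative[OF Z x]]]
    by simp
qed

text \<open>Tensoriality by cancellation: second derivatives of \<open>Z\<close> commute,
  derivatives of \<open>X\<close> and \<open>Y\<close> are removed by the bracket term, and the
  Christoffel terms containing first derivatives of \<open>Z\<close> are symmetric in
  \<open>X\<close> and \<open>Y\<close>.\<close>

lemma curvature_eq:
  assumes x: "x \<in> S" and X: "smooth_on S X" and Y: "smooth_on S Y" and Z: "smooth_on S Z"
  shows "curvature G X Y Z x = R x (X x) (Y x) (Z x)"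
proof -
  have n: "nabla G U (nabla G V Z) x =
      fderiv (\<lambda>y. fderiv Z y (V x)) x (U x) + fderiv Z x (fderiv V x (U x)) +
      (fderiv (\<lambda>y. \<Gamma> y (V x) (Z x)) x (U x) + \<Gamma> x (fderiv V x (U x)) (Z x) + \<Gamma> x (V x) (fderiv Z x (U x)))
      + \<Gamma> x (U x) (fderiv Z x (V x)) + \<Gamma> x (U x) (\<Gamma> x (V x) (Z x))" if V: "smooth_on S V" for U V
    unfolding nabla_def[of G U] fderiv_eqI[OF nabla_has_derivative[OF x V Z]]
    by (simp add: nabla_def x)
  have "nabla G (lie_bracket X Y) Z x = fderiv Z x (fderiv Y x (X x)) - fderiv Z x (fderiv X x (Y x))
     + \<Gamma> x (fderiv Y x (X x)) (Z x) - \<Gamma> x (fderiv X x (Y x)) (Z x)"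
    by (simp add: nabla_def lie_bracket_def x linear_diff[OF smooth_on_linear_fderiv[OF Z x]])
  then show ?thesis
    using fderiv_commute[OF open_S x Z, of "X x" "Y x"]
    unfolding curvature_def n[OF X] n[OF Y] curvature_op_def by simp
qed

lemma riemann_eq: "x \<in> S \<Longrightarrow> riemann G x i j k l = G x (R x i j k) l"
  by (simp add: riemann_def curvature4_def curvature_eq smooth_on_const)

lemma fderiv_curvature_op:
  assumes x: "x \<in> S"
  shows "fderiv (\<lambda>y. R y i j k) x m =
    fderiv (\<lambda>y. fderiv (\<lambda>y. \<Gamma> y i k) y j) x m - fderiv (\<lambda>y. fderiv (\<lambda>y. \<Gamma> y j k) y i) x m
    + (fderiv (\<lambda>y. \<Gamma> y j (\<Gamma> x i k)) x m + \<Gamma> x j (fderiv (\<lambda>y. \<Gamma> y i k) x m))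
    - (fderiv (\<lambda>y. \<Gamma> y i (\<Gamma> x j k)) x m + \<Gamma> x i (fderiv (\<lambda>y. \<Gamma> y j k) x m))"
proof -
  have D: "((\<lambda>y. \<Gamma> y u v) has_derivative fderiv (\<lambda>y. \<Gamma> y u v) x) (at x)" for u v
    by (rule smooth_on_has_derivative[OF christoffel_smooth x])
  have DD: "((\<lambda>y. fderiv (\<lambda>y. \<Gamma> y u v) y w) has_derivative fderiv (\<lambda>y. fderiv (\<lambda>y. \<Gamma> y u v) y w) x) (at x)" for u v w
    by (rule smooth_on_has_derivative[OF smooth_on_fderiv[OF christoffel_smooth] x])
  note * = christoffel_has_derivative[OF x has_derivative_const D]
  show ?thesis
    unfolding curvature_op_def
      fderiv_eqI[OF has_derivative_diff[OF has_derivative_add[OF has_derivative_diff[OF DD DD] *] *]]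
    by (simp add: x)
qed

text \<open>In the cyclic sum the second derivatives of \<open>\<Gamma>\<close> cancel by symmetry,
  the corrections in the first two slots by vanishing torsion and skewness, and the rest after
  expansion of \<open>R\<close>.\<close>

lemma second_bianchi_op:
  assumes x: "x \<in> S"
  shows "nabla_curvature_op G x m i j k + nabla_curvature_op G x i j m k + nabla_curvature_op G x j m i k = 0"
proof -
  have c: "fderiv (\<lambda>y. fderiv (\<lambda>y. \<Gamma> y i k) y j) x m = fderiv (\<lambda>y. fderiv (\<lambda>y. \<Gamma> y i k) y m) x j"
    "fderiv (\<lambda>y. fderiv (\<lambda>y. \<Gamma> y j k) y i) x m = fderiv (\<lambda>y. fderiv (\<lambda>y. \<Gamma> y j k) y m) x i"
    "fderiv (\<lambda>y. fderiv (\<lambda>y. \<Gamma> y m k) y i) x j = fderiv (\<lambda>y. fderiv (\<lambda>y. \<Gamma> y m k) y j) x i"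
    by (rule fderiv_commute[OF open_S x christoffel_smooth])+
  have g: "\<Gamma> x i m = \<Gamma> x m i" "\<Gamma> x j m = \<Gamma> x m j" "\<Gamma> x j i = \<Gamma> x i j"
    by (rule christoffel_commute[OF x])+
  \<comment> \<open>Once torsion-freeness has aligned the lower indices, the six corrections in the
    first two slots form these three skew pairs.\<close>
  have r: "R x (\<Gamma> x m i) j k + R x j (\<Gamma> x m i) k = 0" "R x i (\<Gamma> x m j) k + R x (\<Gamma> x m j) i k = 0"
    "R x (\<Gamma> x i j) m k + R x m (\<Gamma> x i j) k = 0"
    by (simp_all add: curvature_op_def)
  have "nabla_curvature_op G x m i j k + nabla_curvature_op G x i j m k + nabla_curvature_op G x j m i k =
    (fderiv (\<lambda>y. R y i j k) x m + \<Gamma> x m (R x i j k) - R x i j (\<Gamma> x m k))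
    + (fderiv (\<lambda>y. R y j m k) x i + \<Gamma> x i (R x j m k) - R x j m (\<Gamma> x i k))
    + (fderiv (\<lambda>y. R y m i k) x j + \<Gamma> x j (R x m i k) - R x m i (\<Gamma> x j k))
    - (R x (\<Gamma> x m i) j k + R x j (\<Gamma> x m i) k) - (R x i (\<Gamma> x m j) k + R x (\<Gamma> x m j) i k)
    - (R x (\<Gamma> x i j) m k + R x m (\<Gamma> x i j) k)"
    unfolding nabla_curvature_op_def g by (simp add: algebra_simps)
  also have "\<dots> = 0"
    unfolding r fderiv_curvature_op[OF x] unfolding c unfolding curvature_op_def
    by (simp add: x algebra_simps)
  finally show ?thesis .
qed

lemma nabla4_riemann:
  assumes x: "x \<in> S"
  shows "nabla4 G (riemann G) x m i j k l = G x (nabla_curvature_op G x m i j k) l"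
proof -
  have "fderiv (\<lambda>y. riemann G y i j k l) x = fderiv (\<lambda>y. G y (R y i j k) l) x"
    by (rule fderiv_cong[OF open_S x]) (rule riemann_eq)
  then show ?thesis
    unfolding nabla4_def nabla_curvature_op_def
    using fderiv_eqI[OF G_has_derivative[OF x smooth_on_has_derivative[OF curvature_op_smooth x] has_derivative_const]]
    by (simp add: riemann_eq x fderiv_G_christoffel)
qed

lemma riemann_smooth: "smooth_on S (\<lambda>x. riemann G x i j k l)"
  by (subst smooth_on_cong[OF open_S riemann_eq])
    (auto intro: smooth_on_linear_arg[OF open_S G_linear G_smooth curvature_op_smooth])

text \<open>The second partial derivatives of a metric component commute. Expanded with metric
  compatibility, their difference is the sum of \<open>G x (R x i j k) l\<close> and
  \<open>G x k (R x i j l)\<close>; products of two Christoffel vectors are symmetric in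
  \<open>i\<close> and \<open>j\<close> and drop out.\<close>

lemma riemann_skew_right:
  assumes x: "x \<in> S"
  shows "riemann G x i j k l = - riemann G x i j l k"
proof -
  have e: "fderiv (\<lambda>y. fderiv (\<lambda>y. G y k l) y i) x j =
      G x (\<Gamma> x j (\<Gamma> x i k) + fderiv (\<lambda>y. \<Gamma> y i k) x j) l + G x (\<Gamma> x i k) (\<Gamma> x j l)
      + G x k (\<Gamma> x j (\<Gamma> x i l) + fderiv (\<lambda>y. \<Gamma> y i l) x j) + G x (\<Gamma> x j k) (\<Gamma> x i l)" for i j
  proof -
    have D: "((\<lambda>y. \<Gamma> y u v) has_derivative fderiv (\<lambda>y. \<Gamma> y u v) x) (at x)" for u v
      by (rule smooth_on_has_derivative[OF christoffel_smooth x])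
    have "fderiv (\<lambda>y. fderiv (\<lambda>y. G y k l) y i) x = fderiv (\<lambda>y. G y (\<Gamma> y i k) l + G y k (\<Gamma> y i l)) x"
      by (rule fderiv_cong[OF open_S x]) (rule fderiv_G_christoffel)
    also have "\<dots> = (\<lambda>w. (fderiv (\<lambda>y. G y (\<Gamma> x i k) l) x w + G x (fderiv (\<lambda>y. \<Gamma> y i k) x w) l + G x (\<Gamma> x i k) 0)
       + (fderiv (\<lambda>y. G y k (\<Gamma> x i l)) x w + G x 0 (\<Gamma> x i l) + G x k (fderiv (\<lambda>y. \<Gamma> y i l) x w)))"
      by (rule fderiv_eqI, rule has_derivative_add; rule G_has_derivative[OF x]; rule D has_derivative_const)
    finally show ?thesis by (simp add: x fderiv_G_christoffel)
  qed
  have "fderiv (\<lambda>y. fderiv (\<lambda>y. G y k l) y i) x j = fderiv (\<lambda>y. fderiv (\<lambda>y. G y k l) y j) x i"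
    by (rule fderiv_commute[OF open_S x G_smooth])
  then have "G x (R x i j k) l + G x k (R x i j l) = 0"
    unfolding e curvature_op_def by (simp add: x)
  then show ?thesis by (simp add: riemann_eq x G_commute[OF x, of k])
qed

lemma nabla4_riemann_skew_left:
  assumes x: "x \<in> S" shows "nabla4 G (riemann G) x m j i k l = - nabla4 G (riemann G) x m i j k l"
proof -
  have s: "riemann G y b a c d = - riemann G y a b c d" if "y \<in> S" for y a b c d
    using that curvature_op_skew[of y b a c] by (simp add: riemann_eq)
  have "fderiv (\<lambda>y. riemann G y j i k l) x = fderiv (\<lambda>y. - riemann G y i j k l) x"
    by (rule fderiv_cong[OF open_S x]) (rule s)
  also have "\<dots> = (\<lambda>w. - fderiv (\<lambda>y. riemann G y i j k l) x w)"
    by (rule fderiv_eqI[OF has_derivative_minus[OF smooth_on_has_derivative[OF riemann_smooth x]]])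
  finally show ?thesis
    unfolding nabla4_def s[OF x, of j] s[OF x, of "\<Gamma> x m j"] by simp
qed

lemma nabla4_riemann_skew_right:
  assumes x: "x \<in> S" shows "nabla4 G (riemann G) x m i j l k = - nabla4 G (riemann G) x m i j k l"
proof -
  have "fderiv (\<lambda>y. riemann G y i j l k) x = fderiv (\<lambda>y. - riemann G y i j k l) x"
    by (rule fderiv_cong[OF open_S x]) (rule riemann_skew_right)
  also have "\<dots> = (\<lambda>w. - fderiv (\<lambda>y. riemann G y i j k l) x w)"
    by (rule fderiv_eqI[OF has_derivative_minus[OF smooth_on_has_derivative[OF riemann_smooth x]]])
  finally show ?thesis
    unfolding nabla4_def riemann_skew_right[OF x, of _ _ l] riemann_skew_right[OF x, of _ _ "\<Gamma> x m l"] by simp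
qed

section \<open>Traces with respect to the metric\<close>

lemma inv_metric_expansion:
  "(\<Sum>j\<in>Basis. inv_metric G x i j *\<^sub>R j) = sharp G x (\<lambda>z. z \<bullet> i)"
  unfolding inv_metric_def by (rule euclidean_representation)

lemma metric_trace_linear:
  assumes "\<And>i. i \<in> Basis \<Longrightarrow> linear (T i)"
  shows "metric_trace G x T = (\<Sum>i\<in>Basis. T i (sharp G x (\<lambda>z. z \<bullet> i)))"
  unfolding metric_trace_def
proof (rule sum.cong[OF refl])
  fix i :: 'e assume "i \<in> Basis"
  then have l: "linear (T i)" by (rule assms)
  show "(\<Sum>j\<in>Basis. inv_metric G x i j * T i j) = T i (sharp G x (\<lambda>z. z \<bullet> i))"
    unfolding inv_metric_expansion[symmetric] linear_sum[OF l] linear_cmul[OF l] by simp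
qed

text \<open>The inverse metric raises the index that \<open>G\<close> has lowered, so what remains
  is the ordinary trace in the coordinate basis.\<close>

lemma metric_trace_endo:
  assumes x: "x \<in> S" shows "metric_trace G x (\<lambda>i. G x (L i)) = (\<Sum>i\<in>Basis. L i \<bullet> i)"
proof -
  have "G x (L i) (sharp G x (\<lambda>z. z \<bullet> i)) = L i \<bullet> i" for i
    unfolding G_commute[OF x, of "L i"] by (rule G_sharp[OF x]) (simp add: bounded_linear.linear bounded_linear_inner_left)
  then show ?thesis
    by (subst metric_trace_linear) (simp_all add: G_linear_right x)
qed

lemma metric_trace_G: "x \<in> S \<Longrightarrow> metric_trace G x (G x) = real DIM('e)"
  using metric_trace_endo[of x "\<lambda>i. i"] by simp

lemma metric_trace_covector:
  assumes x: "x \<in> S" and \<alpha>: "linear \<alpha>" shows "metric_trace G x (\<lambda>m l. \<alpha> m * G x j l) = \<alpha> j"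
proof -
  have "metric_trace G x (\<lambda>m. G x (\<alpha> m *\<^sub>R j)) = (\<Sum>m\<in>Basis. (\<alpha> m *\<^sub>R j) \<bullet> m)"
    by (rule metric_trace_endo[OF x])
  moreover have "\<alpha> j = (\<Sum>m\<in>Basis. (j \<bullet> m) *\<^sub>R \<alpha> m)" by (rule linear_Basis_expansion[OF \<alpha>])
  moreover have "(\<lambda>m. G x (\<alpha> m *\<^sub>R j)) = (\<lambda>m l. \<alpha> m * G x j l)" by (simp add: fun_eq_iff x)
  ultimately show ?thesis by (simp add: mult.commute)
qed

lemma ricci_eq:
  assumes x: "x \<in> S" shows "ricci G x i k = (\<Sum>b\<in>Basis. R x i b k \<bullet> b)"
  unfolding ricci_def riemann_eq[OF x] by (rule metric_trace_endo[OF x])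

lemma ricci_smooth: "smooth_on S (\<lambda>x. ricci G x i k)"
  by (subst smooth_on_cong[OF open_S ricci_eq])
    (auto intro!: smooth_on_sum[OF open_S] smooth_on_inner_right[OF open_S] curvature_op_smooth)

lemma ricci_linear:
  assumes x: "x \<in> S" shows "linear (\<lambda>i. ricci G x i k)" "linear (ricci G x i)"
  by (rule linearI; simp add: x ricci_eq inner_add_left sum.distrib sum_distrib_left)+

lemmas ricci_simps [simp] = linear_add[OF ricci_linear(1)] linear_add[OF ricci_linear(2)]
  linear_diff[OF ricci_linear(1)] linear_diff[OF ricci_linear(2)]
  linear_0[OF ricci_linear(1)] linear_0[OF ricci_linear(2)]
  linear_cmul[OF ricci_linear(1)] linear_cmul[OF ricci_linear(2)]

text \<open>\<open>T\<close> is written as \<open>G y (L y i) k\<close> with the endomorphism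
  \<open>L\<close> obtained by \<open>sharp\<close>, and its trace is the ordinary trace of
  \<open>L\<close>. Differentiating that trace involves no connection; the commutator of
  \<open>L\<close> with the Christoffel map, which the covariant derivative adds, has trace
  0.\<close>

lemma
  assumes lin: "\<And>y k. y \<in> S \<Longrightarrow> linear (\<lambda>i. T y i k)" "\<And>y i. y \<in> S \<Longrightarrow> linear (T y i)"
    and T: "\<And>i k. smooth_on S (\<lambda>y. T y i k)"
  shows metric_trace_smooth: "smooth_on S (\<lambda>y. metric_trace G y (T y))"
    and fderiv_metric_trace: "x \<in> S \<Longrightarrow>
      fderiv (\<lambda>y. metric_trace G y (T y)) x m = metric_trace G x (nabla2 G T x m)"
proof -
  define L where "L y i = sharp G y (T y i)" for y i
  have GL: "G y (L y i) z = T y i z" if "y \<in> S" for y i z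
    unfolding L_def by (rule G_sharp[OF that lin(2)[OF that]])
  have L_smooth: "smooth_on S (\<lambda>y. L y i)" for i
    unfolding L_def by (rule smooth_on_sharp[OF lin(2) T])
  have L_linear: "linear (L y)" if y: "y \<in> S" for y
    by (intro linearI G_eqI[OF y])
      (simp_all add: GL y linear_add[OF lin(1)] linear_cmul[OF lin(1)])
  have tr: "metric_trace G y (T y) = (\<Sum>i\<in>Basis. L y i \<bullet> i)" if y: "y \<in> S" for y
  proof -
    have "T y = (\<lambda>i. G y (L y i))" using GL[OF y] by (simp add: fun_eq_iff)
    then show ?thesis using metric_trace_endo[OF y, of "L y"] by simp
  qed
  show "smooth_on S (\<lambda>y. metric_trace G y (T y))"
    by (subst smooth_on_cong[OF open_S tr])
      (auto intro!: smooth_on_sum[OF open_S] smooth_on_inner_right[OF open_S] L_smooth)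
  assume x: "x \<in> S"
  note dL = smooth_on_has_derivative[OF L_smooth x]
  have "fderiv (\<lambda>y. metric_trace G y (T y)) x = fderiv (\<lambda>y. \<Sum>i\<in>Basis. L y i \<bullet> i) x"
    by (rule fderiv_cong[OF open_S x]) (rule tr)
  also have "\<dots> = (\<lambda>w. \<Sum>i\<in>Basis. fderiv (\<lambda>y. L y i) x w \<bullet> i)"
    by (rule fderiv_eqI, rule has_derivative_sum, rule has_derivative_inner_left[OF dL])
  finally have l: "fderiv (\<lambda>y. metric_trace G y (T y)) x m = (\<Sum>i\<in>Basis. fderiv (\<lambda>y. L y i) x m \<bullet> i)"
    by simp
  \<comment> \<open>Since the metric is parallel, lowering an index commutes with covariant
    differentiation.\<close>
  have "nabla2 G T x m = (\<lambda>i. G x (fderiv (\<lambda>y. L y i) x m + \<Gamma> x m (L x i) - L x (\<Gamma> x m i)))"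
  proof (intro ext)
    fix i k
    have "fderiv (\<lambda>y. T y i k) x = fderiv (\<lambda>y. G y (L y i) k) x"
      by (rule fderiv_cong[OF open_S x]) (simp add: GL)
    also have "\<dots> = (\<lambda>w. fderiv (\<lambda>y. G y (L x i) k) x w + G x (fderiv (\<lambda>y. L y i) x w) k + G x (L x i) 0)"
      by (rule fderiv_eqI[OF G_has_derivative[OF x dL has_derivative_const]])
    finally show "nabla2 G T x m i k = G x (fderiv (\<lambda>y. L y i) x m + \<Gamma> x m (L x i) - L x (\<Gamma> x m i)) k"
      by (simp add: nabla2_def x fderiv_G_christoffel GL)
  qed
  then show "fderiv (\<lambda>y. metric_trace G y (T y)) x m = metric_trace G x (nabla2 G T x m)"
    using trace_commute[OF christoffel_linear_right[OF x, of m] L_linear[OF x]]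
    by (simp add: l metric_trace_endo[OF x] inner_add_left inner_diff_left sum.distrib sum_subtractf)
qed

section \<open>Ricci tensor, contracted Bianchi identity and concircular tensor\<close>

lemma riemann_linear:
  assumes x: "x \<in> S"
  shows "linear (\<lambda>i. riemann G x i j k l)" "linear (\<lambda>j. riemann G x i j k l)"
    "linear (\<lambda>k. riemann G x i j k l)" "linear (riemann G x i j k)"
  by (rule linearI; simp add: x riemann_eq)+

text \<open>Covariant differentiation commutes with contraction: for fixed \<open>i\<close> and
  \<open>k\<close> the traced slots form a 2-tensor covered by \<open>fderiv_metric_trace\<close>,
  and the corrections in the two free slots are those of \<open>nabla2\<close>.\<close>

lemma ricci_nabla:
  assumes x: "x \<in> S"
  shows "metric_trace G x (\<lambda>a b. nabla4 G (riemann G) x m i a k b) = nabla2 G (ricci G) x m i k"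
proof -
  have "(\<lambda>a b. nabla4 G (riemann G) x m i a k b) = (\<lambda>a b. nabla2 G (\<lambda>y a. riemann G y i a k) x m a b
      - riemann G x (\<Gamma> x m i) a k b - riemann G x i a (\<Gamma> x m k) b)"
    by (simp add: nabla4_def nabla2_def fun_eq_iff)
  then have "metric_trace G x (\<lambda>a b. nabla4 G (riemann G) x m i a k b) =
      metric_trace G x (nabla2 G (\<lambda>y a. riemann G y i a k) x m) - ricci G x (\<Gamma> x m i) k - ricci G x i (\<Gamma> x m k)"
    by (simp only: metric_trace_diff ricci_def)
  also have "metric_trace G x (nabla2 G (\<lambda>y a. riemann G y i a k) x m) = fderiv (\<lambda>y. ricci G y i k) x m"
    unfolding ricci_def by (rule fderiv_metric_trace[symmetric]) (auto intro: riemann_linear riemann_smooth x)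
  finally show ?thesis by (simp add: nabla2_def)
qed

lemma div4_riemann:
  assumes x: "x \<in> S"
  shows "div4 G (riemann G) x i j k = ricci_codazzi G x i j k"
proof -
  \<comment> \<open>A flip of the first two slots in one term of the Bianchi identity moves
    \<open>m\<close> to the second slot of \<open>riemann\<close>, where \<open>ricci\<close>
    contracts it.\<close>
  have "nabla4 G (riemann G) x m i j k l = nabla4 G (riemann G) x j i m k l - nabla4 G (riemann G) x i j m k l" for m l
    using arg_cong[OF second_bianchi_op[OF x, of m i j k], of "\<lambda>u. G x u l"] nabla4_riemann_skew_left[OF x, of j m i k l]
    by (simp add: nabla4_riemann x)
  then show ?thesis
    unfolding div4_def ricci_codazzi_def ricci_nabla[OF x, symmetric] metric_trace_diff[symmetric]
    by (intro metric_trace_cong)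
qed

lemma scalar_curvature_smooth: "smooth_on S (scalar_curvature G)"
proof -
  have "scalar_curvature G = (\<lambda>y. metric_trace G y (ricci G y))" by (simp add: scalar_curvature_def fun_eq_iff)
  then show ?thesis using metric_trace_smooth[OF ricci_linear ricci_smooth] by simp
qed

text \<open>Exchanging the two traces of the divergence and applying both skew symmetries gives the
  divergence of the Ricci tensor. Tracing the Codazzi defect directly gives the derivative of the
  scalar curvature minus that same divergence. Hence each is half of the derivative.\<close>

lemma trace_ricci_codazzi:
  assumes x: "x \<in> S"
  shows "metric_trace G x (\<lambda>i k. ricci_codazzi G x i j k) = fderiv (scalar_curvature G) x j / 2"
proof -
  have "metric_trace G x (\<lambda>i k. div4 G (riemann G) x i j k)
     = metric_trace G x (\<lambda>m l. metric_trace G x (\<lambda>i k. nabla4 G (riemann G) x m i j k l))"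
    unfolding div4_def by (rule metric_trace_swap)
  also have "\<dots> = metric_trace G x (\<lambda>m l. metric_trace G x (\<lambda>i k. nabla4 G (riemann G) x m j i l k))"
  proof -
    have "nabla4 G (riemann G) x m i j k l = nabla4 G (riemann G) x m j i l k" for m i k l
      using nabla4_riemann_skew_left[OF x, of m j i k l] nabla4_riemann_skew_right[OF x, of m j i k l] by simp
    then show ?thesis by simp
  qed
  also have "\<dots> = metric_trace G x (\<lambda>m l. nabla2 G (ricci G) x m j l)"
    by (simp only: ricci_nabla[OF x])
  finally have 1: "metric_trace G x (\<lambda>i k. ricci_codazzi G x i j k) = metric_trace G x (\<lambda>m l. nabla2 G (ricci G) x m j l)"
    by (simp only: div4_riemann[OF x])
  have "fderiv (scalar_curvature G) x j = metric_trace G x (nabla2 G (ricci G) x j)"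
    using fderiv_metric_trace[OF ricci_linear ricci_smooth x]
    by (simp add: scalar_curvature_def[abs_def])
  moreover have "metric_trace G x (\<lambda>i k. ricci_codazzi G x i j k) =
      metric_trace G x (nabla2 G (ricci G) x j) - metric_trace G x (\<lambda>i k. nabla2 G (ricci G) x i j k)"
    unfolding ricci_codazzi_def by (rule metric_trace_diff)
  ultimately show ?thesis using 1 by simp
qed

text \<open>Products of metrics are parallel, so in the correction term only the derivative of the
  scalar curvature survives, and the trace contracts it with one metric factor.\<close>

lemma div4_concircular:
  assumes x: "x \<in> S"
  shows "div4 G (concircular G) x i j k = ricci_codazzi G x i j k
    - (G x i k * fderiv (scalar_curvature G) x j - G x j k * fderiv (scalar_curvature G) x i)
      / (real DIM('e) * (real DIM('e) - 1))"
proof -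
  \<comment> \<open>In dimension 1 this is \<open>1 / 0 = 0\<close>, the same default value as in
    \<open>concircular\<close>.\<close>
  define \<kappa> where "\<kappa> = 1 / (real DIM('e) * (real DIM('e) - 1))"
  let ?t = "scalar_curvature G"
  have conc: "concircular G y i j k l = riemann G y i j k l - \<kappa> * (?t y * (G y i k * G y j l - G y j k * G y i l))"
    for y i j k l by (simp add: concircular_def \<kappa>_def)
  note dG = smooth_on_has_derivative[OF G_smooth x]
  have t: "(?t has_derivative fderiv ?t x) (at x)"
    by (rule smooth_on_has_derivative[OF scalar_curvature_smooth x])
  have d: "fderiv (\<lambda>y. concircular G y i j k l) x m = fderiv (\<lambda>y. riemann G y i j k l) x m
     - \<kappa> * (?t x * ((G x i k * fderiv (\<lambda>y. G y j l) x m + fderiv (\<lambda>y. G y i k) x m * G x j l)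
       - (G x j k * fderiv (\<lambda>y. G y i l) x m + fderiv (\<lambda>y. G y j k) x m * G x i l))
       + fderiv ?t x m * (G x i k * G x j l - G x j k * G x i l))" for m l
    unfolding conc
      fderiv_eqI[OF has_derivative_diff[OF smooth_on_has_derivative[OF riemann_smooth x]
        has_derivative_mult_right[OF has_derivative_mult[OF t has_derivative_diff[OF
          has_derivative_mult[OF dG dG] has_derivative_mult[OF dG dG]]]]]] ..
  have "nabla4 G (concircular G) x m i j k l = nabla4 G (riemann G) x m i j k l
     - \<kappa> * (G x i k * (fderiv ?t x m * G x j l) - G x j k * (fderiv ?t x m * G x i l))" for m l
    unfolding nabla4_def d unfolding conc fderiv_G_christoffel[OF x]
    by (simp add: algebra_simps)
  then have "div4 G (concircular G) x i j k = metric_trace G x (\<lambda>m l. nabla4 G (riemann G) x m i j k l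
     - \<kappa> * (G x i k * (fderiv ?t x m * G x j l) - G x j k * (fderiv ?t x m * G x i l)))"
    unfolding div4_def by (intro metric_trace_cong)
  also have "\<dots> = div4 G (riemann G) x i j k - \<kappa> * (G x i k * fderiv ?t x j - G x j k * fderiv ?t x i)"
    unfolding div4_def metric_trace_diff metric_trace_cmult
      metric_trace_covector[OF x smooth_on_linear_fderiv[OF scalar_curvature_smooth x]] ..
  finally show ?thesis by (simp add: div4_riemann[OF x] \<kappa>_def)
qed

lemma ricci_codazzi_if_div4_concircular:
  assumes x: "x \<in> S" and n: "DIM('e) \<ge> 3"
    and div: "\<And>i j k. i \<in> Basis \<Longrightarrow> j \<in> Basis \<Longrightarrow> k \<in> Basis \<Longrightarrow> div4 G (concircular G) x i j k = 0"
    and b: "i \<in> Basis" "j \<in> Basis" "k \<in> Basis"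
  shows "ricci_codazzi G x i j k = 0"
proof -
  let ?dt = "fderiv (scalar_curvature G) x"
  let ?n = "real DIM('e)"
  have cod: "ricci_codazzi G x i j k = (1 / (?n * (?n - 1))) * (?dt j * G x i k - ?dt i * G x j k)"
    if "i \<in> Basis" "j \<in> Basis" "k \<in> Basis" for i j k
    using div[OF that] div4_concircular[OF x, of i j k] by (simp add: mult.commute)
  have dt: "?dt j = 0" if j: "j \<in> Basis" for j
  proof -
    have "metric_trace G x (\<lambda>i k. ricci_codazzi G x i j k) =
      metric_trace G x (\<lambda>i k. (1 / (?n * (?n - 1))) * (?dt j * G x i k - ?dt i * G x j k))"
      by (rule metric_trace_cong) (rule cod[OF _ j])
    also have "\<dots> = (1 / (?n * (?n - 1))) * (?dt j * ?n - ?dt j)"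
      unfolding metric_trace_cmult metric_trace_diff
        metric_trace_covector[OF x smooth_on_linear_fderiv[OF scalar_curvature_smooth x]] metric_trace_G[OF x] ..
    also have "\<dots> = ?dt j / ?n" using n by (simp add: field_simps)
    \<comment> \<open>For \<open>n = 2\<close> both sides coincide and nothing follows;
      \<open>n \<ge> 3\<close> forces the derivative to vanish.\<close>
    finally have "?dt j / 2 = ?dt j / ?n" unfolding trace_ricci_codazzi[OF x] .
    then show ?thesis using n by (simp add: field_simps)
  qed
  show ?thesis using cod[OF b] dt b by simp
qed

text \<open>A vanishing Codazzi defect has trace 0, which is half the derivative of the scalar
  curvature whatever the dimension; the correction term in \<open>div4_concircular\<close> then
  vanishes too.\<close>

lemma div4_concircular_if_ricci_codazzi:
  assumes x: "x \<in> S"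
    and cod: "\<And>i j k. i \<in> Basis \<Longrightarrow> j \<in> Basis \<Longrightarrow> k \<in> Basis \<Longrightarrow> ricci_codazzi G x i j k = 0"
    and b: "i \<in> Basis" "j \<in> Basis" "k \<in> Basis"
  shows "div4 G (concircular G) x i j k = 0"
proof -
  have "fderiv (scalar_curvature G) x j = 0" if "j \<in> Basis" for j
  proof -
    have "metric_trace G x (\<lambda>i k. ricci_codazzi G x i j k) = metric_trace G x (\<lambda>i k. 0)"
      by (rule metric_trace_cong) (rule cod[OF _ that])
    then show ?thesis unfolding trace_ricci_codazzi[OF x] by (simp add: metric_trace_def)
  qed
  then show ?thesis using div4_concircular[OF x, of i j k] cod[OF b] b by simp
qed

section \<open>Gradient and Hessian\<close>

lemma nabla_const: "nabla G (\<lambda>_. u) Z x = fderiv Z x u + \<Gamma> x u (Z x)"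
  by (simp add: nabla_def)

lemma nabla_const_smooth:
  assumes Z: "smooth_on S Z" shows "smooth_on S (nabla G (\<lambda>_. u) Z)"
proof -
  have "smooth_on S (\<lambda>x. fderiv Z x u + \<Gamma> x u (Z x))"
    by (intro smooth_on_add[OF open_S] smooth_on_fderiv[OF Z] smooth_on_christoffel smooth_on_const Z)
  then show ?thesis by (simp add: nabla_const[abs_def])
qed

context
  fixes h :: "'e \<Rightarrow> real"
  assumes h: "smooth_on S h"
begin

lemma gradient_smooth: "smooth_on S (gradient G h)"
proof -
  have "smooth_on S (\<lambda>x. sharp G x (fderiv h x))"
    by (rule smooth_on_sharp) (auto intro: smooth_on_linear_fderiv[OF h] smooth_on_fderiv[OF h])
  then show ?thesis by (simp add: gradient_def[abs_def])
qed

lemma G_gradient: "x \<in> S \<Longrightarrow> G x (gradient G h x) v = fderiv h x v"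
  unfolding gradient_def by (rule G_sharp) (auto intro: smooth_on_linear_fderiv[OF h])

lemma hess_eq:
  assumes x: "x \<in> S"
  shows "hess G h x u v = fderiv (\<lambda>y. fderiv h y v) x u - fderiv h x (\<Gamma> x u v)"
proof -
  have "fderiv (\<lambda>y. fderiv h y v) x = fderiv (\<lambda>y. G y (gradient G h y) v) x"
    by (rule fderiv_cong[OF open_S x]) (simp add: G_gradient)
  also have "\<dots> = (\<lambda>w. fderiv (\<lambda>y. G y (gradient G h x) v) x w + G x (fderiv (gradient G h) x w) v + G x (gradient G h x) 0)"
    by (rule fderiv_eqI[OF G_has_derivative[OF x smooth_on_has_derivative[OF gradient_smooth x] has_derivative_const]])
  finally show ?thesis
    by (simp add: hess_def nabla_const x fderiv_G_christoffel G_gradient[symmetric])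
qed

lemma hess_smooth: "smooth_on S (\<lambda>x. hess G h x u v)"
  unfolding hess_def
  by (rule smooth_on_linear_arg[OF open_S G_linear G_smooth nabla_const_smooth[OF gradient_smooth]])

text \<open>The Ricci identity for the gradient: the Hessian is the lowered covariant derivative of
  \<open>gradient G h\<close>, so its antisymmetrised derivative is a commutator of covariant
  derivatives. The correction terms are symmetric in \<open>i\<close> and \<open>j\<close> because
  the connection has no torsion.\<close>

lemma nabla2_hess_commutator:
  assumes x: "x \<in> S"
  shows "nabla2 G (hess G h) x j i k - nabla2 G (hess G h) x i j k = G x (R x i j (gradient G h x)) k"
proof -
  let ?N = "\<lambda>i. nabla G (\<lambda>_. i) (gradient G h)"
  have d: "nabla2 G (hess G h) x m i k = G x (nabla G (\<lambda>_. m) (?N i) x) k - hess G h x (\<Gamma> x m i) k" for m i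
  proof -
    have "fderiv (\<lambda>y. hess G h y i k) x = (\<lambda>w. fderiv (\<lambda>y. G y (?N i x) k) x w + G x (fderiv (?N i) x w) k + G x (?N i x) 0)"
      unfolding hess_def
      by (rule fderiv_eqI[OF G_has_derivative[OF x smooth_on_has_derivative[OF nabla_const_smooth[OF gradient_smooth] x] has_derivative_const]])
    then show ?thesis
      by (simp add: nabla2_def nabla_const[of m] x fderiv_G_christoffel hess_def[of G h x i])
  qed
  \<comment> \<open>Coordinate fields commute, so the bracket term of the curvature is 0.\<close>
  have "curvature G (\<lambda>_. i) (\<lambda>_. j) (gradient G h) x = nabla G (\<lambda>_. j) (?N i) x - nabla G (\<lambda>_. i) (?N j) x"
    by (simp add: curvature_def lie_bracket_def nabla_def[of G "lie_bracket _ _"] x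
        linear_0[OF smooth_on_linear_fderiv[OF gradient_smooth x]])
  then have "R x i j (gradient G h x) = nabla G (\<lambda>_. j) (?N i) x - nabla G (\<lambda>_. i) (?N j) x"
    using curvature_eq[OF x smooth_on_const smooth_on_const gradient_smooth, of i j] by simp
  then show ?thesis
    unfolding d christoffel_commute[OF x, of i j] by (simp add: x)
qed

end

end


section \<open>Warped products\<close>

lemma has_derivative_compose_fst:
  "(h has_derivative h') (at (fst z)) \<Longrightarrow> ((\<lambda>z. h (fst z)) has_derivative (\<lambda>w. h' (fst w))) (at z)"
  using has_derivative_compose[OF has_derivative_fst[OF has_derivative_ident]] by blast

lemma has_derivative_compose_snd:
  "(h has_derivative h') (at (snd z)) \<Longrightarrow> ((\<lambda>z. h (snd z)) has_derivative (\<lambda>w. h' (snd w))) (at z)"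
  using has_derivative_compose[OF has_derivative_snd[OF has_derivative_ident]] by blast

lemma smooth_on_compose_fst:
  fixes h :: "'a::euclidean_space \<Rightarrow> 'c::real_normed_vector" and T :: "'b::real_normed_vector set"
  assumes "open S" "open T" "smooth_on S h" shows "smooth_on (S \<times> T) (\<lambda>z. h (fst z))"
  by (rule smooth_on_compose[OF open_Times[OF assms(1,2)] assms(1,3) smooth_on_bounded_linear[OF bounded_linear_fst]]) auto

lemma smooth_on_compose_snd:
  fixes h :: "'b::euclidean_space \<Rightarrow> 'c::real_normed_vector" and S :: "'a::real_normed_vector set"
  assumes "open S" "open T" "smooth_on T h" shows "smooth_on (S \<times> T) (\<lambda>z. h (snd z))"
  by (rule smooth_on_compose[OF open_Times[OF assms(1,2)] assms(2,3) smooth_on_bounded_linear[OF bounded_linear_snd]]) auto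

lemma sum_Basis_Times:
  fixes f :: "'a::euclidean_space \<times> 'b::euclidean_space \<Rightarrow> 'c::comm_monoid_add"
  shows "sum f Basis = (\<Sum>i\<in>Basis. f (i, 0)) + (\<Sum>i\<in>Basis. f (0, i))"
proof -
  have "inj_on (\<lambda>u. (u::'a, 0::'b)) Basis" "inj_on (\<lambda>u. (0::'a, u::'b)) Basis"
    by (auto intro!: inj_onI)
  then show ?thesis
    unfolding Basis_prod_def
    by (subst sum.union_disjoint) (auto simp: Basis_prod_def sum.reindex)
qed

locale warped_product =
  base: local_metric G1 S1 + fibre: local_metric G2 S2
  for G1 :: "'e::euclidean_space lmetric" and S1 and G2 :: "'d::euclidean_space lmetric" and S2 +
  fixes h :: "'e \<Rightarrow> real" and G :: "('e \<times> 'd) lmetric"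
  assumes h_smooth: "smooth_on S1 h" and h_pos: "x \<in> S1 \<Longrightarrow> h x > 0"
    and G_warped: "z \<in> S1 \<times> S2 \<Longrightarrow>
      G z u v = G1 (fst z) (fst u) (fst v) + (h (fst z))\<^sup>2 * G2 (snd z) (snd u) (snd v)"
begin

abbreviation "grad \<equiv> gradient G1 h"

sublocale total: local_metric G "S1 \<times> S2"
proof (rule local_metric.intro)
  show "open (S1 \<times> S2)" by (intro open_Times base.open_S fibre.open_S)
  fix z assume z: "z \<in> S1 \<times> S2"
  then have m: "fst z \<in> S1" "snd z \<in> S2" by auto
  show "G z u v = G z v u" for u v
    by (simp add: G_warped[OF z] base.G_commute[OF m(1), of "fst u"] fibre.G_commute[OF m(2), of "snd u"])
  show "linear (\<lambda>u. G z u v)" for v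
    by (rule linearI) (simp_all add: G_warped[OF z] m algebra_simps)
  fix u assume u: "\<And>v. G z u v = 0"
  have "G1 (fst z) (fst u) v = 0" for v using u[of "(v, 0)"] m by (simp add: G_warped[OF z])
  then have "fst u = 0" by (rule base.G_nondegenerate[OF m(1)])
  moreover have "G2 (snd z) (snd u) v = 0" for v
    using u[of "(0, v)"] m h_pos[OF m(1)] by (simp add: G_warped[OF z])
  then have "snd u = 0" by (rule fibre.G_nondegenerate[OF m(2)])
  ultimately show "u = 0" by (simp add: prod_eq_iff)
next
  have o: "open (S1 \<times> S2)" by (intro open_Times base.open_S fibre.open_S)
  fix u v
  have "smooth_on (S1 \<times> S2) (\<lambda>z. h (fst z))"
    by (rule smooth_on_compose_fst[OF base.open_S fibre.open_S h_smooth])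
  then have "smooth_on (S1 \<times> S2) (\<lambda>z. G1 (fst z) (fst u) (fst v) + (h (fst z))\<^sup>2 * G2 (snd z) (snd u) (snd v))"
    unfolding power2_eq_square
    by (intro smooth_on_add[OF o] smooth_on_mult[OF o] smooth_on_compose_fst[OF base.open_S fibre.open_S base.G_smooth]
        smooth_on_compose_snd[OF base.open_S fibre.open_S fibre.G_smooth])
  then show "smooth_on (S1 \<times> S2) (\<lambda>z. G z u v)"
    by (subst smooth_on_cong[OF o G_warped])
qed

section \<open>The connection of a warped product\<close>

context
  fixes z assumes z: "z \<in> S1 \<times> S2"
begin

lemma fst_in_S1: "fst z \<in> S1" and snd_in_S2: "snd z \<in> S2" using z by auto

lemma h_nonzero: "h (fst z) \<noteq> 0" using h_pos[OF fst_in_S1] by simp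

lemma fderiv_G:
  "fderiv (\<lambda>z. G z u v) z w = fderiv (\<lambda>x. G1 x (fst u) (fst v)) (fst z) (fst w)
    + 2 * h (fst z) * fderiv h (fst z) (fst w) * G2 (snd z) (snd u) (snd v)
    + (h (fst z))\<^sup>2 * fderiv (\<lambda>y. G2 y (snd u) (snd v)) (snd z) (snd w)"
proof -
  have "((\<lambda>z. G1 (fst z) (fst u) (fst v) + (h (fst z))\<^sup>2 * G2 (snd z) (snd u) (snd v)) has_derivative (\<lambda>w. fderiv (\<lambda>x. G1 x (fst u) (fst v)) (fst z) (fst w)
     + (h (fst z) * h (fst z) * fderiv (\<lambda>y. G2 y (snd u) (snd v)) (snd z) (snd w)
       + (h (fst z) * fderiv h (fst z) (fst w) + fderiv h (fst z) (fst w) * h (fst z)) * G2 (snd z) (snd u) (snd v)))) (at z)"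
    unfolding power2_eq_square
    by (rule has_derivative_add[OF has_derivative_compose_fst[OF smooth_on_has_derivative[OF base.G_smooth fst_in_S1]]
       has_derivative_mult[OF has_derivative_mult has_derivative_compose_snd[OF smooth_on_has_derivative[OF fibre.G_smooth snd_in_S2]]]];
       rule has_derivative_compose_fst[OF smooth_on_has_derivative[OF h_smooth fst_in_S1]])
  note d = fderiv_eqI[OF this]
  have "fderiv (\<lambda>z. G z u v) z = fderiv (\<lambda>z. G1 (fst z) (fst u) (fst v) + (h (fst z))\<^sup>2 * G2 (snd z) (snd u) (snd v)) z"
    by (rule fderiv_cong[OF total.open_S z]) (rule G_warped)
  then show ?thesis unfolding d by (simp add: power2_eq_square algebra_simps)
qed

text \<open>By nondegeneracy it is enough to pair both sides with \<open>w\<close> and compare with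
  the Koszul expression. The terms added to the two factor connections say that a horizontal and a
  vertical vector are coupled by the logarithmic derivative of \<open>h\<close>, and that the fibres
  bend along \<open>grad\<close>.\<close>

lemma christoffel_warped:
  "christoffel G z u v =
    (christoffel G1 (fst z) (fst u) (fst v) - (h (fst z) * G2 (snd z) (snd u) (snd v)) *\<^sub>R grad (fst z),
     christoffel G2 (snd z) (snd u) (snd v) + (fderiv h (fst z) (fst u) * (1 / h (fst z))) *\<^sub>R snd v
       + (fderiv h (fst z) (fst v) * (1 / h (fst z))) *\<^sub>R snd u)" (is "_ = ?C")
proof (rule total.G_eqI[OF z])
  fix w
  have "G z ?C w = (G1 (fst z) (christoffel G1 (fst z) (fst u) (fst v)) (fst w)
      - h (fst z) * G2 (snd z) (snd u) (snd v) * fderiv h (fst z) (fst w))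
     + ((h (fst z))\<^sup>2 * G2 (snd z) (christoffel G2 (snd z) (snd u) (snd v)) (snd w)
      + h (fst z) * fderiv h (fst z) (fst u) * G2 (snd z) (snd v) (snd w)
      + h (fst z) * fderiv h (fst z) (fst v) * G2 (snd z) (snd u) (snd w))"
    using h_nonzero by (simp add: G_warped[OF z] fst_in_S1 snd_in_S2 base.G_gradient[OF h_smooth fst_in_S1] power2_eq_square field_simps)
  then show "G z (christoffel G z u v) w = G z ?C w"
    unfolding total.G_christoffel[OF z] base.G_christoffel[OF fst_in_S1] fibre.G_christoffel[OF snd_in_S2] fderiv_G
    by (simp add: field_simps)
qed

end

lemma has_derivative_log_derivative:
  assumes x: "x \<in> S1"
  shows "((\<lambda>x. fderiv h x a * (1 / h x)) has_derivative
    (\<lambda>w. fderiv (\<lambda>x. fderiv h x a) x w * (1 / h x) - fderiv h x a * fderiv h x w * (1 / h x)\<^sup>2)) (at x)"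
proof -
  have nz: "h x \<noteq> 0" using h_pos[OF x] by simp
  have i: "((\<lambda>x. 1 / h x) has_derivative (\<lambda>w. - (1 * fderiv h x w / (h x * h x)) + 0 / h x)) (at x)"
    using has_derivative_divide[OF has_derivative_const smooth_on_has_derivative[OF h_smooth x] nz, of 1]
    by (rule has_derivative_eq_rhs) (simp add: fun_eq_iff field_simps)
  show ?thesis
    by (rule has_derivative_eq_rhs, rule has_derivative_mult[OF smooth_on_has_derivative[OF smooth_on_fderiv[OF h_smooth] x] i])
      (simp add: fun_eq_iff power2_eq_square field_simps nz)
qed

lemma fderiv_christoffel_warped:
  assumes z: "z \<in> S1 \<times> S2"
  shows "fderiv (\<lambda>z. christoffel G z u v) z w =
    (fderiv (\<lambda>x. christoffel G1 x (fst u) (fst v)) (fst z) (fst w)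
      - ((h (fst z) * G2 (snd z) (snd u) (snd v)) *\<^sub>R fderiv grad (fst z) (fst w)
       + (h (fst z) * fderiv (\<lambda>y. G2 y (snd u) (snd v)) (snd z) (snd w)
          + fderiv h (fst z) (fst w) * G2 (snd z) (snd u) (snd v)) *\<^sub>R grad (fst z)),
     fderiv (\<lambda>y. christoffel G2 y (snd u) (snd v)) (snd z) (snd w)
      + (fderiv (\<lambda>x. fderiv h x (fst u)) (fst z) (fst w) * (1 / h (fst z))
          - fderiv h (fst z) (fst u) * fderiv h (fst z) (fst w) * (1 / h (fst z))\<^sup>2) *\<^sub>R snd v
      + (fderiv (\<lambda>x. fderiv h x (fst v)) (fst z) (fst w) * (1 / h (fst z))
          - fderiv h (fst z) (fst v) * fderiv h (fst z) (fst w) * (1 / h (fst z))\<^sup>2) *\<^sub>R snd u)"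
proof -
  have z1: "fst z \<in> S1" and z2: "snd z \<in> S2" using z by auto
  have "((\<lambda>z. (christoffel G1 (fst z) (fst u) (fst v) - (h (fst z) * G2 (snd z) (snd u) (snd v)) *\<^sub>R grad (fst z),
     christoffel G2 (snd z) (snd u) (snd v) + (fderiv h (fst z) (fst u) * (1 / h (fst z))) *\<^sub>R snd v
       + (fderiv h (fst z) (fst v) * (1 / h (fst z))) *\<^sub>R snd u)) has_derivative
    (\<lambda>w. (fderiv (\<lambda>x. christoffel G1 x (fst u) (fst v)) (fst z) (fst w)
      - ((h (fst z) * G2 (snd z) (snd u) (snd v)) *\<^sub>R fderiv grad (fst z) (fst w)
       + (h (fst z) * fderiv (\<lambda>y. G2 y (snd u) (snd v)) (snd z) (snd w)
          + fderiv h (fst z) (fst w) * G2 (snd z) (snd u) (snd v)) *\<^sub>R grad (fst z)),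
     fderiv (\<lambda>y. christoffel G2 y (snd u) (snd v)) (snd z) (snd w)
      + (fderiv (\<lambda>x. fderiv h x (fst u)) (fst z) (fst w) * (1 / h (fst z))
          - fderiv h (fst z) (fst u) * fderiv h (fst z) (fst w) * (1 / h (fst z))\<^sup>2) *\<^sub>R snd v
      + (fderiv (\<lambda>x. fderiv h x (fst v)) (fst z) (fst w) * (1 / h (fst z))
          - fderiv h (fst z) (fst v) * fderiv h (fst z) (fst w) * (1 / h (fst z))\<^sup>2) *\<^sub>R snd u))) (at z)"
    by (rule has_derivative_Pair[OF
      has_derivative_diff[OF has_derivative_compose_fst[OF smooth_on_has_derivative[OF base.christoffel_smooth z1]]
        has_derivative_scaleR[OF has_derivative_mult[OF has_derivative_compose_fst[OF smooth_on_has_derivative[OF h_smooth z1]]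
          has_derivative_compose_snd[OF smooth_on_has_derivative[OF fibre.G_smooth z2]]]
          has_derivative_compose_fst[OF smooth_on_has_derivative[OF base.gradient_smooth[OF h_smooth] z1]]]]
      has_derivative_add[OF has_derivative_add[OF has_derivative_compose_snd[OF smooth_on_has_derivative[OF fibre.christoffel_smooth z2]]
          has_derivative_scaleR_left[OF has_derivative_compose_fst[OF has_derivative_log_derivative[OF z1]]]]
        has_derivative_scaleR_left[OF has_derivative_compose_fst[OF has_derivative_log_derivative[OF z1]]]]])
  note d = fderiv_eqI[OF this]
  have "fderiv (\<lambda>z. christoffel G z u v) z = fderiv (\<lambda>z. (christoffel G1 (fst z) (fst u) (fst v) - (h (fst z) * G2 (snd z) (snd u) (snd v)) *\<^sub>R grad (fst z),
     christoffel G2 (snd z) (snd u) (snd v) + (fderiv h (fst z) (fst u) * (1 / h (fst z))) *\<^sub>R snd v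
       + (fderiv h (fst z) (fst v) * (1 / h (fst z))) *\<^sub>R snd u)) z"
    by (rule fderiv_cong[OF total.open_S z]) (rule christoffel_warped)
  then show ?thesis unfolding d by simp
qed

section \<open>Curvature and Ricci tensor of a warped product\<close>

context
  fixes x y assumes x: "x \<in> S1" and y: "y \<in> S2"
begin

lemmas warped_simps = christoffel_warped[OF SigmaI[OF x y]] fderiv_christoffel_warped[OF SigmaI[OF x y]] curvature_op_def x y
  linear_0[OF base.fderiv_christoffel_linear] linear_0[OF base.fderiv_christoffel_linear_left] linear_0[OF base.fderiv_christoffel_linear_right]
  linear_0[OF fibre.fderiv_christoffel_linear] linear_0[OF fibre.fderiv_christoffel_linear_left] linear_0[OF fibre.fderiv_christoffel_linear_right]
  linear_0[OF fibre.fderiv_G_linear] linear_0[OF fibre.fderiv_G_linear_left] linear_0[OF fibre.fderiv_G_linear_right]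
  linear_0[OF smooth_on_linear_fderiv[OF h_smooth]] linear_0[OF smooth_on_linear_fderiv[OF smooth_on_fderiv[OF h_smooth]]]
  linear_diff[OF smooth_on_linear_fderiv[OF h_smooth]] linear_neg[OF smooth_on_linear_fderiv[OF h_smooth]]
  linear_cmul[OF smooth_on_linear_fderiv[OF h_smooth]]
  linear_0[OF smooth_on_linear_fderiv[OF base.gradient_smooth[OF h_smooth]]]

text \<open>Vertical arguments have base component 0, which puts this term into the derivative of
  the Christoffel symbols. The inner derivative is known to vanish on \<open>S1\<close> only, hence
  the local congruence.\<close>

lemma fderiv_h_0: "fderiv (\<lambda>x. fderiv h x 0) x w = 0"
proof -
  have "fderiv (\<lambda>x. fderiv h x 0) x = fderiv (\<lambda>x. 0::real) x"
    by (rule fderiv_cong[OF base.open_S x]) (rule linear_0[OF smooth_on_linear_fderiv[OF h_smooth]])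
  then show ?thesis by simp
qed

text \<open>The letters \<open>h\<close> (tangent to the base) and \<open>v\<close> (tangent to the fibre) in the following names give
  the types of the arguments.\<close>

lemma curvature_hhh: "curvature_op G (x, y) (u, 0) (b, 0) (v, 0) = (curvature_op G1 x u b v, 0)"
  by (simp add: warped_simps fderiv_h_0)

lemma curvature_hvh: "curvature_op G (x, y) (u, 0) (0, a) (v, 0) = (0, - (hess G1 h x u v / h x) *\<^sub>R a)"
  using h_pos[OF x]
  by (simp add: warped_simps fderiv_h_0 base.hess_eq[OF h_smooth x] power2_eq_square
     scaleR_add_left[symmetric] scaleR_diff_left[symmetric] field_simps
     del: scaleR_minus_left)

text \<open>The Ricci sum pairs the curvature with its second argument. Hence only the horizontal
  component matters when that argument is horizontal, and only the vertical one when it is vertical;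
  this explains the projections from here on.\<close>

lemma curvature_hhv: "fst (curvature_op G (x, y) (u, 0) (b, 0) (0, c)) = 0"
  by (simp add: warped_simps fderiv_h_0)

lemma curvature_hvv: "snd (curvature_op G (x, y) (u, 0) (0, a) (0, c)) = 0"
  by (simp add: warped_simps fderiv_h_0)

lemma curvature_vhh: "fst (curvature_op G (x, y) (0, a) (b, 0) (v, 0)) = 0"
  by (simp add: warped_simps fderiv_h_0)

lemma curvature_vvh: "snd (curvature_op G (x, y) (0, a) (0, b) (v, 0)) = 0"
  by (simp add: warped_simps fderiv_h_0 fibre.christoffel_commute[OF y, of a b])

lemma curvature_vhv: "fst (curvature_op G (x, y) (0, a) (b, 0) (0, c))
    = - (h x * G2 y a c) *\<^sub>R nabla G1 (\<lambda>_. b) grad x"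
  using h_pos[OF x]
  by (simp add: warped_simps fderiv_h_0 base.nabla_const algebra_simps)

lemma curvature_vvv: "snd (curvature_op G (x, y) (0, a) (0, b) (0, c))
    = curvature_op G2 y a b c + fderiv h x (grad x) *\<^sub>R (G2 y b c *\<^sub>R a - G2 y a c *\<^sub>R b)"
  using h_pos[OF x]
  by (simp add: warped_simps fderiv_h_0 algebra_simps)

end

text \<open>The sum is the trace of the covariant derivative of the gradient, that is, the Laplacian
  of \<open>h\<close>, and the last factor is the squared length of the gradient. This is the
  function written \<open>\<psi>\<close> in the overview.\<close>

definition ricci_shift :: "'e \<Rightarrow> real" where
  "ricci_shift x = h x * (\<Sum>b\<in>Basis. nabla G1 (\<lambda>_. b) grad x \<bullet> b) + (real DIM('d) - 1) * fderiv h x (grad x)"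

definition ricci_base :: "'e \<Rightarrow> 'e \<Rightarrow> 'e \<Rightarrow> real" where
  "ricci_base x u v = ricci G1 x u v - real DIM('d) * (hess G1 h x u v * (1 / h x))"

lemma ricci_shift_smooth: "smooth_on S1 ricci_shift"
proof -
  note o = base.open_S and grad = base.gradient_smooth[OF h_smooth]
  have "smooth_on S1 (\<lambda>x. h x * (\<Sum>b\<in>Basis. nabla G1 (\<lambda>_. b) grad x \<bullet> b) + (real DIM('d) - 1) * fderiv h x (grad x))"
    by (intro smooth_on_add[OF o] smooth_on_mult[OF o] h_smooth smooth_on_sum[OF o] smooth_on_inner_right[OF o]
        base.nabla_const_smooth[OF grad] smooth_on_const
        smooth_on_linear_arg[OF o smooth_on_linear_fderiv[OF h_smooth] smooth_on_fderiv[OF h_smooth] grad])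
  then show ?thesis by (simp add: ricci_shift_def[abs_def])
qed

context
  fixes z assumes z: "z \<in> S1 \<times> S2"
begin

lemma ricci_hh: "ricci G z (u, 0) (v, 0) = ricci_base (fst z) u v"
proof -
  have "ricci G z (u, 0) (v, 0) = (\<Sum>b\<in>Basis. curvature_op G1 (fst z) u b v \<bullet> b)
      + (\<Sum>a\<in>Basis. (- (hess G1 h (fst z) u v / h (fst z)) *\<^sub>R a) \<bullet> (a :: 'd))"
    unfolding total.ricci_eq[OF z] sum_Basis_Times
    using curvature_hhh[OF fst_in_S1[OF z] snd_in_S2[OF z], of u _ v] curvature_hvh[OF fst_in_S1[OF z] snd_in_S2[OF z], of u _ v] by simp
  then show ?thesis by (simp add: ricci_base_def base.ricci_eq[OF fst_in_S1[OF z]] mult.commute)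
qed

lemma ricci_hv: "ricci G z (u, 0) (0, c) = 0"
  unfolding total.ricci_eq[OF z] sum_Basis_Times
  using curvature_hhv[OF fst_in_S1[OF z] snd_in_S2[OF z], of u _ c] curvature_hvv[OF fst_in_S1[OF z] snd_in_S2[OF z], of u _ c]
  by (simp add: inner_prod_def)

lemma ricci_vh: "ricci G z (0, a) (v, 0) = 0"
  unfolding total.ricci_eq[OF z] sum_Basis_Times
  using curvature_vhh[OF fst_in_S1[OF z] snd_in_S2[OF z], of a _ v] curvature_vvh[OF fst_in_S1[OF z] snd_in_S2[OF z], of a _ v]
  by (simp add: inner_prod_def)

lemma ricci_vv: "ricci G z (0, a) (0, c) = ricci G2 (snd z) a c - ricci_shift (fst z) * G2 (snd z) a c"
proof -
  let ?N = "\<Sum>b\<in>Basis. nabla G1 (\<lambda>_. b) grad (fst z) \<bullet> b"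
  have "ricci G z (0, a) (0, c) = (\<Sum>b\<in>Basis. (- (h (fst z) * G2 (snd z) a c) *\<^sub>R nabla G1 (\<lambda>_. b) grad (fst z)) \<bullet> b)
    + (\<Sum>b\<in>Basis. (curvature_op G2 (snd z) a b c + fderiv h (fst z) (grad (fst z)) *\<^sub>R (G2 (snd z) b c *\<^sub>R a - G2 (snd z) a c *\<^sub>R b)) \<bullet> b)"
    unfolding total.ricci_eq[OF z] sum_Basis_Times
    using curvature_vhv[OF fst_in_S1[OF z] snd_in_S2[OF z], of a _ c] curvature_vvv[OF fst_in_S1[OF z] snd_in_S2[OF z], of a _ c]
    by (simp add: inner_prod_def)
  also have "\<dots> = - (h (fst z) * G2 (snd z) a c) * ?N + (ricci G2 (snd z) a c
      + fderiv h (fst z) (grad (fst z)) * ((\<Sum>b\<in>Basis. (a \<bullet> b) *\<^sub>R G2 (snd z) b c) - G2 (snd z) a c * real DIM('d)))"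
    by (simp add: fibre.ricci_eq[OF snd_in_S2[OF z]] inner_add_left inner_diff_left sum.distrib sum_subtractf sum_distrib_left
        sum_negf right_diff_distrib mult.commute mult.left_commute)
  \<comment> \<open>This one copy of the fibre metric is set against the \<open>DIM('d)\<close>
    copies of opposite sign; the difference is the factor \<open>DIM('d) - 1\<close> in
    \<open>ricci_shift\<close>.\<close>
  also have "(\<Sum>b\<in>Basis. (a \<bullet> b) *\<^sub>R G2 (snd z) b c) = G2 (snd z) a c"
    by (rule linear_Basis_expansion[OF fibre.G_linear[OF snd_in_S2[OF z]], symmetric])
  finally show ?thesis by (simp add: ricci_shift_def algebra_simps)
qed

text \<open>Christoffel vectors of the product have a horizontal and a vertical part. Because the
  mixed part of the Ricci tensor vanishes, pairing one with a pure vector sees only the matching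
  part.\<close>

lemma ricci_v_any: "ricci G z (0, a) (u, c) = ricci G2 (snd z) a c - ricci_shift (fst z) * G2 (snd z) a c"
  using linear_add[OF total.ricci_linear(2)[OF z], of "(0, a)" "(u, 0)" "(0, c)"] by (simp add: ricci_vh ricci_vv)

lemma ricci_any_v: "ricci G z (u, a) (0, c) = ricci G2 (snd z) a c - ricci_shift (fst z) * G2 (snd z) a c"
  using linear_add[OF total.ricci_linear(1)[OF z], of "(u, 0)" "(0, a)" "(0, c)"] by (simp add: ricci_hv ricci_vv)

lemma ricci_h_any: "ricci G z (u, 0) (v, c) = ricci_base (fst z) u v"
  using linear_add[OF total.ricci_linear(2)[OF z], of "(u, 0)" "(v, 0)" "(0, c)"] by (simp add: ricci_hv ricci_hh)

end

section \<open>Components of the Codazzi equation\<close>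

lemma nabla2_ricci_hhh:
  assumes z: "z \<in> S1 \<times> S2"
  shows "nabla2 G (ricci G) z (m, 0) (i, 0) (k, 0) = nabla2 G1 (ricci G1) (fst z) m i k
    - real DIM('d) * (nabla2 G1 (hess G1 h) (fst z) m i k * (1 / h (fst z))
       - hess G1 h (fst z) i k * fderiv h (fst z) m * (1 / h (fst z))\<^sup>2)"
proof -
  note z1 = fst_in_S1[OF z] and z2 = snd_in_S2[OF z]
  have nz: "h (fst z) \<noteq> 0" using h_pos[OF z1] by simp
  have i: "((\<lambda>x. 1 / h x) has_derivative (\<lambda>w. - fderiv h (fst z) w * (1 / h (fst z))\<^sup>2)) (at (fst z))"
    by (rule has_derivative_eq_rhs[OF has_derivative_divide[OF has_derivative_const smooth_on_has_derivative[OF h_smooth z1] nz]])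
      (simp add: fun_eq_iff field_simps power2_eq_square)
  have "fderiv (\<lambda>z. ricci G z (i, 0) (k, 0)) z = fderiv (\<lambda>z. ricci_base (fst z) i k) z"
    by (rule fderiv_cong[OF total.open_S z]) (rule ricci_hh)
  also have "\<dots> = (\<lambda>w. fderiv (\<lambda>x. ricci G1 x i k) (fst z) (fst w)
      - real DIM('d) * (hess G1 h (fst z) i k * (- fderiv h (fst z) (fst w) * (1 / h (fst z))\<^sup>2)
          + fderiv (\<lambda>x. hess G1 h x i k) (fst z) (fst w) * (1 / h (fst z))))"
    unfolding ricci_base_def
    by (rule fderiv_eqI[OF has_derivative_diff[OF has_derivative_compose_fst[OF smooth_on_has_derivative[OF base.ricci_smooth z1]]
       has_derivative_mult_right[OF has_derivative_mult[OF has_derivative_compose_fst[OF smooth_on_has_derivative[OF base.hess_smooth[OF h_smooth] z1]]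
         has_derivative_compose_fst[OF i]]]]])
  \<comment> \<open>The Christoffel vector of two horizontal vectors is that of the base, so this is
    the covariant derivative of \<open>ricci_base\<close> on the base, with the product rule applied
    to the Hessian times \<open>1 / h\<close>.\<close>
  finally show ?thesis
    by (simp add: nabla2_def christoffel_warped[OF z] ricci_hh[OF z] ricci_base_def z2 algebra_simps)
qed

text \<open>The derivative of \<open>1 / h\<close> supplies exactly the Hessian products, so the
  large bracket is the difference of the two sides of the curvature condition on the base.\<close>

lemma ricci_codazzi_hhh:
  assumes z: "z \<in> S1 \<times> S2"
  shows "ricci_codazzi G z (i, 0) (j, 0) (k, 0) = ricci_codazzi G1 (fst z) i j k
    - real DIM('d) * (1 / h (fst z)) * (G1 (fst z) (curvature_op G1 (fst z) i j (grad (fst z))) k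
       - (fderiv h (fst z) j * (1 / h (fst z) * hess G1 h (fst z) i k)
          - fderiv h (fst z) i * (1 / h (fst z) * hess G1 h (fst z) j k)))"
  unfolding ricci_codazzi_def nabla2_ricci_hhh[OF z] base.nabla2_hess_commutator[OF h_smooth fst_in_S1[OF z], symmetric]
  by (simp add: algebra_simps power2_eq_square)

lemma fderiv_ricci_vv:
  assumes z: "z \<in> S1 \<times> S2"
  shows "fderiv (\<lambda>z. ricci G z (0, a) (0, c)) z w = fderiv (\<lambda>y. ricci G2 y a c) (snd z) (snd w)
    - (ricci_shift (fst z) * fderiv (\<lambda>y. G2 y a c) (snd z) (snd w) + fderiv ricci_shift (fst z) (fst w) * G2 (snd z) a c)"
proof -
  note z1 = fst_in_S1[OF z] and z2 = snd_in_S2[OF z]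
  have "fderiv (\<lambda>z. ricci G z (0, a) (0, c)) z = fderiv (\<lambda>z. ricci G2 (snd z) a c - ricci_shift (fst z) * G2 (snd z) a c) z"
    by (rule fderiv_cong[OF total.open_S z]) (rule ricci_vv)
  also have "\<dots> = (\<lambda>w. fderiv (\<lambda>y. ricci G2 y a c) (snd z) (snd w)
    - (ricci_shift (fst z) * fderiv (\<lambda>y. G2 y a c) (snd z) (snd w) + fderiv ricci_shift (fst z) (fst w) * G2 (snd z) a c))"
    by (rule fderiv_eqI[OF has_derivative_diff[OF has_derivative_compose_snd[OF smooth_on_has_derivative[OF fibre.ricci_smooth z2]]
       has_derivative_mult[OF has_derivative_compose_fst[OF smooth_on_has_derivative[OF ricci_shift_smooth z1]]
         has_derivative_compose_snd[OF smooth_on_has_derivative[OF fibre.G_smooth z2]]]]])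
  finally show ?thesis by simp
qed

text \<open>The horizontal part of a vertical Christoffel vector is invisible to a vertical partner,
  and the multiple of the fibre metric in \<open>ricci_vv\<close> is parallel along the fibre, since
  its factor depends on the base point alone.\<close>

lemma nabla2_ricci_vvv:
  assumes z: "z \<in> S1 \<times> S2"
  shows "nabla2 G (ricci G) z (0, m) (0, i) (0, k) = nabla2 G2 (ricci G2) (snd z) m i k"
  using linear_0[OF smooth_on_linear_fderiv[OF ricci_shift_smooth fst_in_S1[OF z]]]
    linear_0[OF smooth_on_linear_fderiv[OF h_smooth fst_in_S1[OF z]]]
  by (simp add: nabla2_def fderiv_ricci_vv[OF z] christoffel_warped[OF z] fst_in_S1[OF z] ricci_any_v[OF z] ricci_v_any[OF z]
      fibre.fderiv_G_christoffel[OF snd_in_S2[OF z]] algebra_simps)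

lemma ricci_codazzi_vvv:
  assumes z: "z \<in> S1 \<times> S2"
  shows "ricci_codazzi G z (0, i) (0, j) (0, k) = ricci_codazzi G2 (snd z) i j k"
  unfolding ricci_codazzi_def nabla2_ricci_vvv[OF z] ..

text \<open>The vertical Ricci part, multiplied by the logarithmic derivative of \<open>h\<close>,
  is subtracted twice in the derivative along \<open>u\<close> and once in the derivative along
  \<open>a\<close>, so one copy survives. It carries the only occurrence of the fibre Ricci tensor;
  everything else is proportional to the fibre metric.\<close>

lemma ricci_codazzi_vhv:
  assumes z: "z \<in> S1 \<times> S2"
  shows "ricci_codazzi G z (0, a) (u, 0) (0, c) = 
    - (fderiv h (fst z) u * (1 / h (fst z)) * ricci G2 (snd z) a c)
    + (fderiv h (fst z) u * (1 / h (fst z)) * ricci_shift (fst z) - fderiv ricci_shift (fst z) u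
        - h (fst z) * ricci_base (fst z) u (grad (fst z))) * G2 (snd z) a c"
proof -
  note z1 = fst_in_S1[OF z] and z2 = snd_in_S2[OF z]
  note zero = linear_0[OF smooth_on_linear_fderiv[OF h_smooth z1]] linear_0[OF fibre.fderiv_G_linear[OF z2]]
    linear_0[OF smooth_on_linear_fderiv[OF fibre.ricci_smooth z2]]
  let ?r = "ricci G2 (snd z) a c - ricci_shift (fst z) * G2 (snd z) a c"
  have 1: "nabla2 G (ricci G) z (u, 0) (0, a) (0, c) = - fderiv ricci_shift (fst z) u * G2 (snd z) a c
     - 2 * (fderiv h (fst z) u * (1 / h (fst z)) * ?r)"
    using linear_cmul[OF total.ricci_linear(1)[OF z], of "fderiv h (fst z) u * (1 / h (fst z))" "(0, a)" "(0, c)"]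
      linear_cmul[OF total.ricci_linear(2)[OF z], of "(0, a)" "fderiv h (fst z) u * (1 / h (fst z))" "(0, c)"]
    by (simp add: nabla2_def fderiv_ricci_vv[OF z] christoffel_warped[OF z] z1 z2 zero ricci_vv[OF z])
  \<comment> \<open>The mixed component is identically 0, so its plain derivative vanishes. The
    covariant derivative does not, because the connection turns vertical directions into horizontal
    ones and conversely.\<close>
  have "fderiv (\<lambda>z. ricci G z (u, 0) (0, c)) z = fderiv (\<lambda>z. 0::real) z"
    by (rule fderiv_cong[OF total.open_S z]) (rule ricci_hv)
  then have "nabla2 G (ricci G) z (0, a) (u, 0) (0, c) = - (fderiv h (fst z) u * (1 / h (fst z)) * ?r)
     + h (fst z) * G2 (snd z) a c * ricci_base (fst z) u (grad (fst z))"
    using linear_cmul[OF total.ricci_linear(1)[OF z], of "fderiv h (fst z) u * (1 / h (fst z))" "(0, a)" "(0, c)"]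
      linear_cmul[OF total.ricci_linear(2)[OF z], of "(u, 0)" "- (h (fst z) * G2 (snd z) a c)" "(grad (fst z), 0)"]
    by (simp add: nabla2_def christoffel_warped[OF z] z1 z2 zero ricci_h_any[OF z] ricci_vv[OF z] ricci_hh[OF z])
  then show ?thesis
    unfolding ricci_codazzi_def 1 by (simp add: algebra_simps)
qed

end


section \<open>Bump functions and charts\<close>

text \<open>The functions \<open>t\<^sup>-\<^sup>n exp (-1/t)\<close> are a family closed under differentiation, which makes their
  smoothness a simultaneous induction.\<close>

definition flat :: "nat \<Rightarrow> real \<Rightarrow> real" where
  "flat n t = (if t > 0 then inverse t ^ n / exp (inverse t) else 0)"

lemma flat_tendsto_0: "(flat n \<longlongrightarrow> 0) (at 0)"
proof (rule filterlim_split_at)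
  show "(flat n \<longlongrightarrow> 0) (at_left 0)"
    by (rule tendsto_eventually) (auto simp: flat_def eventually_at_filter)
  have "((\<lambda>t. inverse t ^ n / exp (inverse t)) \<longlongrightarrow> 0) (at_right (0::real))"
    by (rule filterlim_compose[OF tendsto_power_div_exp_0 filterlim_inverse_at_top_right])
  then show "(flat n \<longlongrightarrow> 0) (at_right 0)"
    by (rule Lim_transform_eventually) (auto simp: flat_def eventually_at_filter)
qed

lemma flat_DERIV: "(flat n has_real_derivative (flat (n + 2) t - real n * flat (n + 1) t)) (at t)"
proof (cases t "0::real" rule: linorder_cases)
  case less
  have "((\<lambda>_. 0) has_real_derivative 0) (at t)" by simp
  then have "(flat n has_real_derivative 0) (at t)"
    by (rule has_field_derivative_transform_within_open[where S = "{..<0}"]) (use less in \<open>auto simp: flat_def\<close>)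
  then show ?thesis using less by (simp add: flat_def)
next
  case equal
  \<comment> \<open>The difference quotient of \<open>flat n\<close> at 0 is
    \<open>flat (n + 1)\<close>.\<close>
  have "(\<lambda>k. flat (n + 1) k) \<midarrow>0\<rightarrow> 0" by (rule flat_tendsto_0)
  then have "(\<lambda>k. (flat n (0 + k) - flat n 0) / k) \<midarrow>0\<rightarrow> 0"
    by (rule Lim_transform_eventually) (auto simp: flat_def eventually_at_filter field_simps)
  then have "(flat n has_real_derivative 0) (at 0)" unfolding DERIV_def .
  then show ?thesis using equal by (simp add: flat_def)
next
  case greater
  have "((\<lambda>t. inverse t ^ n / exp (inverse t)) has_real_derivative (flat (n + 2) t - real n * flat (n + 1) t)) (at t)"
    using greater
    by (auto intro!: derivative_eq_intros simp: flat_def field_simps power2_eq_square)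
      (cases n; simp add: field_simps)
  then show ?thesis
    by (rule has_field_derivative_transform_within_open[where S = "{0<..}"]) (use greater in \<open>auto simp: flat_def\<close>)
qed

lemma flat_smooth: "smooth_on UNIV (flat n)"
proof -
  have "Ck_on k UNIV (flat n)" for k
  proof (induction k arbitrary: n)
    case 0
    show ?case using flat_DERIV by (auto intro!: continuous_at_imp_continuous_on DERIV_isCont)
  next
    case (Suc k)
    show ?case
    proof (rule Ck_on_SucI[OF open_UNIV])
      show "(flat n has_derivative (\<lambda>v. (flat (n + 2) t + (- real n) *\<^sub>R flat (n + 1) t) *\<^sub>R v)) (at t)" for t
        using flat_DERIV[of n t] unfolding has_field_derivative_def
        by (rule has_derivative_eq_rhs) (simp add: fun_eq_iff)
      show "Ck_on k UNIV (\<lambda>t. (flat (n + 2) t + (- real n) *\<^sub>R flat (n + 1) t) *\<^sub>R v)" for v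
        by (intro Ck_on_scaleR Ck_on_add Ck_on_const Suc open_UNIV)
    qed
  qed
  then show ?thesis unfolding smooth_on_def by blast
qed

text \<open>The squared distance is polynomial and thus smooth at the centre too. The constant
  factor normalises the value at \<open>a\<close> to 1; no plateau is required, as the extension of
  a vector prescribes one value only.\<close>

definition bump :: "'e::euclidean_space \<Rightarrow> real \<Rightarrow> 'e \<Rightarrow> real" where
  "bump a r x = flat 0 (r\<^sup>2 - (x - a) \<bullet> (x - a)) * (1 / flat 0 (r\<^sup>2))"

lemma bump_smooth: "smooth_on UNIV (bump a r)"
proof -
  have "smooth_on UNIV (\<lambda>x. r\<^sup>2 - (\<Sum>b\<in>Basis. ((x - a) \<bullet> b) * ((x - a) \<bullet> b)))"
    by (intro smooth_on_diff[where f = "\<lambda>_. r\<^sup>2"] smooth_on_sum smooth_on_mult smooth_on_inner_right smooth_on_diff smooth_on_ident smooth_on_const open_UNIV)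
  then have "smooth_on UNIV (\<lambda>x. r\<^sup>2 - (x - a) \<bullet> (x - a))"
    by (simp only: euclidean_inner[symmetric])
  then have "smooth_on UNIV (\<lambda>x. flat 0 (r\<^sup>2 - (x - a) \<bullet> (x - a)))"
    by (rule smooth_on_compose[OF open_UNIV open_UNIV flat_smooth]) simp
  then show ?thesis
    unfolding bump_def[abs_def] by (intro smooth_on_mult smooth_on_const open_UNIV)
qed

lemma bump_center: "r > 0 \<Longrightarrow> bump a r a = 1"
  by (simp add: bump_def flat_def)

lemma bump_outside: "x \<notin> cball a r \<Longrightarrow> r > 0 \<Longrightarrow> bump a r x = 0"
proof -
  assume "x \<notin> cball a r" "r > 0"
  then have "r\<^sup>2 < (norm (x - a))\<^sup>2" by (intro power_strict_mono) (auto simp: dist_norm norm_minus_commute)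
  then show ?thesis by (simp add: bump_def flat_def power2_norm_eq_inner)
qed

section \<open>Charts, tangent vectors and their extension to vector fields\<close>

lemma smooth_manifold_chart:
  assumes A: "smooth_manifold A" and c: "c \<in> A"
  shows chart_open: "open (fst c)" "open (chart_image c)"
    and chart_inv_snd: "p \<in> fst c \<Longrightarrow> chart_inv c (snd c p) = p"
    and snd_chart_inv: "x \<in> chart_image c \<Longrightarrow> snd c (chart_inv c x) = x"
    and chart_inv_in: "x \<in> chart_image c \<Longrightarrow> chart_inv c x \<in> fst c"
    and chart_inv_continuous: "continuous_on (chart_image c) (chart_inv c)"
    and chart_continuous: "continuous_on (fst c) (snd c)"
  using A c unfolding smooth_manifold_def homeomorphism_def by auto

lemma snd_in_chart_image: "p \<in> fst c \<Longrightarrow> snd c p \<in> chart_image c"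
  by (simp add: chart_image_def)

lemma transition_smooth:
  assumes "smooth_manifold A" "c \<in> A" "d \<in> A"
  shows "smooth_on (snd c ` (fst c \<inter> fst d)) (\<lambda>x. snd d (chart_inv c x))"
  using assms unfolding smooth_manifold_def by (simp add: comp_def)

lemma overlap_image:
  assumes A: "smooth_manifold A" "c \<in> A"
  shows "snd c ` (fst c \<inter> U) = {x \<in> chart_image c. chart_inv c x \<in> U}"
  using smooth_manifold_chart[OF A] unfolding chart_image_def by force

lemma overlap_open:
  assumes A: "smooth_manifold A" "c \<in> A" and U: "open U"
  shows "open (snd c ` (fst c \<inter> U))"
proof -
  have "{x \<in> chart_image c. chart_inv c x \<in> U} = chart_image c \<inter> chart_inv c -` U" by auto
  then show ?thesis
    unfolding overlap_image[OF A]
    using continuous_open_preimage[OF chart_inv_continuous[OF A] chart_open(2)[OF A] U] by simp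
qed

lemma coord_vec_combination:
  "coord_vec c p (a *\<^sub>R u + b *\<^sub>R v) = (\<lambda>h. a * coord_vec c p u h + b * coord_vec c p v h)"
  by (auto simp: coord_vec_def fun_eq_iff linear_add[OF linear_frechet_derivative] linear_cmul[OF linear_frechet_derivative])

lemma coord_vec_0: "coord_vec c p 0 = (\<lambda>h. 0)"
  using coord_vec_combination[of c p 0 0 0 0] by simp

text \<open>With coordinate functions as test functions a tangent operator returns its components.
  This gives injectivity of \<open>coord_vec\<close> in the vector and lets
  \<open>coord_field\<close> read off representatives.\<close>

lemma coord_vec_coordinate:
  assumes A: "smooth_manifold A" "c \<in> A" and p: "p \<in> fst c"
  shows "coord_vec c p v (\<lambda>q. snd c q \<bullet> b) = v \<bullet> b"
proof -
  note s = snd_in_chart_image[OF p]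
  have e: "((\<lambda>q. snd c q \<bullet> b) \<circ> chart_inv c) y = y \<bullet> b" if "y \<in> chart_image c" for y
    using snd_chart_inv[OF A that] by simp
  have d: "((\<lambda>y. y \<bullet> b) has_derivative (\<lambda>v. v \<bullet> b)) (at (snd c p))"
    by (intro has_derivative_inner_left has_derivative_ident)
  have d': "(((\<lambda>q. snd c q \<bullet> b) \<circ> chart_inv c) has_derivative (\<lambda>v. v \<bullet> b)) (at (snd c p))"
    by (rule has_derivative_transform_within_open[OF d chart_open(2)[OF A] s]) (rule e[symmetric])
  then have "((\<lambda>q. snd c q \<bullet> b) \<circ> chart_inv c) differentiable (at (snd c p))"
    unfolding differentiable_def by blast
  then show ?thesis
    using fderiv_eqI[OF d'] by (simp add: coord_vec_def)
qed

lemma coord_vec_eq_0: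
  assumes A: "smooth_manifold A" "c \<in> A" and p: "p \<in> fst c" and 0: "coord_vec c p v = (\<lambda>h. 0)"
  shows "v = 0"
proof (rule euclidean_eqI)
  fix b
  show "v \<bullet> b = 0 \<bullet> b" using coord_vec_coordinate[OF A p, of v b] 0 by simp
qed

lemma coord_vec_change_aux:
  assumes A: "smooth_manifold A" "c \<in> A" "d \<in> A" and p: "p \<in> fst c" "p \<in> fst d"
    and h: "(h \<circ> chart_inv c) differentiable (at (snd c p))"
  shows "((h \<circ> chart_inv d) has_derivative
    (\<lambda>v. fderiv (h \<circ> chart_inv c) (snd c p) (fderiv (\<lambda>x. snd c (chart_inv d x)) (snd d p) v))) (at (snd d p))"
proof -
  let ?U = "snd d ` (fst d \<inter> fst c)"
  have U: "open ?U" "snd d p \<in> ?U" using overlap_open[OF A(1,3) chart_open(1)[OF A(1,2)]] p by auto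
  have e: "(h \<circ> chart_inv d) y = (h \<circ> chart_inv c) (snd c (chart_inv d y))" if "y \<in> ?U" for y
    using that overlap_image[OF A(1,3), of "fst c"] chart_inv_snd[OF A(1,2)] by auto
  have p': "snd c (chart_inv d (snd d p)) = snd c p" using chart_inv_snd[OF A(1,3) p(2)] by simp
  have "((\<lambda>y. (h \<circ> chart_inv c) (snd c (chart_inv d y))) has_derivative
      (\<lambda>v. fderiv (h \<circ> chart_inv c) (snd c p) (fderiv (\<lambda>x. snd c (chart_inv d x)) (snd d p) v))) (at (snd d p))"
    by (rule has_derivative_compose[OF smooth_on_has_derivative[OF transition_smooth[OF A(1,3,2)] U(2)]])
      (simp only: p' has_derivative_fderiv[OF h])
  then show ?thesis
    by (rule has_derivative_transform_within_open[OF _ U]) (rule e[symmetric])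
qed

lemma coord_vec_change:
  assumes A: "smooth_manifold A" "c \<in> A" "d \<in> A" and p: "p \<in> fst c" "p \<in> fst d"
  shows "coord_vec d p v = coord_vec c p (fderiv (\<lambda>x. snd c (chart_inv d x)) (snd d p) v)"
proof
  fix h :: "_ \<Rightarrow> real"
  note 1 = coord_vec_change_aux[OF A p, of h] and 2 = coord_vec_change_aux[OF A(1,3,2) p(2,1), of h]
  \<comment> \<open>The equivalence matters for the default branch: both operators must return 0 on
    the same functions.\<close>
  have "(h \<circ> chart_inv c) differentiable (at (snd c p)) \<longleftrightarrow> (h \<circ> chart_inv d) differentiable (at (snd d p))"
    using 1 2 unfolding differentiable_def by blast
  then show "coord_vec d p v h = coord_vec c p (fderiv (\<lambda>x. snd c (chart_inv d x)) (snd d p) v) h"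
    using fderiv_eqI[OF 1] by (simp add: coord_vec_def)
qed

lemma tangent_space_eq:
  assumes A: "smooth_manifold A" "c \<in> A" and p: "p \<in> fst c"
  shows "tangent_space A p = range (coord_vec c p)"
  unfolding tangent_space_def using coord_vec_change[OF A _ p] A(2) p by blast

lemma local_metric_coord_metric:
  assumes M: "pseudo_riemannian_manifold A g" and c: "c \<in> A"
  shows "local_metric (coord_metric c g) (chart_image c)"
proof -
  have A: "smooth_manifold A" and g: "pseudo_riemannian_metric A g"
    using M unfolding pseudo_riemannian_manifold_def by auto
  have lin: "g p (coord_vec c p (a *\<^sub>R u + b *\<^sub>R v)) (coord_vec c p w) =
      a * g p (coord_vec c p u) (coord_vec c p w) + b * g p (coord_vec c p v) (coord_vec c p w)"
    and sym: "g p (coord_vec c p u) (coord_vec c p v) = g p (coord_vec c p v) (coord_vec c p u)"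
    and nd: "(\<And>v. g p (coord_vec c p u) (coord_vec c p v) = 0) \<Longrightarrow> coord_vec c p u = (\<lambda>h. 0)"
    if p: "p \<in> fst c" for p u v w a b
  proof -
    have "p \<in> points A" using p c by (auto simp: points_def)
    note gp = g[unfolded pseudo_riemannian_metric_def, THEN conjunct1, rule_format, OF this,
        unfolded tangent_space_eq[OF A c p]]
    show "g p (coord_vec c p u) (coord_vec c p v) = g p (coord_vec c p v) (coord_vec c p u)"
      using gp by blast
    show "g p (coord_vec c p (a *\<^sub>R u + b *\<^sub>R v)) (coord_vec c p w) =
      a * g p (coord_vec c p u) (coord_vec c p w) + b * g p (coord_vec c p v) (coord_vec c p w)"
      unfolding coord_vec_combination using gp by blast
    show "coord_vec c p u = (\<lambda>h. 0)" if "\<And>v. g p (coord_vec c p u) (coord_vec c p v) = 0"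
      using gp that by blast
  qed
  show ?thesis
  proof (rule local_metric.intro)
    show "open (chart_image c)" by (rule chart_open(2)[OF A c])
    show "smooth_on (chart_image c) (\<lambda>x. coord_metric c g x u v)" for u v
      using g c unfolding pseudo_riemannian_metric_def by blast
    fix x assume x: "x \<in> chart_image c"
    note p = chart_inv_in[OF A c x]
    show "coord_metric c g x u v = coord_metric c g x v u" for u v
      unfolding coord_metric_def by (rule sym[OF p])
    show "linear (\<lambda>u. coord_metric c g x u v)" for v
      unfolding coord_metric_def using lin[OF p, of 1 _ 1] lin[OF p, of _ _ 0 0] by (intro linearI) simp_all
    show "u = 0" if "\<And>v. coord_metric c g x u v = 0" for u
      using coord_vec_eq_0[OF A c p nd[OF p]] that unfolding coord_metric_def by blast
  qed
qed

lemma coord_field_at: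
  assumes A: "smooth_manifold A" "c \<in> A" and p: "p \<in> fst c" and X: "X p = coord_vec c p v"
  shows "coord_field c X (snd c p) = v"
  unfolding coord_field_def chart_inv_snd[OF A p] X coord_vec_coordinate[OF A p]
  by (rule euclidean_representation)

text \<open>The constant field \<open>v\<close> of the chart \<open>c\<close> is cut off by a bump
  function supported in the chart and continued by the zero operator.\<close>

lemma vector_field_extension:
  assumes A: "smooth_manifold A" "c \<in> A" and p: "p \<in> fst c"
  obtains X where "vector_field A X" "X p = coord_vec c p v"
proof -
  let ?a = "snd c p"
  obtain r where r: "r > 0" "cball ?a r \<subseteq> chart_image c"
    using chart_open(2)[OF A] snd_in_chart_image[OF p] open_contains_cball by blast
  define X where "X q = (if q \<in> fst c then coord_vec c q (bump ?a r (snd c q) *\<^sub>R v) else (\<lambda>h. 0))" for q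
  \<comment> \<open>\<open>X\<close> vanishes off this compact set, which is closed since the space
    is Hausdorff. Every chart domain is covered by its overlap with \<open>fst c\<close> and its
    part outside \<open>?K\<close>; smoothness is checked on these two open pieces.\<close>
  let ?K = "chart_inv c ` cball ?a r"
  have "compact ?K"
    by (rule compact_continuous_image[OF continuous_on_subset[OF chart_inv_continuous[OF A] r(2)] compact_cball])
  then have K: "open (- ?K)" using compact_imp_closed open_Compl by blast
  have Kc: "?K \<subseteq> fst c" using r(2) chart_inv_in[OF A] by blast
  have "vector_field A X"
    unfolding vector_field_def
  proof (intro conjI ballI)
    fix q assume "q \<in> points A"
    then obtain d where d: "d \<in> A" "q \<in> fst d" by (auto simp: points_def)
    show "X q \<in> tangent_space A q"
    proof (cases "q \<in> fst c")
      case True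
      then show ?thesis by (simp add: X_def tangent_space_eq[OF A])
    next
      case False
      then have "X q = coord_vec d q 0" by (simp add: X_def coord_vec_0)
      then show ?thesis using tangent_space_eq[OF A(1) d] by simp
    qed
  next
    fix d assume d: "d \<in> A"
    let ?U = "snd d ` (fst d \<inter> fst c)" and ?W = "snd d ` (fst d \<inter> - ?K)" and ?V = "snd c ` (fst c \<inter> fst d)"
    let ?t = "\<lambda>x. snd d (chart_inv c x)"
    have oU: "open ?U" and oV: "open ?V" and oW: "open ?W"
      using overlap_open[OF A(1) d chart_open(1)[OF A]] overlap_open[OF A chart_open(1)[OF A(1) d]]
        overlap_open[OF A(1) d K] by auto
    have "smooth_on ?V (\<lambda>x. bump ?a r x *\<^sub>R fderiv ?t x v)"
      by (intro smooth_on_scaleR[OF oV] smooth_on_subset[OF bump_smooth subset_UNIV]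
          smooth_on_fderiv transition_smooth[OF A d])
    then have "smooth_on ?U (\<lambda>y. bump ?a r (snd c (chart_inv d y)) *\<^sub>R fderiv ?t (snd c (chart_inv d y)) v)"
      by (rule smooth_on_compose[OF oU oV _ transition_smooth[OF A(1) d A(2)]])
        (use overlap_image[OF A(1) d, of "fst c"] chart_inv_in[OF A(1) d] in auto)
    \<comment> \<open>On the overlap, the derivative of the transition map carries the components in
      \<open>c\<close> to those in \<open>d\<close>.\<close>
    moreover have "coord_field d X y = bump ?a r (snd c (chart_inv d y)) *\<^sub>R fderiv ?t (snd c (chart_inv d y)) v"
      if y: "y \<in> ?U" for y
    proof -
      obtain q where q: "q \<in> fst d" "q \<in> fst c" "y = snd d q" using y by auto
      have iq: "chart_inv d y = q" using chart_inv_snd[OF A(1) d q(1)] q(3) by simp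
      have "snd c q \<in> ?V" using q by auto
      then have l: "linear (fderiv ?t (snd c q))"
        using smooth_on_linear_fderiv[OF transition_smooth[OF A d]] by blast
      have "X q = coord_vec d q (fderiv ?t (snd c q) (bump ?a r (snd c q) *\<^sub>R v))"
        using coord_vec_change[OF A(1) d A(2) q(1,2)] q(2) by (simp add: X_def)
      then have "coord_field d X y = fderiv ?t (snd c q) (bump ?a r (snd c q) *\<^sub>R v)"
        unfolding q(3) by (rule coord_field_at[OF A(1) d q(1)])
      then show ?thesis unfolding iq by (simp add: linear_cmul[OF l])
    qed
    ultimately have sU: "smooth_on ?U (coord_field d X)"
      using smooth_on_cong[OF oU, of "coord_field d X"] by simp
    have "coord_field d X y = 0" if y: "y \<in> ?W" for y
    proof -
      obtain q where q: "q \<in> fst d" "q \<notin> ?K" "y = snd d q" using y by auto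
      have "X q = coord_vec d q 0"
      proof (cases "q \<in> fst c")
        case True
        have "snd c q \<notin> cball ?a r" using q(2) chart_inv_snd[OF A True] by (metis imageI)
        then have "bump ?a r (snd c q) = 0" by (rule bump_outside[OF _ r(1)])
        then show ?thesis by (simp add: X_def coord_vec_0)
      next
        case False
        then show ?thesis by (simp add: X_def coord_vec_0)
      qed
      then show ?thesis unfolding q(3) by (rule coord_field_at[OF A(1) d q(1)])
    qed
    then have sW: "smooth_on ?W (coord_field d X)"
      using smooth_on_cong[OF oW, of "coord_field d X" "\<lambda>_. 0"] smooth_on_const by simp
    have "chart_image d = ?U \<union> ?W" using Kc unfolding chart_image_def by blast
    then show "smooth_on (chart_image d) (coord_field d X)"
      using smooth_on_Un[OF oU oW sU sW] by simp
  qed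
  moreover have "X p = coord_vec c p v" using p by (simp add: X_def bump_center[OF r(1)])
  ultimately show ?thesis using that by blast
qed

section \<open>Product charts and the warped metric in them\<close>

definition product_chart :: "('p, 'e) chart \<Rightarrow> ('q, 'f) chart \<Rightarrow> ('p \<times> 'q, 'e \<times> 'f) chart" where
  "product_chart c d = (fst c \<times> fst d, map_prod (snd c) (snd d))"

lemma product_chart_in_atlas: "c \<in> A \<Longrightarrow> d \<in> B \<Longrightarrow> product_chart c d \<in> product_atlas A B"
  unfolding product_chart_def product_atlas_def by blast

lemma chart_image_product: "chart_image (product_chart c d) = chart_image c \<times> chart_image d"
  unfolding chart_image_def product_chart_def by force

context
  fixes A :: "('p::{t2_space,second_countable_topology}, 'e::euclidean_space) chart set"
    and B :: "('q::{t2_space,second_countable_topology}, 'd::euclidean_space) chart set"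
    and c d
  assumes A: "smooth_manifold A" "c \<in> A" and B: "smooth_manifold B" "d \<in> B"
begin

lemma chart_inv_product:
  assumes z: "z \<in> chart_image c \<times> chart_image d"
  shows "chart_inv (product_chart c d) z = (chart_inv c (fst z), chart_inv d (snd z))"
proof -
  have "inj_on (snd c) (fst c)" "inj_on (snd d) (fst d)"
    using chart_inv_snd[OF A] chart_inv_snd[OF B] by (auto intro: inj_on_inverseI)
  then have "inj_on (map_prod (snd c) (snd d)) (fst c \<times> fst d)" by (rule map_prod_inj_on)
  then show ?thesis
    unfolding chart_inv_def product_chart_def fst_conv snd_conv
    by (rule inv_into_f_eq)
      (use z chart_inv_in[OF A] chart_inv_in[OF B] snd_chart_inv[OF A] snd_chart_inv[OF B] in
        \<open>auto simp: chart_inv_def[symmetric]\<close>)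
qed

context
  fixes z assumes z: "z \<in> chart_image c \<times> chart_image d"
begin

lemma snd_product_chart_inv: "snd (product_chart c d) (chart_inv (product_chart c d) z) = z"
  unfolding chart_inv_product[OF z]
  using z snd_chart_inv[OF A] snd_chart_inv[OF B] by (auto simp: product_chart_def)

lemma open_product: "open (chart_image c \<times> chart_image d)"
  by (intro open_Times chart_open(2)[OF A] chart_open(2)[OF B])

text \<open>As an equation of operators on all functions this includes the default value 0, so
  \<open>k \<circ> fst\<close> has to be differentiable exactly when \<open>k\<close> is, both in
  charts.\<close>

lemma pushforward_fst:
  "pushforward fst (coord_vec (product_chart c d) (chart_inv (product_chart c d) z) w)
    = coord_vec c (chart_inv c (fst z)) (fst w)"
proof
  fix k :: "'p \<Rightarrow> real"
  have x: "snd c (chart_inv c (fst z)) = fst z" using z snd_chart_inv[OF A] by auto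
  have e: "((k \<circ> fst) \<circ> chart_inv (product_chart c d)) y = (k \<circ> chart_inv c) (fst y)"
    if "y \<in> chart_image c \<times> chart_image d" for y
    using chart_inv_product[OF that] by simp
  have 1: "(((k \<circ> fst) \<circ> chart_inv (product_chart c d)) has_derivative (\<lambda>w. fderiv (k \<circ> chart_inv c) (fst z) (fst w))) (at z)"
    if "(k \<circ> chart_inv c) differentiable (at (fst z))"
    by (rule has_derivative_transform_within_open[OF has_derivative_compose_fst[OF has_derivative_fderiv[OF that]] open_product z])
      (rule e[symmetric])
  have 2: "(k \<circ> chart_inv c) differentiable (at (fst z))"
    if "((k \<circ> fst) \<circ> chart_inv (product_chart c d)) differentiable (at z)"
  proof -
    obtain L where L0: "(((k \<circ> fst) \<circ> chart_inv (product_chart c d)) has_derivative L) (at z)"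
      using \<open>_ differentiable _\<close> unfolding differentiable_def by blast
    then have L: "((\<lambda>y. (k \<circ> chart_inv c) (fst y)) has_derivative L) (at (fst z, snd z))"
      using has_derivative_transform_within_open[OF L0 open_product z e] by simp
    \<comment> \<open>Restriction to the slice through \<open>z\<close> recovers \<open>k\<close>
      from \<open>k \<circ> fst\<close>.\<close>
    have "((\<lambda>x. (x, snd z)) has_derivative (\<lambda>v. (v, 0))) (at (fst z))"
      by (intro has_derivative_Pair has_derivative_ident has_derivative_const)
    from has_derivative_compose[OF this L] show ?thesis by (auto simp: differentiable_def comp_def)
  qed
  have "((k \<circ> fst) \<circ> chart_inv (product_chart c d)) differentiable (at z) \<longleftrightarrow> (k \<circ> chart_inv c) differentiable (at (fst z))"
    using 1 2 unfolding differentiable_def by blast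
  then show "pushforward fst (coord_vec (product_chart c d) (chart_inv (product_chart c d) z) w) k
      = coord_vec c (chart_inv c (fst z)) (fst w) k"
    using fderiv_eqI[OF 1] unfolding pushforward_def coord_vec_def x snd_product_chart_inv by simp
qed

lemma pushforward_snd:
  "pushforward snd (coord_vec (product_chart c d) (chart_inv (product_chart c d) z) w)
    = coord_vec d (chart_inv d (snd z)) (snd w)"
proof
  fix k :: "'q \<Rightarrow> real"
  have x: "snd d (chart_inv d (snd z)) = snd z" using z snd_chart_inv[OF B] by auto
  have e: "((k \<circ> snd) \<circ> chart_inv (product_chart c d)) y = (k \<circ> chart_inv d) (snd y)"
    if "y \<in> chart_image c \<times> chart_image d" for y
    using chart_inv_product[OF that] by simp
  have 1: "(((k \<circ> snd) \<circ> chart_inv (product_chart c d)) has_derivative (\<lambda>w. fderiv (k \<circ> chart_inv d) (snd z) (snd w))) (at z)"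
    if "(k \<circ> chart_inv d) differentiable (at (snd z))"
    by (rule has_derivative_transform_within_open[OF has_derivative_compose_snd[OF has_derivative_fderiv[OF that]] open_product z])
      (rule e[symmetric])
  have 2: "(k \<circ> chart_inv d) differentiable (at (snd z))"
    if "((k \<circ> snd) \<circ> chart_inv (product_chart c d)) differentiable (at z)"
  proof -
    obtain L where L0: "(((k \<circ> snd) \<circ> chart_inv (product_chart c d)) has_derivative L) (at z)"
      using \<open>_ differentiable _\<close> unfolding differentiable_def by blast
    then have L: "((\<lambda>y. (k \<circ> chart_inv d) (snd y)) has_derivative L) (at (fst z, snd z))"
      using has_derivative_transform_within_open[OF L0 open_product z e] by simp
    have "((\<lambda>x. (fst z, x)) has_derivative (\<lambda>v. (0, v))) (at (snd z))"
      by (intro has_derivative_Pair has_derivative_ident has_derivative_const)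
    from has_derivative_compose[OF this L] show ?thesis by (auto simp: differentiable_def comp_def)
  qed
  have "((k \<circ> snd) \<circ> chart_inv (product_chart c d)) differentiable (at z) \<longleftrightarrow> (k \<circ> chart_inv d) differentiable (at (snd z))"
    using 1 2 unfolding differentiable_def by blast
  then show "pushforward snd (coord_vec (product_chart c d) (chart_inv (product_chart c d) z) w) k
      = coord_vec d (chart_inv d (snd z)) (snd w) k"
    using fderiv_eqI[OF 1] unfolding pushforward_def coord_vec_def x snd_product_chart_inv by simp
qed

lemma coord_metric_warped:
  "coord_metric (product_chart c d) (warped_metric g1 f g2) z u v =
    coord_metric c g1 (fst z) (fst u) (fst v)
    + ((f \<circ> chart_inv c) (fst z))\<^sup>2 * coord_metric d g2 (snd z) (snd u) (snd v)"
  unfolding coord_metric_def warped_metric_def pullback_metric_def pushforward_fst pushforward_snd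
  unfolding chart_inv_product[OF z] by simp

end

end

section \<open>From charts to manifolds\<close>

lemma constant_if_fderiv_0:
  fixes A :: "('p::{t2_space,second_countable_topology}, 'e::euclidean_space) chart set" and f :: "'p \<Rightarrow> real"
  assumes A: "smooth_manifold A" and conn: "connected (points A)" and f: "smooth_function A f"
    and 0: "\<And>c x u. c \<in> A \<Longrightarrow> x \<in> chart_image c \<Longrightarrow> u \<in> Basis \<Longrightarrow> fderiv (f \<circ> chart_inv c) x u = 0"
  shows "\<exists>k. \<forall>p\<in>points A. f p = k"
proof -
  have loc: "\<forall>\<^sub>F q in at p within points A. f p = f q" if "p \<in> points A" for p
  proof -
    obtain c where c: "c \<in> A" and p: "p \<in> fst c" using \<open>p \<in> points A\<close> by (auto simp: points_def)
    obtain r where r: "r > 0" "ball (snd c p) r \<subseteq> chart_image c"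
      using chart_open(2)[OF A c] snd_in_chart_image[OF p] openE by blast
    have d: "((f \<circ> chart_inv c) has_derivative (\<lambda>v. 0)) (at x within ball (snd c p) r)" if "x \<in> ball (snd c p) r" for x
    proof -
      have x: "x \<in> chart_image c" using that r by auto
      have s: "smooth_on (chart_image c) (f \<circ> chart_inv c)" using f c unfolding smooth_function_def by blast
      have "fderiv (f \<circ> chart_inv c) x v = 0" for v
        by (subst linear_Basis_expansion[OF smooth_on_linear_fderiv[OF s x]]) (simp add: 0[OF c x])
      then have "fderiv (f \<circ> chart_inv c) x = (\<lambda>v. 0)" by (simp add: fun_eq_iff)
      then have "((f \<circ> chart_inv c) has_derivative (\<lambda>v. 0)) (at x)"
        using smooth_on_has_derivative[OF s x] by simp
      then show ?thesis by (rule has_derivative_at_withinI)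
    qed
    \<comment> \<open>A vanishing derivative gives constancy on a convex set; the chart image itself
      may be disconnected, hence the ball.\<close>
    obtain k where k: "\<And>x. x \<in> ball (snd c p) r \<Longrightarrow> (f \<circ> chart_inv c) x = k"
      using has_derivative_zero_constant[OF convex_ball d] by blast
    let ?N = "fst c \<inter> snd c -` ball (snd c p) r"
    have N: "open ?N" "p \<in> ?N"
      using continuous_open_preimage[OF chart_continuous[OF A c] chart_open(1)[OF A c] open_ball] p r by auto
    have fk: "f q = k" if "q \<in> ?N" for q
      using k[of "snd c q"] chart_inv_snd[OF A c, of q] that by simp
    show ?thesis
      unfolding eventually_at_topological using N fk by metis
  qed
  show ?thesis
  proof (cases "points A = {}")
    case False
    then obtain p where "p \<in> points A" by blast
    then show ?thesis using connected_local_const[OF conn _ _ ballI[OF loc]] by metis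
  qed simp
qed

lemma warped_product_chart:
  assumes M1: "pseudo_riemannian_manifold A1 g1" and M2: "pseudo_riemannian_manifold A2 g2"
    and f: "smooth_function A1 f" "\<forall>p\<in>points A1. f p > 0" and c: "c \<in> A1" and d: "d \<in> A2"
  shows "warped_product (coord_metric c g1) (chart_image c) (coord_metric d g2) (chart_image d)
    (f \<circ> chart_inv c) (coord_metric (product_chart c d) (warped_metric g1 f g2))"
proof (intro warped_product.intro warped_product_axioms.intro local_metric_coord_metric[OF M1 c] local_metric_coord_metric[OF M2 d])
  have A1: "smooth_manifold A1" and A2: "smooth_manifold A2"
    using M1 M2 unfolding pseudo_riemannian_manifold_def by auto
  show "smooth_on (chart_image c) (f \<circ> chart_inv c)" using f(1) c unfolding smooth_function_def by blast
  show "0 < (f \<circ> chart_inv c) x" if "x \<in> chart_image c" for x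
    using f(2) c chart_inv_in[OF A1 c that] by (auto simp: points_def)
  show "coord_metric (product_chart c d) (warped_metric g1 f g2) z u v =
    coord_metric c g1 (fst z) (fst u) (fst v)
    + ((f \<circ> chart_inv c) (fst z))\<^sup>2 * coord_metric d g2 (snd z) (snd u) (snd v)"
    if "z \<in> chart_image c \<times> chart_image d" for z u v
    by (rule coord_metric_warped[OF A1 c A2 d that])
qed

theorem theorem6:
  fixes A1 :: "('p::{t2_space,second_countable_topology}, 'e::euclidean_space) chart set"
    and A2 :: "('q::{t2_space,second_countable_topology}, 'd::euclidean_space) chart set"
    and g1 :: "'p metric_field"
    and g2 :: "'q metric_field"
    and f :: "'p \<Rightarrow> real"
  assumes M1: "pseudo_riemannian_manifold A1 g1"
    and M2: "pseudo_riemannian_manifold A2 g2"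
    and conn: "connected (points A1)"
    and dim: "DIM('e \<times> 'd) \<ge> 3"
    and f_smooth: "smooth_function A1 f"
    and f_pos: "\<forall>p\<in>points A1. f p > 0"
    and div_free: "concircular_divergence_free (product_atlas A1 A2) (warped_metric g1 f g2)"
  shows
    "((\<forall>X Y Z. vector_field A1 X \<longrightarrow> vector_field A1 Y \<longrightarrow> vector_field A1 Z \<longrightarrow>
         (\<forall>c\<in>A1. \<forall>p\<in>fst c.
            curvature_grad c g1 f X Y Z p =
              Y p f * normalized_hessian c g1 f X Z p - X p f * normalized_hessian c g1 f Y Z p))
      \<longrightarrow> concircular_divergence_free A1 g1)
     \<and> concircular_divergence_free A2 g2
     \<and> ((\<exists>k. \<forall>p\<in>points A1. f p = k) \<or> einstein A2 g2)"
proof (intro conjI impI)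
  have A1: "smooth_manifold A1" and A2: "smooth_manifold A2"
    using M1 M2 unfolding pseudo_riemannian_manifold_def by auto
  note loc1 = local_metric_coord_metric[OF M1] and loc2 = local_metric_coord_metric[OF M2]
  note warped = warped_product_chart[OF M1 M2 f_smooth f_pos]
  let ?G = "\<lambda>c d. coord_metric (product_chart c d) (warped_metric g1 f g2)"
  have codazzi: "ricci_codazzi (?G c d) z i j k = 0"
    if c: "c \<in> A1" and d: "d \<in> A2" and z: "z \<in> chart_image c \<times> chart_image d"
      and b: "i \<in> Basis" "j \<in> Basis" "k \<in> Basis" for c d z i j k
  proof -
    interpret warped_product "coord_metric c g1" "chart_image c" "coord_metric d g2" "chart_image d"
      "f \<circ> chart_inv c" "?G c d" by (rule warped[OF c d])
    show ?thesis
    proof (rule total.ricci_codazzi_if_div4_concircular[OF z dim _ b])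
      fix i j k :: "'e \<times> 'd" assume "i \<in> Basis" "j \<in> Basis" "k \<in> Basis"
      then show "div4 (?G c d) (concircular (?G c d)) z i j k = 0"
        using div_free product_chart_in_atlas[OF c d] z
        unfolding concircular_divergence_free_def chart_image_product[symmetric] by blast
    qed
  qed
  \<comment> \<open>A point of one factor becomes a point of the product only together with a
    companion in the other; nonemptiness of both manifolds supplies the companions.\<close>
  obtain c0 p0 where c0: "c0 \<in> A1" "p0 \<in> fst c0"
    using A1 unfolding smooth_manifold_def points_def by blast
  obtain d0 q0 where d0: "d0 \<in> A2" "q0 \<in> fst d0"
    using A2 unfolding smooth_manifold_def points_def by blast

  show "concircular_divergence_free A2 g2"
    unfolding concircular_divergence_free_def
  proof (intro ballI)
    fix d y and i j k :: 'd
    assume d: "d \<in> A2" and y: "y \<in> chart_image d" and b: "i \<in> Basis" "j \<in> Basis" "k \<in> Basis"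
    interpret warped_product "coord_metric c0 g1" "chart_image c0" "coord_metric d g2" "chart_image d"
      "f \<circ> chart_inv c0" "?G c0 d" by (rule warped[OF c0(1) d])
    have z: "(snd c0 p0, y) \<in> chart_image c0 \<times> chart_image d" using y snd_in_chart_image[OF c0(2)] by simp
    show "div4 (coord_metric d g2) (concircular (coord_metric d g2)) y i j k = 0"
    proof (rule fibre.div4_concircular_if_ricci_codazzi[OF y _ b])
      fix i j k :: 'd assume "i \<in> Basis" "j \<in> Basis" "k \<in> Basis"
      then show "ricci_codazzi (coord_metric d g2) y i j k = 0"
        using codazzi[OF c0(1) d z, of "(0, i)" "(0, j)" "(0, k)"] ricci_codazzi_vvv[OF z]
        by (simp add: Basis_prod_def)
    qed
  qed

  show "concircular_divergence_free A1 g1"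
    if hyp: "\<forall>X Y Z. vector_field A1 X \<longrightarrow> vector_field A1 Y \<longrightarrow> vector_field A1 Z \<longrightarrow>
         (\<forall>c\<in>A1. \<forall>p\<in>fst c.
            curvature_grad c g1 f X Y Z p =
              Y p f * normalized_hessian c g1 f X Z p - X p f * normalized_hessian c g1 f Y Z p)"
    unfolding concircular_divergence_free_def
  proof (intro ballI)
    fix c x and i j k :: 'e
    assume c: "c \<in> A1" and x: "x \<in> chart_image c" and b: "i \<in> Basis" "j \<in> Basis" "k \<in> Basis"
    interpret warped_product "coord_metric c g1" "chart_image c" "coord_metric d0 g2" "chart_image d0"
      "f \<circ> chart_inv c" "?G c d0" by (rule warped[OF c d0(1)])
    let ?h = "f \<circ> chart_inv c" and ?p = "chart_inv c x"
    have p: "?p \<in> fst c" and px: "snd c ?p = x"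
      using chart_inv_in[OF A1 c x] snd_chart_inv[OF A1 c x] by auto
    have z: "(x, snd d0 q0) \<in> chart_image c \<times> chart_image d0" using x snd_in_chart_image[OF d0(2)] by simp
    show "div4 (coord_metric c g1) (concircular (coord_metric c g1)) x i j k = 0"
    proof (rule base.div4_concircular_if_ricci_codazzi[OF x _ b])
      fix i j k :: 'e assume b: "i \<in> Basis" "j \<in> Basis" "k \<in> Basis"
      \<comment> \<open>Global fields through the coordinate vectors at \<open>?p\<close>: both
        sides of the hypothesis depend only on the values there, so it becomes an identity for
        \<open>i\<close>, \<open>j\<close>, \<open>k\<close>.\<close>
      obtain X Y Z where X: "vector_field A1 X" "X ?p = coord_vec c ?p i"
        and Y: "vector_field A1 Y" "Y ?p = coord_vec c ?p j"
        and Z: "vector_field A1 Z" "Z ?p = coord_vec c ?p k"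
        using vector_field_extension[OF A1 c p] by metis
      have at: "coord_field c X x = i" "coord_field c Y x = j" "coord_field c Z x = k"
        using coord_field_at[OF A1 c p] X(2) Y(2) Z(2) unfolding px by blast+
      have sm: "smooth_on (chart_image c) (coord_field c X)" "smooth_on (chart_image c) (coord_field c Y)"
        using X(1) Y(1) c unfolding vector_field_def by blast+
      have df: "coord_vec c ?p v f = fderiv ?h x v" for v
        using smooth_on_differentiable[OF h_smooth x] by (simp add: coord_vec_def px)
      \<comment> \<open>The connection does not differentiate its first argument, so the field
        \<open>V\<close> may be replaced by the constant field with the same value at
        \<open>x\<close>.\<close>
      have nh: "normalized_hessian c g1 f V Z ?p = 1 / ?h x * hess (coord_metric c g1) ?h x v k"
        if "coord_field c V x = v" for V v
        by (simp add: normalized_hessian_def hessian_def hess_def nabla_def px at that)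
      have "curvature_grad c g1 f X Y Z ?p = coord_metric c g1 x (curvature_op (coord_metric c g1) x i j (grad x)) k"
        unfolding curvature_grad_def curvature4_def px
          base.curvature_eq[OF x sm base.gradient_smooth[OF h_smooth]] at ..
      moreover have "curvature_grad c g1 f X Y Z ?p =
          Y ?p f * normalized_hessian c g1 f X Z ?p - X ?p f * normalized_hessian c g1 f Y Z ?p"
        using hyp X(1) Y(1) Z(1) c p by blast
      ultimately have "coord_metric c g1 x (curvature_op (coord_metric c g1) x i j (grad x)) k
        = fderiv ?h x j * (1 / ?h x * hess (coord_metric c g1) ?h x i k)
          - fderiv ?h x i * (1 / ?h x * hess (coord_metric c g1) ?h x j k)"
        unfolding X(2) Y(2) df nh[OF at(1)] nh[OF at(2)] by simp
      then show "ricci_codazzi (coord_metric c g1) x i j k = 0"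
        using codazzi[OF c d0(1) z, of "(i, 0)" "(j, 0)" "(k, 0)"] ricci_codazzi_hhh[OF z, of i j k] b
        by (simp add: Basis_prod_def)
    qed
  qed

  show "(\<exists>k. \<forall>p\<in>points A1. f p = k) \<or> einstein A2 g2"
  proof (cases "\<exists>c\<in>A1. \<exists>x\<in>chart_image c. \<exists>u\<in>Basis. fderiv (f \<circ> chart_inv c) x u \<noteq> 0")
    case False
    then show ?thesis using constant_if_fderiv_0[OF A1 conn f_smooth] by blast
  next
    case True
    then obtain c x u where c: "c \<in> A1" and x: "x \<in> chart_image c" and u: "u \<in> Basis"
      and nz: "fderiv (f \<circ> chart_inv c) x u \<noteq> 0" by blast
    let ?h = "f \<circ> chart_inv c"
    interpret w0: warped_product "coord_metric c g1" "chart_image c" "coord_metric d0 g2" "chart_image d0"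
      ?h "?G c d0" by (rule warped[OF c d0(1)])
    \<comment> \<open>The coefficient of the fibre metric in \<open>ricci_codazzi_vhv\<close>. It is
      built from base data and the fibre dimension, so although it is defined through the chart
      \<open>d0\<close>, it is the same in every fibre chart \<open>d\<close>; division by the
      nonzero derivative then gives one Einstein constant.\<close>
    define \<nu> where "\<nu> = fderiv ?h x u * (1 / ?h x) * w0.ricci_shift x - fderiv w0.ricci_shift x u
      - ?h x * w0.ricci_base x u (gradient (coord_metric c g1) ?h x)"
    have h: "?h x \<noteq> 0" using w0.h_pos[OF x] by simp
    have "ricci (coord_metric d g2) y a b = (\<nu> * ?h x / fderiv ?h x u) * coord_metric d g2 y a b"
      if d: "d \<in> A2" and y: "y \<in> chart_image d" and ab: "a \<in> Basis" "b \<in> Basis" for d y a b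
    proof -
      interpret w: warped_product "coord_metric c g1" "chart_image c" "coord_metric d g2" "chart_image d"
        ?h "?G c d" by (rule warped[OF c d])
      have z: "(x, y) \<in> chart_image c \<times> chart_image d" using x y by simp
      have "fderiv ?h x u * (1 / ?h x) * ricci (coord_metric d g2) y a b = \<nu> * coord_metric d g2 y a b"
        using codazzi[OF c d z, of "(0, a)" "(u, 0)" "(0, b)"] w.ricci_codazzi_vhv[OF z, of a u b] u ab
        by (simp add: Basis_prod_def \<nu>_def)
      then show ?thesis using h nz by (simp add: field_simps)
    qed
    then have "einstein A2 g2" unfolding einstein_def by blast
    then show ?thesis ..
  qed
qed

end
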